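(* Let $m,n,d$ be positive integers with $\gcd(m,n)=1$, $d\ge2$, $n\ge2$, let $\kappa_0=-\frac mn$, $\tau=(dn-1,n)$ and $N=(d+1)n-1$ (so that $\tau$ is a partition of $N$). Then there are no singular polynomials for $\kappa_0$ of isotype $\tau$.
   Context: $S_N$ acts on polynomials in $x=(x_1,\ldots,x_N)$ by $(wf)(x)=f(xw)$, $(xw)_i=x_{w(i)}$; $(i,j)$ is the transposition. Dunkl operators: $\mathcal D_i(\kappa)f=\frac{\partial f}{\partial x_i}+\kappa\sum_{j\ne i}\frac{f-(i,j)f}{x_i-x_j}$, $1\le i\le N$. A singular polynomial for $\kappa_0\in\mathbb Q$ is a nonzero polynomial $p$ with rational coefficients such that $\mathcal D_i(\kappa_0)p=0$ for $1\le i\le N$. Irreducible representations of $S_N$ are labeled in the standard way by partitions of $N$ (with $(N)$ trivial). A polynomial is of isotype $\tau$ if it lies in an irreducible $S_N$-submodule, corresponding to $\tau$, of the space of homogeneous polynomials of some degree. *)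

theory Defs
  imports Complex_Main "HOL-Library.Poly_Mapping" "HOL-Combinatorics.Permutations"
begin

section \<open>Formal linear combinations over the rationals\<close>

definition qscale :: "rat \<Rightarrow> ('a \<Rightarrow>\<^sub>0 rat) \<Rightarrow> ('a \<Rightarrow>\<^sub>0 rat)" where
  "qscale c = Poly_Mapping.map ((*) c)"

text \<open>The linear extension of a map \<open>g\<close> between basis elements.\<close>

definition lin_ext :: "('a \<Rightarrow> 'b) \<Rightarrow> ('a \<Rightarrow>\<^sub>0 rat) \<Rightarrow> ('b \<Rightarrow>\<^sub>0 rat)" where
  "lin_ext g p = (\<Sum>a\<in>Poly_Mapping.keys p. Poly_Mapping.single (g a) (Poly_Mapping.lookup p a))"

lemma lookup_qscale [simp]: "Poly_Mapping.lookup (qscale c p) a = c * Poly_Mapping.lookup p a"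
  unfolding qscale_def by (simp add: Poly_Mapping.map.rep_eq when_def)

lemma qscale_vector_space: "vector_space (qscale :: rat \<Rightarrow> ('a \<Rightarrow>\<^sub>0 rat) \<Rightarrow> _)"
  by unfold_locales (auto intro!: poly_mapping_eqI simp: lookup_add algebra_simps)

lemma sum_keys_superset:
  fixes p :: "'a \<Rightarrow>\<^sub>0 rat" and F :: "'a \<Rightarrow> rat \<Rightarrow> 'c::comm_monoid_add"
  assumes "finite S" "Poly_Mapping.keys p \<subseteq> S" "\<And>a. F a 0 = 0"
  shows "(\<Sum>a\<in>Poly_Mapping.keys p. F a (Poly_Mapping.lookup p a)) = (\<Sum>a\<in>S. F a (Poly_Mapping.lookup p a))"
  using assms by (intro sum.mono_neutral_left) (auto simp: in_keys_iff)

lemma sum_keys_add: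
  fixes p q :: "'a \<Rightarrow>\<^sub>0 rat" and F :: "'a \<Rightarrow> rat \<Rightarrow> 'c::comm_monoid_add"
  assumes "\<And>a. F a 0 = 0" "\<And>a c d. F a (c + d) = F a c + F a d"
  shows "(\<Sum>a\<in>Poly_Mapping.keys (p + q). F a (Poly_Mapping.lookup (p + q) a)) =
    (\<Sum>a\<in>Poly_Mapping.keys p. F a (Poly_Mapping.lookup p a)) + (\<Sum>a\<in>Poly_Mapping.keys q. F a (Poly_Mapping.lookup q a))"
proof -
  let ?S = "Poly_Mapping.keys p \<union> Poly_Mapping.keys q"
  have "Poly_Mapping.keys (p + q) \<subseteq> ?S" by (rule Poly_Mapping.keys_add)
  then show ?thesis
    using sum_keys_superset[of ?S "p + q" F] sum_keys_superset[of ?S p F]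
      sum_keys_superset[of ?S q F] assms
    by (simp add: lookup_add sum.distrib)
qed

lemma lin_ext_single [simp]: "lin_ext g (Poly_Mapping.single a c) = Poly_Mapping.single (g a) c"
  by (simp add: lin_ext_def)

lemma lin_ext_add: "lin_ext g (p + q) = lin_ext g p + lin_ext g q"
  unfolding lin_ext_def
  by (rule sum_keys_add[where F = "\<lambda>a c. Poly_Mapping.single (g a) c"]) (simp_all add: single_add)

lemma poly_mapping_single_induct [case_names zero add]:
  fixes p :: "'a \<Rightarrow>\<^sub>0 'b::comm_monoid_add"
  assumes "P 0" "\<And>a c p. P p \<Longrightarrow> P (Poly_Mapping.single a c + p)"
  shows "P p"
proof (induction p rule: update_induct)
  case const
  then show ?case by (rule assms)
next
  case (update f a b)
  have "Poly_Mapping.update a b f = Poly_Mapping.single a b + f"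
    using update
    by (auto intro!: poly_mapping_eqI simp: lookup_update lookup_add lookup_single when_def in_keys_iff)
  then show ?case using assms update by simp
qed


section \<open>Polynomials, the action of the symmetric group, Dunkl operators\<close>

text \<open>A monomial is its exponent function, a polynomial a finitely supported family of
  rational coefficients. The variables of a polynomial in \<open>N\<close> variables are indexed by
  \<open>{1..N}\<close>, and \<open>S\<^sub>N\<close> consists of the functions \<open>w\<close> with \<open>w permutes {1..N}\<close>.\<close>

type_synonym poly_q = "(nat \<Rightarrow>\<^sub>0 nat) \<Rightarrow>\<^sub>0 rat"

definition X :: "nat \<Rightarrow> poly_q" where
  "X i = Poly_Mapping.single (Poly_Mapping.single i 1) 1"

definition polys :: "nat \<Rightarrow> poly_q set" where
  "polys N = {p. \<forall>a\<in>Poly_Mapping.keys p. Poly_Mapping.keys a \<subseteq> {1..N}}"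

definition homogeneous_polys :: "nat \<Rightarrow> nat \<Rightarrow> poly_q set" where
  "homogeneous_polys N k = {p \<in> polys N. \<forall>a\<in>Poly_Mapping.keys p. (\<Sum>i\<in>Poly_Mapping.keys a. Poly_Mapping.lookup a i) = k}"

definition poly_eval :: "poly_q \<Rightarrow> (nat \<Rightarrow> rat) \<Rightarrow> rat" where
  "poly_eval p x = (\<Sum>a\<in>Poly_Mapping.keys p. Poly_Mapping.lookup p a * (\<Prod>i\<in>Poly_Mapping.keys a. x i ^ Poly_Mapping.lookup a i))"

text \<open>\<open>w\<close> sends the variable \<open>x\<^sub>i\<close> to \<open>x\<^bsub>w i\<^esub>\<close>, so the exponent of \<open>x\<^sub>j\<close> in the image of a
  monomial is the exponent of \<open>x\<^sub>i\<close> with \<open>i = w\<^sup>-\<^sup>1 j\<close> in the monomial itself. That this is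
  \<open>(w f)(x) = f(x w)\<close> with \<open>(x w)\<^sub>i = x\<^bsub>w i\<^esub>\<close> is lemma \<open>poly_eval_perm_act\<close>.\<close>

definition perm_act :: "(nat \<Rightarrow> nat) \<Rightarrow> poly_q \<Rightarrow> poly_q" where
  "perm_act w = lin_ext (Poly_Mapping.map_key (inv w))"

definition partial_deriv :: "nat \<Rightarrow> poly_q \<Rightarrow> poly_q" where
  "partial_deriv i p = (\<Sum>a\<in>Poly_Mapping.keys p.
     Poly_Mapping.single (a - Poly_Mapping.single i 1) (of_nat (Poly_Mapping.lookup a i) * Poly_Mapping.lookup p a))"

text \<open>The quotient of \<open>f - (i,j) f\<close> by \<open>x\<^sub>i - x\<^sub>j\<close>; see \<open>div_diff_iff\<close> for existence and
  uniqueness.\<close>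

definition div_diff :: "nat \<Rightarrow> nat \<Rightarrow> poly_q \<Rightarrow> poly_q" where
  "div_diff i j f = (THE g. g * (X i - X j) = f - perm_act (transpose i j) f)"

definition dunkl :: "nat \<Rightarrow> rat \<Rightarrow> nat \<Rightarrow> poly_q \<Rightarrow> poly_q" where
  "dunkl N \<kappa> i f = partial_deriv i f + qscale \<kappa> (\<Sum>j\<in>{1..N} - {i}. div_diff i j f)"

definition singular_poly :: "nat \<Rightarrow> rat \<Rightarrow> poly_q \<Rightarrow> bool" where
  "singular_poly N \<kappa> p \<longleftrightarrow> p \<in> polys N \<and> p \<noteq> 0 \<and> (\<forall>i\<in>{1..N}. dunkl N \<kappa> i p = 0)"

lemma lookup_map_key_inv:
  assumes "bij w"
  shows "Poly_Mapping.lookup (Poly_Mapping.map_key (inv w) a) j = Poly_Mapping.lookup a (inv w j)"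
  using assms by (simp add: map_key.rep_eq bij_is_inj bij_imp_bij_inv)

lemma map_key_inv_single:
  assumes "bij w"
  shows "Poly_Mapping.map_key (inv w) (Poly_Mapping.single i k) = Poly_Mapping.single (w i) k"
  using assms
  by (auto intro!: poly_mapping_eqI simp: lookup_map_key_inv lookup_single when_def bij_inv_eq_iff
      inv_f_f bij_is_inj)

lemma map_key_inv_add:
  assumes "bij w"
  shows "Poly_Mapping.map_key (inv w) (a + b) =
    Poly_Mapping.map_key (inv w) a + Poly_Mapping.map_key (inv w) b"
  using assms by (auto intro!: poly_mapping_eqI simp: lookup_map_key_inv lookup_add)

lemma perm_act_add: "perm_act w (p + q) = perm_act w p + perm_act w q"
  by (simp add: perm_act_def lin_ext_add)

lemma perm_act_X: "bij w \<Longrightarrow> perm_act w (X i) = X (w i)"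
  by (simp add: perm_act_def X_def map_key_inv_single)

lemma perm_act_mult:
  assumes "bij w"
  shows "perm_act w (p * q) = perm_act w p * perm_act w q"
proof (induction p rule: poly_mapping_single_induct)
  case zero
  then show ?case by (simp add: perm_act_def lin_ext_def)
next
  case (add a c p)
  have "perm_act w (Poly_Mapping.single a c * q) = perm_act w (Poly_Mapping.single a c) * perm_act w q"
  proof (induction q rule: poly_mapping_single_induct)
    case zero
    then show ?case by (simp add: perm_act_def lin_ext_def)
  next
    case (add b d q)
    then show ?case
      using assms
      by (simp add: distrib_left perm_act_add mult_single)
         (simp add: perm_act_def mult_single map_key_inv_add)
  qed
  then show ?case using add by (simp add: distrib_right perm_act_add)
qed

lemma poly_eval_perm_act:
  assumes "bij w"
  shows "poly_eval (perm_act w f) x = poly_eval f (\<lambda>i. x (w i))"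
proof (induction f rule: poly_mapping_single_induct)
  case zero
  then show ?case by (simp add: perm_act_def lin_ext_def poly_eval_def)
next
  case (add a c p)
  have add_eval: "poly_eval (p + q) y = poly_eval p y + poly_eval q y" for p q y
    unfolding poly_eval_def
    by (rule sum_keys_add[where F = "\<lambda>a c. c * (\<Prod>i\<in>Poly_Mapping.keys a. y i ^ Poly_Mapping.lookup a i)"])
       (simp_all add: algebra_simps)
  have keys: "Poly_Mapping.keys (Poly_Mapping.map_key (inv w) a) = w ` Poly_Mapping.keys a"
    using assms by (auto simp: in_keys_iff lookup_map_key_inv image_iff bij_inv_eq_iff
      inv_f_f bij_is_inj intro!: bexI[of _ "inv w _"] simp: surj_f_inv_f bij_is_surj)
  have "poly_eval (perm_act w (Poly_Mapping.single a c)) x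
      = poly_eval (Poly_Mapping.single a c) (\<lambda>i. x (w i))"
    using assms
    by (auto simp: poly_eval_def perm_act_def keys lookup_map_key_inv inv_f_f bij_is_inj
       prod.reindex inj_on_subset[OF bij_is_inj])
  then show ?case using add by (simp add: perm_act_add add_eval)
qed

lemma partial_deriv_lookup:
  "Poly_Mapping.lookup (partial_deriv i p) a =
    of_nat (Suc (Poly_Mapping.lookup a i)) * Poly_Mapping.lookup p (a + Poly_Mapping.single i 1)"
proof (induction p rule: poly_mapping_single_induct)
  case zero
  then show ?case by (simp add: partial_deriv_def)
next
  case (add b c p)
  have add': "partial_deriv i (p + q) = partial_deriv i p + partial_deriv i q" for p q
    unfolding partial_deriv_def
    by (rule sum_keys_add[where F = "\<lambda>a c. Poly_Mapping.single (a - Poly_Mapping.single i 1)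
        (of_nat (Poly_Mapping.lookup a i) * c)"]) (simp_all add: single_add algebra_simps)
  have "Poly_Mapping.lookup (partial_deriv i (Poly_Mapping.single b c)) a =
    of_nat (Suc (Poly_Mapping.lookup a i)) * Poly_Mapping.lookup (Poly_Mapping.single b c) (a + Poly_Mapping.single i 1)"
  proof (cases "b = a + Poly_Mapping.single i 1")
    case True
    then show ?thesis by (simp add: partial_deriv_def lookup_add)
  next
    case False
    have "Poly_Mapping.lookup b i = 0" if "b - Poly_Mapping.single i 1 = a"
    proof (rule ccontr)
      assume "Poly_Mapping.lookup b i \<noteq> 0"
      then have "b = (b - Poly_Mapping.single i 1) + Poly_Mapping.single i 1"
        by (auto intro!: poly_mapping_eqI simp: lookup_add lookup_minus lookup_single when_def)
      with that False show False by simp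
    qed
    with False show ?thesis
      by (auto simp: partial_deriv_def lookup_single when_def)
  qed
  then show ?case using add by (simp add: add' lookup_add algebra_simps)
qed

lemma X_diff_nonzero: "i \<noteq> j \<Longrightarrow> X i - X j \<noteq> 0"
  by (auto simp: X_def dest!: arg_cong[where f = Poly_Mapping.keys] split: if_splits)

lemma X_diff_dvd: "X i - X j dvd f - perm_act (transpose i j) f"
proof -
  let ?s = "perm_act (transpose i j)"
  have bij: "bij (transpose i j)" by simp
  have mult: "X i - X j dvd f * g - ?s (f * g)"
    if "X i - X j dvd f - ?s f" "X i - X j dvd g - ?s g" for f g
  proof -
    have "f * g - ?s (f * g) = f * (g - ?s g) + ?s g * (f - ?s f)"
      by (simp add: perm_act_mult[OF bij] algebra_simps)
    then show ?thesis using that by simp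
  qed
  have const: "?s (Poly_Mapping.single 0 c) = Poly_Mapping.single 0 c" for c
    by (simp add: perm_act_def)
  have var: "X i - X j dvd X k - ?s (X k)" for k
  proof -
    have "X i - X j dvd X j - X i" by (metis minus_diff_eq dvd_minus_iff dvd_refl)
    then show ?thesis
      by (auto simp: perm_act_X[OF bij] transpose_def)
  qed
  have pow: "X i - X j dvd Poly_Mapping.single (Poly_Mapping.single k v) 1
      - ?s (Poly_Mapping.single (Poly_Mapping.single k v) 1)" for k v
  proof (induction v)
    case 0
    show ?case by (simp add: const del: single_one)
  next
    case (Suc v)
    have "Poly_Mapping.single (Poly_Mapping.single k (Suc v)) 1
        = X k * Poly_Mapping.single (Poly_Mapping.single k v) (1::rat)"
      by (simp add: X_def mult_single flip: single_add)
    then show ?case using mult[OF var Suc] by simp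
  qed
  have mon: "X i - X j dvd Poly_Mapping.single a 1 - ?s (Poly_Mapping.single a 1)" for a
  proof (induction a rule: poly_mapping_single_induct)
    case zero
    show ?case by (simp add: const del: single_one)
  next
    case (add k v a)
    then show ?case using mult[OF pow add] by (simp add: mult_single)
  qed
  show ?thesis
  proof (induction f rule: poly_mapping_single_induct)
    case zero
    then show ?case by (simp add: perm_act_def lin_ext_def)
  next
    case (add a c p)
    have "X i - X j dvd Poly_Mapping.single 0 c * Poly_Mapping.single a 1
        - ?s (Poly_Mapping.single 0 c * Poly_Mapping.single a 1)"
      by (rule mult[OF _ mon]) (simp add: const)
    then have "X i - X j dvd Poly_Mapping.single a c - ?s (Poly_Mapping.single a c)"
      by (simp add: mult_single)
    from dvd_add[OF this add] show ?case by (simp add: perm_act_add add_diff_add)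
  qed
qed

lemma div_diff_iff:
  assumes "i \<noteq> j"
  shows "div_diff i j f = g \<longleftrightarrow> g * (X i - X j) = f - perm_act (transpose i j) f"
proof -
  have "\<exists>!g. g * (X i - X j) = f - perm_act (transpose i j) f"
    using X_diff_dvd[of i j f] X_diff_nonzero[OF assms]
    by (metis dvdE mult.commute mult_right_cancel)
  from theI'[OF this] this show ?thesis
    unfolding div_diff_def by blast
qed


section \<open>Representations of the symmetric group\<close>

text \<open>An action is given as a family of linear maps indexed by the permutations; modules are
  subspaces of a space of formal linear combinations.\<close>

definition sym_submodule ::
  "nat \<Rightarrow> ((nat \<Rightarrow> nat) \<Rightarrow> ('a \<Rightarrow>\<^sub>0 rat) \<Rightarrow> ('a \<Rightarrow>\<^sub>0 rat)) \<Rightarrow> ('a \<Rightarrow>\<^sub>0 rat) set \<Rightarrow> bool" where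
  "sym_submodule N act V \<longleftrightarrow>
     module.subspace qscale V \<and> (\<forall>w v. w permutes {1..N} \<longrightarrow> v \<in> V \<longrightarrow> act w v \<in> V)"

definition sym_irreducible ::
  "nat \<Rightarrow> ((nat \<Rightarrow> nat) \<Rightarrow> ('a \<Rightarrow>\<^sub>0 rat) \<Rightarrow> ('a \<Rightarrow>\<^sub>0 rat)) \<Rightarrow> ('a \<Rightarrow>\<^sub>0 rat) set \<Rightarrow> bool" where
  "sym_irreducible N act V \<longleftrightarrow>
     sym_submodule N act V \<and> V \<noteq> {0} \<and>
     (\<forall>W. sym_submodule N act W \<and> W \<subseteq> V \<longrightarrow> W = {0} \<or> W = V)"

definition sym_isomorphic ::
  "nat \<Rightarrow> ((nat \<Rightarrow> nat) \<Rightarrow> ('a \<Rightarrow>\<^sub>0 rat) \<Rightarrow> ('a \<Rightarrow>\<^sub>0 rat)) \<Rightarrow> ('a \<Rightarrow>\<^sub>0 rat) set \<Rightarrow>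
   ((nat \<Rightarrow> nat) \<Rightarrow> ('b \<Rightarrow>\<^sub>0 rat) \<Rightarrow> ('b \<Rightarrow>\<^sub>0 rat)) \<Rightarrow> ('b \<Rightarrow>\<^sub>0 rat) set \<Rightarrow> bool" where
  "sym_isomorphic N act V act' V' \<longleftrightarrow>
     (\<exists>\<phi>. bij_betw \<phi> V V' \<and>
          (\<forall>u\<in>V. \<forall>v\<in>V. \<phi> (u + v) = \<phi> u + \<phi> v) \<and>
          (\<forall>c. \<forall>v\<in>V. \<phi> (qscale c v) = qscale c (\<phi> v)) \<and>
          (\<forall>w v. w permutes {1..N} \<longrightarrow> v \<in> V \<longrightarrow> \<phi> (act w v) = act' w (\<phi> v)))"

text \<open>Partitions are weakly decreasing lists of positive integers. The Specht module is the span
  of the polytabloids \<open>e\<^sub>t = \<Sum>\<sigma>\<in>C\<^sub>t. sgn \<sigma> \<sigma>{t}\<close> in the permutation module on tabloids; over a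
  field of characteristic 0 it is the irreducible module labeled by the partition, with the
  trivial module labeled by \<open>[N]\<close> and the sign module by \<open>[1,\<dots>,1]\<close>. The tabloid \<open>{t}\<close> of
  a tableau \<open>t\<close> is encoded as the function sending a row index to the set of entries in that
  row.\<close>

definition is_partition :: "nat \<Rightarrow> nat list \<Rightarrow> bool" where
  "is_partition N \<mu> \<longleftrightarrow> sorted_wrt (\<ge>) \<mu> \<and> 0 \<notin> set \<mu> \<and> sum_list \<mu> = N"

definition diagram :: "nat list \<Rightarrow> (nat \<times> nat) set" where
  "diagram \<mu> = {(r, c). r < length \<mu> \<and> c < \<mu> ! r}"

definition tableaux :: "nat \<Rightarrow> nat list \<Rightarrow> (nat \<times> nat \<Rightarrow> nat) set" where
  "tableaux N \<mu> = {t. bij_betw t (diagram \<mu>) {1..N}}"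

type_synonym tabloid = "nat \<Rightarrow> nat set"

definition tabloid_of :: "nat list \<Rightarrow> (nat \<times> nat \<Rightarrow> nat) \<Rightarrow> tabloid" where
  "tabloid_of \<mu> t = (\<lambda>r. {t (r, c) | c. (r, c) \<in> diagram \<mu>})"

definition tabloid_act :: "(nat \<Rightarrow> nat) \<Rightarrow> (tabloid \<Rightarrow>\<^sub>0 rat) \<Rightarrow> (tabloid \<Rightarrow>\<^sub>0 rat)" where
  "tabloid_act w = lin_ext (\<lambda>T r. w ` T r)"

definition column_stabilizer :: "nat \<Rightarrow> nat list \<Rightarrow> (nat \<times> nat \<Rightarrow> nat) \<Rightarrow> (nat \<Rightarrow> nat) set" where
  "column_stabilizer N \<mu> t = {\<sigma>. \<sigma> permutes {1..N} \<and>
     (\<forall>c. \<sigma> ` {t (r, c) | r. (r, c) \<in> diagram \<mu>} = {t (r, c) | r. (r, c) \<in> diagram \<mu>})}"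

definition polytabloid :: "nat \<Rightarrow> nat list \<Rightarrow> (nat \<times> nat \<Rightarrow> nat) \<Rightarrow> (tabloid \<Rightarrow>\<^sub>0 rat)" where
  "polytabloid N \<mu> t = (\<Sum>\<sigma>\<in>column_stabilizer N \<mu> t.
     qscale (of_int (sign \<sigma>)) (tabloid_act \<sigma> (Poly_Mapping.single (tabloid_of \<mu> t) 1)))"

definition specht :: "nat \<Rightarrow> nat list \<Rightarrow> (tabloid \<Rightarrow>\<^sub>0 rat) set" where
  "specht N \<mu> = module.span qscale (polytabloid N \<mu> ` tableaux N \<mu>)"

definition of_isotype :: "nat \<Rightarrow> nat list \<Rightarrow> poly_q \<Rightarrow> bool" where
  "of_isotype N \<mu> p \<longleftrightarrow> (\<exists>k V. V \<subseteq> homogeneous_polys N k \<and> sym_irreducible N perm_act V \<and>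
     sym_isomorphic N perm_act V tabloid_act (specht N \<mu>) \<and> p \<in> V)"

lemma two_row_is_partition:
  assumes "d \<ge> 2" "n \<ge> 2"
  shows "is_partition ((d + 1) * n - 1) [d * n - 1, n]"
proof -
  have "2 * n \<le> d * n" using assms by simp
  then have "n + 2 \<le> d * n" using assms by linarith
  then show ?thesis using assms by (auto simp: is_partition_def)
qed

end

theory Submission
  imports Defs "HOL-Computational_Algebra.Polynomial" "HOL-Computational_Algebra.Formal_Power_Series"
begin

text \<open>A singular module of isotype \<open>\<tau>\<close> yields singular polynomials \<open>F I\<close>, indexed by the
  \<open>n\<close>-subsets \<open>I\<close> of the set \<open>\<Omega>\<close> of variables, permuted by the symmetric group and with
  \<open>\<Sum>i\<notin>J. F (J \<union> {i}) = 0\<close> whenever \<open>|J| = n - 1\<close>. Put \<open>\<sigma> = m / n\<close>. The Dunkl equations force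
  degree \<open>m d\<close> in every variable, and the leading coefficients in one variable form a family of
  the same kind with one variable fewer, indexed by \<open>(n - 1)\<close>-subsets.

  Now evaluate at indicator vectors \<open>1\<^sub>T\<close>. Along the line on which one coordinate varies, \<open>F I\<close>
  with \<open>|I| = j\<close> is a polynomial whose coefficients satisfy the hypergeometric recurrence
  \<open>(k + 1) (k - \<kappa>) a\<^bsub>k+1\<^esub> = (\<sigma> j - k) (m d - k) a\<^sub>k\<close>, so the Chu-Vandermonde identity relates the
  values at the ends \<open>0\<close> and \<open>1\<close> of the line and the leading coefficient. For \<open>j < n\<close> this gives
  product formulas; for \<open>j = n\<close> it shows that \<open>F I 1\<^sub>T\<close> has sign \<open>(-1)\<close> to the power
  \<open>m (|T| - n)\<close> relative to \<open>F I 1\<^sub>I\<close>, as long as \<open>I \<subseteq> T\<close> and \<open>|T| < d n\<close>. On the other hand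
  \<open>F I\<close> at the complement of \<open>I\<close> is \<open>(-1)\<close> to the power \<open>m d n\<close> times \<open>F I 1\<^sub>I\<close>, and by
  inclusion-exclusion it is \<open>(-1)\<^sup>n\<close> times the sum of the values there of the \<open>F I'\<close> with \<open>I'\<close>
  disjoint from \<open>I\<close>. As \<open>m\<close> and \<open>n\<close> are coprime, the signs do not match.\<close>

section \<open>Evaluation and coefficient extraction\<close>

text \<open>The exponent m d arises from comparing top coefficients in one variable v. If v lies in
  I, the sum relation turns the sum of differences into \<open>card \<Omega> - j + 1\<close> copies
  of one coefficient, and \<sigma> times this number is m d because N = (d + 1) n - 1. If v lies
  outside I and those coefficients vanish, only \<sigma> j is possible. For 0 < j < n this is no
  integer, since m and n are coprime; hence the series along a line can be read from its leading
  coefficient downwards without a zero denominator. The obstacle is j = n, where \<sigma> j = m: the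
  recurrence stops at k = m and, if \<kappa> = m d - \<sigma> \<beta> is an integer (\<beta> = |T| +
  1 - n for a line through the indicator vector of T), starts again with a free coefficient, so the
  value at 0 does not determine the value at 1. The free piece is controlled by the leading
  coefficient, a value of a family with j = n - 1, where the product formula is known. The clash at
  the end is one of parity: m n + m + n is odd unless m and n are both even.\<close>

lemma poly_eval_0 [simp]: "poly_eval 0 x = 0"
  by (simp add: poly_eval_def)

lemma poly_eval_add: "poly_eval (p + q) x = poly_eval p x + poly_eval q x"
  unfolding poly_eval_def
  by (rule sum_keys_add[where F = "\<lambda>a c. c * (\<Prod>i\<in>Poly_Mapping.keys a. x i ^ Poly_Mapping.lookup a i)"])
     (simp_all add: algebra_simps)

lemma poly_eval_uminus: "poly_eval (- p) x = - poly_eval p x"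
  using poly_eval_add[of p "- p" x] by simp

lemma poly_eval_diff: "poly_eval (p - q) x = poly_eval p x - poly_eval q x"
  using poly_eval_add[of p "- q" x] by (simp add: poly_eval_uminus)

lemma poly_eval_sum: "poly_eval (\<Sum>i\<in>S. f i) x = (\<Sum>i\<in>S. poly_eval (f i) x)"
  by (induction S rule: infinite_finite_induct) (simp_all add: poly_eval_add)

lemma poly_eval_single:
  "poly_eval (Poly_Mapping.single a c) x = c * (\<Prod>i\<in>Poly_Mapping.keys a. x i ^ Poly_Mapping.lookup a i)"
  by (simp add: poly_eval_def)

lemma prod_keys_superset:
  fixes x :: "nat \<Rightarrow> 'a::comm_monoid_mult"
  assumes "finite S" "Poly_Mapping.keys a \<subseteq> S"
  shows "(\<Prod>i\<in>Poly_Mapping.keys a. x i ^ Poly_Mapping.lookup a i) = (\<Prod>i\<in>S. x i ^ Poly_Mapping.lookup a i)"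
  using assms by (intro prod.mono_neutral_left) (auto simp: in_keys_iff)

lemma poly_eval_mult: "poly_eval (p * q) x = poly_eval p x * poly_eval q x"
proof (induction p rule: poly_mapping_single_induct)
  case zero
  then show ?case by simp
next
  case (add a c p)
  have "poly_eval (Poly_Mapping.single a c * q) x = poly_eval (Poly_Mapping.single a c) x * poly_eval q x"
  proof (induction q rule: poly_mapping_single_induct)
    case zero
    then show ?case by simp
  next
    case (add b e q)
    let ?S = "Poly_Mapping.keys a \<union> Poly_Mapping.keys b"
    have "Poly_Mapping.keys (a + b) \<subseteq> ?S" by (rule Poly_Mapping.keys_add)
    then have "poly_eval (Poly_Mapping.single (a + b) (c * e)) x
        = poly_eval (Poly_Mapping.single a c) x * poly_eval (Poly_Mapping.single b e) x"
      using prod_keys_superset[of ?S a x] prod_keys_superset[of ?S b x]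
        prod_keys_superset[of ?S "a + b" x]
      by (simp add: poly_eval_single lookup_add power_add prod.distrib)
    then show ?case using add by (simp add: distrib_left poly_eval_add mult_single)
  qed
  then show ?case using add by (simp add: distrib_right poly_eval_add)
qed

lemma poly_eval_X [simp]: "poly_eval (X i) x = x i"
  by (simp add: X_def poly_eval_single)

lemma poly_eval_qscale: "poly_eval (qscale c p) x = c * poly_eval p x"
proof -
  have "qscale c p = Poly_Mapping.single 0 c * p"
  proof (induction p rule: poly_mapping_single_induct)
    case zero
    then show ?case by (auto intro!: poly_mapping_eqI)
  next
    case (add a e p)
    have "qscale c (Poly_Mapping.single a e + p) = Poly_Mapping.single a (c * e) + qscale c p"
      by (auto intro!: poly_mapping_eqI simp: lookup_add lookup_single when_def algebra_simps)
    then show ?case using add by (simp add: distrib_left mult_single)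
  qed
  then show ?thesis by (simp add: poly_eval_mult poly_eval_single)
qed

lemma partial_deriv_add: "partial_deriv i (p + q) = partial_deriv i p + partial_deriv i q"
  by (auto intro!: poly_mapping_eqI simp: partial_deriv_lookup lookup_add algebra_simps)

lemma partial_deriv_0 [simp]: "partial_deriv i 0 = 0"
  by (simp add: partial_deriv_def)

lemma partial_deriv_single:
  "partial_deriv i (Poly_Mapping.single a c) =
    Poly_Mapping.single (a - Poly_Mapping.single i 1) (of_nat (Poly_Mapping.lookup a i) * c)"
  by (simp add: partial_deriv_def)

text \<open>The result stays in \<open>poly_q\<close> and is free of the variable v, so that leading
  coefficients can again form a family, over one variable fewer.\<close>

definition coeff_in :: "nat \<Rightarrow> nat \<Rightarrow> poly_q \<Rightarrow> poly_q" where
  "coeff_in v L p = (\<Sum>a\<in>Poly_Mapping.keys p. if Poly_Mapping.lookup a v = L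
     then Poly_Mapping.single (a - Poly_Mapping.single v L) (Poly_Mapping.lookup p a) else 0)"

text \<open>The restriction of p to the line through x in direction v; the entry \<open>x v\<close>
  itself does not matter. Degrees, roots and coefficients of \<open>rat poly\<close> become
  available along such a line.\<close>

definition poly_in :: "nat \<Rightarrow> poly_q \<Rightarrow> (nat \<Rightarrow> rat) \<Rightarrow> rat poly" where
  "poly_in v p x = (\<Sum>a\<in>Poly_Mapping.keys p. monom (Poly_Mapping.lookup p a *
     (\<Prod>i\<in>Poly_Mapping.keys a - {v}. x i ^ Poly_Mapping.lookup a i)) (Poly_Mapping.lookup a v))"

lemma coeff_in_0 [simp]: "coeff_in v L 0 = 0"
  by (simp add: coeff_in_def)

lemma coeff_in_single: "coeff_in v L (Poly_Mapping.single a c) =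
    (if Poly_Mapping.lookup a v = L then Poly_Mapping.single (a - Poly_Mapping.single v L) c else 0)"
  by (simp add: coeff_in_def)

lemma coeff_in_add: "coeff_in v L (p + q) = coeff_in v L p + coeff_in v L q"
  unfolding coeff_in_def
  by (rule sum_keys_add[where F = "\<lambda>a c. if Poly_Mapping.lookup a v = L
     then Poly_Mapping.single (a - Poly_Mapping.single v L) c else 0"]) (simp_all add: single_add)

lemma coeff_in_sum: "coeff_in v L (\<Sum>i\<in>S. f i) = (\<Sum>i\<in>S. coeff_in v L (f i))"
  by (induction S rule: infinite_finite_induct) (simp_all add: coeff_in_add)

lemma poly_in_0 [simp]: "poly_in v 0 x = 0"
  by (simp add: poly_in_def)

lemma poly_in_single: "poly_in v (Poly_Mapping.single a c) x = monom (c *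
     (\<Prod>i\<in>Poly_Mapping.keys a - {v}. x i ^ Poly_Mapping.lookup a i)) (Poly_Mapping.lookup a v)"
  by (simp add: poly_in_def)

lemma poly_in_add: "poly_in v (p + q) x = poly_in v p x + poly_in v q x"
  unfolding poly_in_def
  by (rule sum_keys_add[where F = "\<lambda>a c. monom (c *
     (\<Prod>i\<in>Poly_Mapping.keys a - {v}. x i ^ Poly_Mapping.lookup a i)) (Poly_Mapping.lookup a v)"])
     (simp_all add: add_monom distrib_right)

lemma poly_poly_in: "poly (poly_in v p x) t = poly_eval p (x(v := t))"
proof (induction p rule: poly_mapping_single_induct)
  case zero
  then show ?case by simp
next
  case (add a c p)
  have "(\<Prod>i\<in>Poly_Mapping.keys a. (x(v := t)) i ^ Poly_Mapping.lookup a i)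
      = t ^ Poly_Mapping.lookup a v * (\<Prod>i\<in>Poly_Mapping.keys a - {v}. x i ^ Poly_Mapping.lookup a i)"
  proof (cases "v \<in> Poly_Mapping.keys a")
    case True
    then show ?thesis by (subst prod.remove[OF _ True]) (auto intro!: prod.cong)
  next
    case False
    then show ?thesis by (auto simp: in_keys_iff intro!: prod.cong)
  qed
  then show ?case using add
    by (simp add: poly_in_add poly_eval_add poly_in_single poly_eval_single poly_monom algebra_simps)
qed

lemma coeff_poly_in: "coeff (poly_in v p x) L = poly_eval (coeff_in v L p) x"
proof (induction p rule: poly_mapping_single_induct)
  case zero
  then show ?case by simp
next
  case (add a c p)
  have "Poly_Mapping.keys (a - Poly_Mapping.single v (Poly_Mapping.lookup a v)) = Poly_Mapping.keys a - {v}"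
    by (auto simp: in_keys_iff lookup_minus lookup_single when_def split: if_splits)
  moreover have "(\<Prod>i\<in>Poly_Mapping.keys a - {v}. x i ^ Poly_Mapping.lookup (a - Poly_Mapping.single v (Poly_Mapping.lookup a v)) i)
      = (\<Prod>i\<in>Poly_Mapping.keys a - {v}. x i ^ Poly_Mapping.lookup a i)"
    by (intro prod.cong) (simp_all add: lookup_minus lookup_single)
  ultimately have "coeff (poly_in v (Poly_Mapping.single a c) x) L = poly_eval (coeff_in v L (Poly_Mapping.single a c)) x"
    by (cases "Poly_Mapping.lookup a v = L") (simp_all add: poly_in_single coeff_in_single poly_eval_single)
  then show ?case using add by (simp add: poly_in_add coeff_in_add poly_eval_add)
qed

lemma pderiv_poly_in: "pderiv (poly_in v p x) = poly_in v (partial_deriv v p) x"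
proof (induction p rule: poly_mapping_single_induct)
  case zero
  then show ?case by simp
next
  case (add a c p)
  have "Poly_Mapping.keys (a - Poly_Mapping.single v 1) - {v} = Poly_Mapping.keys a - {v}"
    by (auto simp: in_keys_iff lookup_minus lookup_single when_def)
  then have "pderiv (poly_in v (Poly_Mapping.single a c) x) = poly_in v (partial_deriv v (Poly_Mapping.single a c)) x"
    by (auto simp: poly_in_single partial_deriv_single pderiv_monom lookup_minus lookup_single when_def
        intro!: prod.cong arg_cong2[where f = monom])
  then show ?case using add by (simp add: poly_in_add partial_deriv_add pderiv_add)
qed

lemma coeff_in_partial_deriv:
  assumes "i \<noteq> v"
  shows "coeff_in v L (partial_deriv i p) = partial_deriv i (coeff_in v L p)"
proof (induction p rule: poly_mapping_single_induct)
  case zero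
  then show ?case by simp
next
  case (add a c p)
  have "a - Poly_Mapping.single i 1 - Poly_Mapping.single v L = a - Poly_Mapping.single v L - Poly_Mapping.single i 1" for L
    by (auto intro!: poly_mapping_eqI simp: lookup_minus)
  then have "coeff_in v L (partial_deriv i (Poly_Mapping.single a c)) = partial_deriv i (coeff_in v L (Poly_Mapping.single a c))"
    using assms by (auto simp: coeff_in_single partial_deriv_single lookup_minus lookup_single when_def)
  then show ?case using add by (simp add: coeff_in_add partial_deriv_add)
qed

lemma coeff_in_commute:
  assumes "u \<noteq> v"
  shows "coeff_in u K (coeff_in v L p) = coeff_in v L (coeff_in u K p)"
proof (induction p rule: poly_mapping_single_induct)
  case zero
  then show ?case by simp
next
  case (add a c p)
  have "a - Poly_Mapping.single u K - Poly_Mapping.single v L = a - Poly_Mapping.single v L - Poly_Mapping.single u K"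
    by (auto intro!: poly_mapping_eqI simp: lookup_minus)
  then have "coeff_in u K (coeff_in v L (Poly_Mapping.single a c)) = coeff_in v L (coeff_in u K (Poly_Mapping.single a c))"
    using assms by (auto simp: coeff_in_single lookup_minus lookup_single when_def)
  then show ?case using add by (simp add: coeff_in_add)
qed

lemma lookup_coeff_in:
  assumes "Poly_Mapping.lookup a v = L"
  shows "Poly_Mapping.lookup (coeff_in v L p) (a - Poly_Mapping.single v L) = Poly_Mapping.lookup p a"
proof (induction p rule: poly_mapping_single_induct)
  case zero
  then show ?case by simp
next
  case (add b c p)
  have "a = b" if "a - Poly_Mapping.single v L = b - Poly_Mapping.single v L" "Poly_Mapping.lookup b v = L"
  proof (rule poly_mapping_eqI)
    fix k
    show "Poly_Mapping.lookup a k = Poly_Mapping.lookup b k"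
      using arg_cong[OF that(1), of "\<lambda>c. Poly_Mapping.lookup c k"] that(2) assms
      by (auto simp: lookup_minus lookup_single when_def split: if_splits)
  qed
  then have "Poly_Mapping.lookup (coeff_in v L (Poly_Mapping.single b c)) (a - Poly_Mapping.single v L)
      = Poly_Mapping.lookup (Poly_Mapping.single b c) a"
    using assms by (auto simp: coeff_in_single lookup_single when_def)
  then show ?case using add by (simp add: coeff_in_add lookup_add)
qed

lemma eq_0_if_coeff_in_eq_0:
  assumes "\<And>L. coeff_in v L p = 0"
  shows "p = 0"
proof (rule poly_mapping_eqI)
  fix a
  show "Poly_Mapping.lookup p a = Poly_Mapping.lookup 0 a"
    using lookup_coeff_in[of a v "Poly_Mapping.lookup a v" p] assms by simp
qed

definition vars :: "poly_q \<Rightarrow> nat set" where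
  "vars p = (\<Union>a\<in>Poly_Mapping.keys p. Poly_Mapping.keys a)"

lemma finite_vars [simp]: "finite (vars p)"
  by (simp add: vars_def)

lemma vars_coeff_in: "vars (coeff_in v L p) \<subseteq> vars p - {v}"
proof -
  have "a \<in> Poly_Mapping.keys (coeff_in v L p) \<Longrightarrow>
      \<exists>b\<in>Poly_Mapping.keys p. Poly_Mapping.lookup b v = L \<and> a = b - Poly_Mapping.single v L" for a
    unfolding coeff_in_def
    by (drule subsetD[OF Poly_Mapping.keys_sum]) (auto split: if_splits)
  then show ?thesis
    by (fastforce simp: vars_def in_keys_iff lookup_minus lookup_single when_def split: if_splits)
qed

lemma coeff_in_eventually_0: "\<exists>D. \<forall>L>D. coeff_in v L p = 0"
proof -
  have "coeff_in v L p = 0" if "L > Max (insert 0 ((\<lambda>a. Poly_Mapping.lookup a v) ` Poly_Mapping.keys p))" for L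
    unfolding coeff_in_def
  proof (rule sum.neutral, rule ballI)
    fix a assume "a \<in> Poly_Mapping.keys p"
    then have "Poly_Mapping.lookup a v < L" using that by simp
    then show "(if Poly_Mapping.lookup a v = L
       then Poly_Mapping.single (a - Poly_Mapping.single v L) (Poly_Mapping.lookup p a) else 0) = 0" by simp
  qed
  then show ?thesis by blast
qed

text \<open>Identities derived from the Dunkl equations hold at first only off finitely many poles;
  this extends them to polynomial identities.\<close>

lemma poly_eq_0_iff_infinite:
  fixes p :: "rat poly"
  assumes "finite S" "\<And>z. z \<notin> S \<Longrightarrow> poly p z = 0"
  shows "p = 0"
proof (rule ccontr)
  assume "p \<noteq> 0"
  then have "finite {z. poly p z = 0}" by (rule poly_roots_finite)
  moreover have "- S \<subseteq> {z. poly p z = 0}" using assms(2) by auto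
  ultimately have "finite (- S)" by (rule finite_subset[rotated])
  with assms(1) have "finite (S \<union> - S)" by blast
  then show False by (simp add: infinite_UNIV_char_0)
qed

text \<open>Induction on a finite set containing the variables of p: a univariate restriction that
  vanishes everywhere has zero coefficients, and these are values of \<open>coeff_in v L p\<close>,
  which has one variable fewer.\<close>

lemma poly_eval_faithful:
  assumes "\<And>x. poly_eval p x = 0"
  shows "p = 0"
proof -
  have "p = 0" if "finite S" "vars p \<subseteq> S" "\<And>x. poly_eval p x = 0" for S p
    using that
  proof (induction S arbitrary: p)
    case empty
    then have "a = 0" if "a \<in> Poly_Mapping.keys p" for a using that by (auto simp: vars_def)
    then have p: "p = Poly_Mapping.single 0 (Poly_Mapping.lookup p 0)"
      by (intro poly_mapping_eqI) (auto simp: lookup_single when_def in_keys_iff)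
    have "poly_eval (Poly_Mapping.single 0 (Poly_Mapping.lookup p 0)) (\<lambda>_. 0) = 0"
      using empty(2) p by metis
    then have "Poly_Mapping.lookup p 0 = 0" by (simp add: poly_eval_single)
    with p show ?case by simp
  next
    case (insert v S)
    have "poly_in v p x = 0" for x
      by (rule poly_eq_0_iff_infinite[of "{}"]) (simp_all add: poly_poly_in insert)
    then have "poly_eval (coeff_in v L p) x = 0" for L x by (metis coeff_poly_in coeff_0)
    moreover have "vars (coeff_in v L p) \<subseteq> S" for L using vars_coeff_in[of v L p] insert by auto
    ultimately have "coeff_in v L p = 0" for L using insert by blast
    then show ?case by (rule eq_0_if_coeff_in_eq_0)
  qed
  then show ?thesis using assms by (meson finite_vars order_refl)
qed

lemma poly_eval_eqI: "(\<And>x. poly_eval p x = poly_eval q x) \<Longrightarrow> p = q"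
  using poly_eval_faithful[of "p - q"] by (simp add: poly_eval_diff)

section \<open>Families of singular polynomials indexed by subsets\<close>

text \<open>Each \<open>Q k\<close> is divisible by z - c k, so the right-hand side is a polynomial
  and the claim compares coefficients of index L - 1. The equation is required only off the points
  \<open>c k\<close>, where HOL division would return 0.\<close>

lemma leading_coeff_partial_fractions:
  fixes P :: "rat poly" and Q :: "'k \<Rightarrow> rat poly"
  assumes "finite K" "degree P \<le> L" "\<And>k. k \<in> K \<Longrightarrow> degree (Q k) \<le> L"
    and root: "\<And>k. k \<in> K \<Longrightarrow> poly (Q k) (c k) = 0"
    and eq: "\<And>z. z \<notin> c ` K \<Longrightarrow> poly (pderiv P) z = s * (\<Sum>k\<in>K. poly (Q k) z / (z - c k))"
  shows "of_nat L * coeff P L = s * (\<Sum>k\<in>K. coeff (Q k) L)"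
proof -
  have "\<exists>T. Q k = [:- c k, 1:] * T" if "k \<in> K" for k
    using root[OF that] by (simp add: poly_eq_0_iff_dvd dvd_def)
  then obtain T where T: "\<And>k. k \<in> K \<Longrightarrow> Q k = [:- c k, 1:] * T k" by metis
  have "pderiv P - smult s (\<Sum>k\<in>K. T k) = 0"
  proof (rule poly_eq_0_iff_infinite[of "c ` K"])
    fix z assume z: "z \<notin> c ` K"
    have "poly (Q k) z / (z - c k) = poly (T k) z" if "k \<in> K" for k
    proof -
      have "poly (Q k) z = (z - c k) * poly (T k) z" using that by (simp add: T algebra_simps)
      then show ?thesis using that z by auto
    qed
    then show "poly (pderiv P - smult s (\<Sum>k\<in>K. T k)) z = 0"
      using eq[OF z] by (simp add: poly_sum)
  qed (use assms in simp)
  then have pd: "pderiv P = smult s (\<Sum>k\<in>K. T k)" by simp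
  show ?thesis
  proof (cases L)
    \<comment> \<open>There is no index L - 1 here, but a constant \<open>Q k\<close> with a root is
      zero.\<close>
    case 0
    have "Q k = 0" if k: "k \<in> K" for k
      using assms(3)[OF k] root[OF k] 0 by (auto elim!: degree_eq_zeroE)
    then show ?thesis using 0 by simp
  next
    case (Suc l)
    have "coeff (Q k) L = coeff (T k) l" if k: "k \<in> K" for k
    proof (cases "T k = 0")
      case False
      then have "degree (Q k) = Suc (degree (T k))" using T[OF k]
        by (simp add: degree_mult_eq del: mult_pCons_left)
      then have "degree (T k) < Suc l" using assms(3)[OF k] Suc by simp
      then show ?thesis using Suc by (simp add: T[OF k] coeff_eq_0)
    qed (use T[OF k] in simp)
    then show ?thesis
      using arg_cong[OF pd, of "\<lambda>p. coeff p l"] Suc by (simp add: coeff_pderiv coeff_sum)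
  qed
qed

lemma transpose_image_insert:
  assumes "v \<notin> I" "k \<in> I"
  shows "transpose v k ` I = insert v (I - {k})"
  using assms by (auto simp: transpose_def image_iff split: if_splits)

lemma transpose_image_neither:
  assumes "v \<notin> I" "k \<notin> I"
  shows "transpose v k ` I = I"
  using assms by (force simp: transpose_def image_iff)

lemma transpose_image_both:
  assumes "v \<in> I" "k \<in> I"
  shows "transpose v k ` I = I"
  using assms by (force simp: transpose_def image_iff)

text \<open>Here \<sigma> is minus the Dunkl parameter, and \<open>\<Omega>\<close> is arbitrary
  because passing to leading coefficients removes a variable. The values of F on sets of other sizes
  are unconstrained. The Dunkl equation is asked only where \<open>x i\<close> differs from the
  other coordinates, so that every quotient is genuine.\<close>

locale singular_family =
  fixes \<sigma> :: rat and \<Omega> :: "nat set" and j :: nat and F :: "nat set \<Rightarrow> poly_q"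
  assumes finite_vars_set: "finite \<Omega>"
    and vars_subset: "I \<subseteq> \<Omega> \<Longrightarrow> card I = j \<Longrightarrow> vars (F I) \<subseteq> \<Omega>"
    and dunkl_eq: "I \<subseteq> \<Omega> \<Longrightarrow> card I = j \<Longrightarrow> i \<in> \<Omega> \<Longrightarrow> (\<And>k. k \<in> \<Omega> - {i} \<Longrightarrow> x k \<noteq> x i) \<Longrightarrow>
      poly_eval (partial_deriv i (F I)) x =
        \<sigma> * (\<Sum>k\<in>\<Omega> - {i}. (poly_eval (F I) x - poly_eval (F (transpose i k ` I)) x) / (x i - x k))"
    and swap_eq: "I \<subseteq> \<Omega> \<Longrightarrow> card I = j \<Longrightarrow> i \<in> \<Omega> \<Longrightarrow> k \<in> \<Omega> \<Longrightarrow>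
      poly_eval (F (transpose i k ` I)) x = poly_eval (F I) (x \<circ> transpose i k)"
    and sum_insert_eq_0: "J \<subseteq> \<Omega> \<Longrightarrow> Suc (card J) = j \<Longrightarrow> (\<Sum>i\<in>\<Omega> - J. F (insert i J)) = 0"
begin

text \<open>Uniform in I, since the Dunkl equation for one I involves the swapped index sets as
  well.\<close>

definition degree_le :: "nat \<Rightarrow> nat \<Rightarrow> bool" where
  "degree_le v L \<longleftrightarrow> (\<forall>I. I \<subseteq> \<Omega> \<longrightarrow> card I = j \<longrightarrow> (\<forall>L'>L. coeff_in v L' (F I) = 0))"

lemma swap_index:
  assumes "I \<subseteq> \<Omega>" "card I = j" "i \<in> \<Omega>" "k \<in> \<Omega>"
  shows "transpose i k ` I \<subseteq> \<Omega>" "card (transpose i k ` I) = j"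
proof -
  show "transpose i k ` I \<subseteq> \<Omega>" using assms by (auto simp: transpose_def)
  have "inj_on (transpose i k) I" by (metis bij_transpose bij_is_inj inj_on_subset subset_UNIV)
  then show "card (transpose i k ` I) = j" using assms by (simp add: card_image)
qed

lemma swap_equal_coords:
  assumes "I \<subseteq> \<Omega>" "card I = j" "i \<in> \<Omega>" "k \<in> \<Omega>" "x i = x k"
  shows "poly_eval (F (transpose i k ` I)) x = poly_eval (F I) x"
proof -
  have "x \<circ> transpose i k = x" using assms(5) by (auto simp: transpose_def)
  then show ?thesis using swap_eq[OF assms(1-4), of x] by simp
qed

lemma degree_poly_in_le:
  assumes "degree_le v L" "I \<subseteq> \<Omega>" "card I = j"
  shows "degree (poly_in v (F I) x) \<le> L"
  using assms by (intro degree_le) (auto simp: coeff_poly_in degree_le_def)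

lemma dunkl_eq_line:
  assumes "I \<subseteq> \<Omega>" "card I = j" "v \<in> \<Omega>" "z \<notin> x ` (\<Omega> - {v})"
  shows "poly (pderiv (poly_in v (F I) x)) z = \<sigma> * (\<Sum>k\<in>\<Omega> - {v}.
    (poly (poly_in v (F I) x) z - poly (poly_in v (F (transpose v k ` I)) x) z) / (z - x k))"
proof -
  have "x k \<noteq> z" if "k \<in> \<Omega> - {v}" for k using assms(4) that by auto
  then show ?thesis
    unfolding pderiv_poly_in poly_poly_in
    by (subst dunkl_eq) (use assms in \<open>auto intro!: sum.cong\<close>)
qed

text \<open>Partial fractions on the line in direction v: the difference between F at I and at the
  swapped set vanishes at z = x k, because swapping v and k does not move a point at which these two
  coordinates agree.\<close>

lemma leading_eq:
  assumes "degree_le v L" "v \<in> \<Omega>" "I \<subseteq> \<Omega>" "card I = j"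
  shows "of_nat L * poly_eval (coeff_in v L (F I)) x = \<sigma> * (\<Sum>k\<in>\<Omega> - {v}.
    poly_eval (coeff_in v L (F I)) x - poly_eval (coeff_in v L (F (transpose v k ` I))) x)"
proof -
  let ?Q = "\<lambda>k. poly_in v (F I) x - poly_in v (F (transpose v k ` I)) x"
  have "of_nat L * coeff (poly_in v (F I) x) L = \<sigma> * (\<Sum>k\<in>\<Omega> - {v}. coeff (?Q k) L)"
  proof (rule leading_coeff_partial_fractions[where c = x])
    show "finite (\<Omega> - {v})" using finite_vars_set by simp
    show "degree (poly_in v (F I) x) \<le> L" using assms by (intro degree_poly_in_le)
    fix k assume k: "k \<in> \<Omega> - {v}"
    show "degree (?Q k) \<le> L"
      using assms k by (intro degree_diff_le degree_poly_in_le swap_index) auto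
    show "poly (?Q k) (x k) = 0"
      using swap_equal_coords[of I v k "x(v := x k)"] assms k by (simp add: poly_poly_in)
  next
    fix z assume "z \<notin> x ` (\<Omega> - {v})"
    then show "poly (pderiv (poly_in v (F I) x)) z = \<sigma> * (\<Sum>k\<in>\<Omega> - {v}. poly (?Q k) z / (z - x k))"
      using assms dunkl_eq_line by simp
  qed
  then show ?thesis by (simp add: coeff_poly_in)
qed

text \<open>Swaps of v inside the index set contribute nothing. Those with k outside replace v by k,
  and by the sum relation their coefficients add up to minus the one at \<open>insert v J\<close>.
  So there is one copy for each element outside \<open>insert v J\<close>, and one more.\<close>

lemma leading_eq_insert:
  assumes "degree_le v L" "v \<in> \<Omega>" "J \<subseteq> \<Omega> - {v}" "Suc (card J) = j"
  shows "of_nat L * poly_eval (coeff_in v L (F (insert v J))) x =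
    \<sigma> * of_nat (card \<Omega> - card J) * poly_eval (coeff_in v L (F (insert v J))) x"
proof -
  let ?c = "\<lambda>I. poly_eval (coeff_in v L (F I)) x"
  have fJ: "finite J" using assms finite_vars_set by (meson finite_subset finite_Diff)
  have vJ: "insert v J \<subseteq> \<Omega>" "card (insert v J) = j" using assms fJ by (auto simp: card_insert_if)
  have "(\<Sum>i\<in>\<Omega> - J. ?c (insert i J)) = 0"
  proof -
    have "J \<subseteq> \<Omega>" using assms by blast
    then show ?thesis using sum_insert_eq_0[of J] assms by (simp flip: poly_eval_sum coeff_in_sum)
  qed
  moreover have "\<Omega> - J = insert v (\<Omega> - {v} - J)" using assms by auto
  ultimately have rel: "?c (insert v J) + (\<Sum>k\<in>\<Omega> - {v} - J. ?c (insert k J)) = 0"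
    using finite_vars_set by simp
  have "(\<Sum>k\<in>\<Omega> - {v}. ?c (insert v J) - ?c (transpose v k ` insert v J)) =
    (\<Sum>k\<in>\<Omega> - {v} - J. ?c (insert v J) - ?c (insert k J))"
  proof (rule sum.mono_neutral_cong_right)
    show "\<forall>k\<in>\<Omega> - {v} - (\<Omega> - {v} - J). ?c (insert v J) - ?c (transpose v k ` insert v J) = 0"
      by (auto simp: transpose_image_both simp del: image_insert)
    fix k assume k: "k \<in> \<Omega> - {v} - J"
    have "transpose k v ` insert v J = insert k (insert v J - {v})"
      using k by (intro transpose_image_insert) auto
    also have "\<dots> = insert k J" using assms by auto
    finally show "?c (insert v J) - ?c (transpose v k ` insert v J) = ?c (insert v J) - ?c (insert k J)"
      by (simp add: transpose_commute del: image_insert)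
  qed (use finite_vars_set in auto)
  also have "\<dots> = (of_nat (card (\<Omega> - {v} - J)) + 1) * ?c (insert v J)"
    using rel by (simp add: sum_subtractf algebra_simps)
  also have "of_nat (card (\<Omega> - {v} - J)) + 1 = (of_nat (card \<Omega> - card J) :: rat)"
  proof -
    have "card (\<Omega> - {v} - J) = card \<Omega> - 1 - card J"
      using assms fJ finite_vars_set by (simp add: card_Diff_subset)
    moreover have "card J < card \<Omega>"
      using assms finite_vars_set by (intro psubset_card_mono) auto
    ultimately show ?thesis by (simp add: of_nat_diff)
  qed
  finally show ?thesis using leading_eq[OF assms(1,2) vJ, of x] by simp
qed

text \<open>Only k in I contributes: the swap leads to a set containing v, whose coefficient is
  removed by \<open>zero\<close>. What remains is j copies of one coefficient.\<close>

lemma leading_eq_no_insert: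
  assumes "degree_le v L" "v \<in> \<Omega>" "I \<subseteq> \<Omega> - {v}" "card I = j"
    and zero: "\<And>J. J \<subseteq> \<Omega> - {v} \<Longrightarrow> Suc (card J) = j \<Longrightarrow> coeff_in v L (F (insert v J)) = 0"
  shows "of_nat L * poly_eval (coeff_in v L (F I)) x = \<sigma> * of_nat j * poly_eval (coeff_in v L (F I)) x"
proof -
  let ?c = "\<lambda>I. poly_eval (coeff_in v L (F I)) x"
  have fI: "finite I" using assms finite_vars_set by (meson finite_subset finite_Diff)
  have "(\<Sum>k\<in>\<Omega> - {v}. ?c I - ?c (transpose v k ` I)) = (\<Sum>k\<in>I. ?c I)"
  proof (rule sum.mono_neutral_cong_right)
    have "transpose v k ` I = I" if "k \<in> \<Omega> - {v} - I" for k
      using that assms by (intro transpose_image_neither) auto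
    then show "\<forall>k\<in>\<Omega> - {v} - I. ?c I - ?c (transpose v k ` I) = 0" by simp
    fix k assume k: "k \<in> I"
    then have "transpose v k ` I = insert v (I - {k})"
      using assms by (intro transpose_image_insert) auto
    moreover have "Suc (card (I - {k})) = j" using k fI assms by (metis card_Suc_Diff1)
    ultimately show "?c I - ?c (transpose v k ` I) = ?c I"
      using zero[of "I - {k}"] assms(3) by (simp add: subset_Diff_insert Diff_subset subset_trans[of "I - {k}" I])
  qed (use finite_vars_set assms in auto)
  then show ?thesis using leading_eq[OF assms(1,2), of I x] assms by auto
qed

text \<open>The only denominator involving the variable v is that of k = v. After multiplication by
  x i - z this term has degree at most L in z, so on the other side the coefficient of index L + 1
  vanishes; it is minus the coefficient of \<open>Y\<close> at L.\<close>

lemma dunkl_eq_coeff: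
  assumes "degree_le v L" "v \<in> \<Omega>" "I \<subseteq> \<Omega>" "card I = j" "i \<in> \<Omega> - {v}"
    and ne: "\<And>k. k \<in> \<Omega> - {v} - {i} \<Longrightarrow> x k \<noteq> x i"
  shows "poly_eval (partial_deriv i (coeff_in v L (F I))) x =
    \<sigma> * (\<Sum>k\<in>\<Omega> - {v} - {i}. (poly_eval (coeff_in v L (F I)) x -
        poly_eval (coeff_in v L (F (transpose i k ` I))) x) / (x i - x k))"
proof -
  let ?A = "\<lambda>I. poly_in v (F I) x"
  define Y where "Y = poly_in v (partial_deriv i (F I)) x -
    smult \<sigma> (\<Sum>k\<in>\<Omega> - {v} - {i}. smult (1 / (x i - x k)) (?A I - ?A (transpose i k ` I)))"
  have "[:x i, -1:] * Y - smult \<sigma> (?A I - ?A (transpose i v ` I)) = 0"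
  proof (rule poly_eq_0_iff_infinite[of "{x i}"])
    fix z assume z: "z \<notin> {x i}"
    define y where "y = x(v := z)"
    have "\<Omega> - {i} = insert v (\<Omega> - {v} - {i})" using assms by auto
    then have "poly_eval (partial_deriv i (F I)) y =
        \<sigma> * ((poly_eval (F I) y - poly_eval (F (transpose i v ` I)) y) / (x i - z) +
          (\<Sum>k\<in>\<Omega> - {v} - {i}. (poly_eval (F I) y - poly_eval (F (transpose i k ` I)) y) / (y i - y k)))"
      using assms z finite_vars_set by (subst dunkl_eq) (auto simp: y_def)
    also have "(\<Sum>k\<in>\<Omega> - {v} - {i}. (poly_eval (F I) y - poly_eval (F (transpose i k ` I)) y) / (y i - y k))
       = (\<Sum>k\<in>\<Omega> - {v} - {i}. (poly_eval (F I) y - poly_eval (F (transpose i k ` I)) y) / (x i - x k))"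
      using assms by (intro sum.cong) (auto simp: y_def)
    finally have "poly Y z = \<sigma> * ((poly_eval (F I) y - poly_eval (F (transpose i v ` I)) y) / (x i - z))"
      by (simp add: Y_def poly_poly_in poly_sum distrib_left flip: y_def)
    moreover have "poly ([:x i, -1:] * Y) z = (x i - z) * poly Y z" by (simp add: algebra_simps)
    ultimately show "poly ([:x i, -1:] * Y - smult \<sigma> (?A I - ?A (transpose i v ` I))) z = 0"
      using z by (simp add: poly_poly_in flip: y_def)
  qed simp
  then have "coeff ([:x i, -1:] * Y) (Suc L) = coeff (smult \<sigma> (?A I - ?A (transpose i v ` I))) (Suc L)"
    by simp
  moreover have vanish: "coeff_in v (Suc L) (F I) = 0" "\<And>k. k \<in> \<Omega> \<Longrightarrow> coeff_in v (Suc L) (F (transpose i k ` I)) = 0"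
    using assms swap_index by (auto simp: degree_le_def)
  moreover have "coeff Y (Suc L) = 0"
    using vanish assms by (auto simp: Y_def coeff_sum coeff_poly_in coeff_in_partial_deriv)
  ultimately have "coeff Y L = 0"
    using assms by (simp add: coeff_poly_in)
  then show ?thesis
    using assms by (simp add: Y_def coeff_sum coeff_poly_in coeff_in_partial_deriv)
qed

lemma swap_eq_coeff:
  assumes "v \<in> \<Omega>" "I \<subseteq> \<Omega>" "card I = j" "i \<in> \<Omega> - {v}" "k \<in> \<Omega> - {v}"
  shows "poly_eval (coeff_in v L (F (transpose i k ` I))) x =
    poly_eval (coeff_in v L (F I)) (x \<circ> transpose i k)"
proof -
  have "poly_in v (F (transpose i k ` I)) x = poly_in v (F I) (x \<circ> transpose i k)"
  proof -
    have "(x \<circ> transpose i k)(v := t) = x(v := t) \<circ> transpose i k" for t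
      using assms by (auto simp: transpose_def)
    then have "poly_in v (F (transpose i k ` I)) x - poly_in v (F I) (x \<circ> transpose i k) = 0"
      using assms by (intro poly_eq_0_iff_infinite[of "{}"]) (auto simp: poly_poly_in swap_eq)
    then show ?thesis by simp
  qed
  then show ?thesis by (simp flip: coeff_poly_in)
qed

lemma leading_family_insert:
  assumes "degree_le v L" "v \<in> \<Omega>" "j = Suc j'"
  shows "singular_family \<sigma> (\<Omega> - {v}) j' (\<lambda>J. coeff_in v L (F (insert v J)))"
proof
  show "finite (\<Omega> - {v})" using finite_vars_set by simp
next
  fix J assume J: "J \<subseteq> \<Omega> - {v}" "card J = j'"
  then have fJ: "finite J" using finite_vars_set by (meson finite_subset finite_Diff)
  have vJ: "insert v J \<subseteq> \<Omega>" "card (insert v J) = j" using J assms fJ by (auto simp: card_insert_if)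
  have tr: "insert v (transpose i k ` J) = transpose i k ` insert v J" if "i \<in> \<Omega> - {v}" "k \<in> \<Omega> - {v}" for i k
    using that by (auto simp: transpose_def)
  show "vars (coeff_in v L (F (insert v J))) \<subseteq> \<Omega> - {v}"
    using vars_coeff_in[of v L "F (insert v J)"] vars_subset[OF vJ] by auto
  show "poly_eval (partial_deriv i (coeff_in v L (F (insert v J)))) x =
    \<sigma> * (\<Sum>k\<in>\<Omega> - {v} - {i}. (poly_eval (coeff_in v L (F (insert v J))) x -
        poly_eval (coeff_in v L (F (insert v (transpose i k ` J)))) x) / (x i - x k))"
    if i: "i \<in> \<Omega> - {v}" and "\<And>k. k \<in> \<Omega> - {v} - {i} \<Longrightarrow> x k \<noteq> x i" for i x
  proof -
    have "(\<Sum>k\<in>\<Omega> - {v} - {i}. (poly_eval (coeff_in v L (F (insert v J))) x -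
        poly_eval (coeff_in v L (F (insert v (transpose i k ` J)))) x) / (x i - x k)) =
      (\<Sum>k\<in>\<Omega> - {v} - {i}. (poly_eval (coeff_in v L (F (insert v J))) x -
        poly_eval (coeff_in v L (F (transpose i k ` insert v J))) x) / (x i - x k))"
    proof (intro sum.cong refl)
      fix k assume "k \<in> \<Omega> - {v} - {i}"
      then have "insert v (transpose i k ` J) = transpose i k ` insert v J" using i by (intro tr) auto
      then show "(poly_eval (coeff_in v L (F (insert v J))) x -
          poly_eval (coeff_in v L (F (insert v (transpose i k ` J)))) x) / (x i - x k) =
        (poly_eval (coeff_in v L (F (insert v J))) x -
          poly_eval (coeff_in v L (F (transpose i k ` insert v J))) x) / (x i - x k)" by metis
    qed
    then show ?thesis
      by (simp only:) (rule dunkl_eq_coeff[OF assms(1,2) vJ], use that in auto)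
  qed
  show "poly_eval (coeff_in v L (F (insert v (transpose i k ` J)))) x =
    poly_eval (coeff_in v L (F (insert v J))) (x \<circ> transpose i k)"
    if "i \<in> \<Omega> - {v}" "k \<in> \<Omega> - {v}" for i k x
    unfolding tr[OF that] by (rule swap_eq_coeff[OF assms(2) vJ that])
next
  fix J assume J: "J \<subseteq> \<Omega> - {v}" "Suc (card J) = j'"
  then have fJ: "finite J" using finite_vars_set by (meson finite_subset finite_Diff)
  have "(\<Sum>i\<in>\<Omega> - insert v J. F (insert i (insert v J))) = 0"
    using J assms fJ by (intro sum_insert_eq_0) (auto simp: card_insert_if)
  then have "(\<Sum>i\<in>\<Omega> - insert v J. coeff_in v L (F (insert i (insert v J)))) = 0"
    by (simp flip: coeff_in_sum)
  moreover have "insert i (insert v J) = insert v (insert i J)" for i by auto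
  moreover have "\<Omega> - {v} - J = \<Omega> - insert v J" by auto
  ultimately show "(\<Sum>i\<in>\<Omega> - {v} - J. coeff_in v L (F (insert v (insert i J)))) = 0" by simp
qed

text \<open>\<open>zero\<close> removes the term i = v from the sum relation, which therefore
  survives on the smaller variable set with the same j.\<close>

lemma leading_family_no_insert:
  assumes "degree_le v L" "v \<in> \<Omega>"
    and zero: "\<And>J. J \<subseteq> \<Omega> - {v} \<Longrightarrow> Suc (card J) = j \<Longrightarrow> coeff_in v L (F (insert v J)) = 0"
  shows "singular_family \<sigma> (\<Omega> - {v}) j (\<lambda>I. coeff_in v L (F I))"
proof
  show "finite (\<Omega> - {v})" using finite_vars_set by simp
next
  fix I assume I: "I \<subseteq> \<Omega> - {v}" "card I = j"
  then have I': "I \<subseteq> \<Omega>" by auto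
  show "vars (coeff_in v L (F I)) \<subseteq> \<Omega> - {v}"
    using vars_coeff_in[of v L "F I"] vars_subset[OF I' I(2)] by auto
  show "poly_eval (partial_deriv i (coeff_in v L (F I))) x =
    \<sigma> * (\<Sum>k\<in>\<Omega> - {v} - {i}. (poly_eval (coeff_in v L (F I)) x -
        poly_eval (coeff_in v L (F (transpose i k ` I))) x) / (x i - x k))"
    if "i \<in> \<Omega> - {v}" "\<And>k. k \<in> \<Omega> - {v} - {i} \<Longrightarrow> x k \<noteq> x i" for i x
    by (rule dunkl_eq_coeff[OF assms(1,2) I' I(2)]) (use that in auto)
  show "poly_eval (coeff_in v L (F (transpose i k ` I))) x =
    poly_eval (coeff_in v L (F I)) (x \<circ> transpose i k)"
    if "i \<in> \<Omega> - {v}" "k \<in> \<Omega> - {v}" for i k x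
    by (rule swap_eq_coeff[OF assms(2) I' I(2) that])
next
  fix J assume J: "J \<subseteq> \<Omega> - {v}" "Suc (card J) = j"
  then have "(\<Sum>i\<in>\<Omega> - J. F (insert i J)) = 0" by (intro sum_insert_eq_0) auto
  then have "(\<Sum>i\<in>\<Omega> - J. coeff_in v L (F (insert i J))) = 0" by (simp flip: coeff_in_sum)
  moreover have "\<Omega> - J = insert v (\<Omega> - {v} - J)" using J assms by auto
  ultimately show "(\<Sum>i\<in>\<Omega> - {v} - J. coeff_in v L (F (insert i J))) = 0"
    using finite_vars_set zero[OF J] by simp
qed

end

subsection \<open>Inclusion-exclusion\<close>

text \<open>Downward induction on \<open>card A\<close>: summing over all one-element extensions of
  A counts each I exactly \<open>j - card A\<close> times. If \<open>card A = j - 1\<close>, these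
  extensions are the sets in \<open>rel\<close>.\<close>

lemma sum_supersets_eq_0:
  fixes f :: "'a set \<Rightarrow> rat"
  assumes fin: "finite \<Omega>"
    and rel: "\<And>J. J \<subseteq> \<Omega> \<Longrightarrow> Suc (card J) = j \<Longrightarrow> (\<Sum>i\<in>\<Omega> - J. f (insert i J)) = 0"
    and A: "A \<subseteq> \<Omega>" "card A < j"
  shows "(\<Sum>I | I \<subseteq> \<Omega> \<and> card I = j \<and> A \<subseteq> I. f I) = 0"
  using A
proof (induction "j - card A" arbitrary: A rule: less_induct)
  case less
  let ?U = "\<lambda>A. {I. I \<subseteq> \<Omega> \<and> card I = j \<and> A \<subseteq> I}"
  have finU: "finite (?U A)" for A by (rule finite_subset[of _ "Pow \<Omega>"]) (use fin in auto)
  have finA: "finite A" using less(2) fin by (rule finite_subset)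
  have "(\<Sum>v\<in>\<Omega> - A. \<Sum>I\<in>?U (insert v A). f I) = 0"
  proof (cases "Suc (card A) = j")
    case True
    have "?U (insert v A) = {insert v A}" if "v \<in> \<Omega> - A" for v
    proof -
      have c: "card (insert v A) = j" using that True finA by simp
      have "insert v A = I" if "I \<in> ?U (insert v A)" for I
        using that c finite_subset[of I, OF _ fin] by (intro card_subset_eq) auto
      moreover have "insert v A \<subseteq> \<Omega>" using that less(2) by blast
      ultimately show ?thesis using c by blast
    qed
    then have "(\<Sum>v\<in>\<Omega> - A. \<Sum>I\<in>?U (insert v A). f I) = (\<Sum>v\<in>\<Omega> - A. f (insert v A))"
      by (intro sum.cong) simp_all
    then show ?thesis using rel[OF less(2) True] by simp
  next
    case False
    then show ?thesis
      using less(2,3) finA by (intro sum.neutral ballI less.hyps) (auto simp: card_insert_if)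
  qed
  also have "(\<Sum>v\<in>\<Omega> - A. \<Sum>I\<in>?U (insert v A). f I) = (\<Sum>v\<in>\<Omega> - A. \<Sum>I\<in>{I \<in> ?U A. v \<in> I}. f I)"
    by (intro sum.cong) auto
  also have "\<dots> = (\<Sum>I\<in>?U A. \<Sum>v\<in>{v \<in> \<Omega> - A. v \<in> I}. f I)"
    using finU fin by (intro sum.swap_restrict) auto
  also have "\<dots> = (\<Sum>I\<in>?U A. of_nat (j - card A) * f I)"
  proof (intro sum.cong refl)
    fix I assume I: "I \<in> ?U A"
    then have "{v \<in> \<Omega> - A. v \<in> I} = I - A" by auto
    then show "(\<Sum>v\<in>{v \<in> \<Omega> - A. v \<in> I}. f I) = of_nat (j - card A) * f I"
      using I finA by (simp add: card_Diff_subset)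
  qed
  finally have "of_nat (j - card A) * (\<Sum>I\<in>?U A. f I) = 0" by (simp only: sum_distrib_left)
  moreover have "of_nat (j - card A) \<noteq> (0::rat)" using less(3) by simp
  ultimately show ?case by simp
qed

text \<open>Induction on B: the sets avoiding B split according to whether they contain the new
  element v, so v moves from B to A at the cost of a sign. \<open>sum_supersets_eq_0\<close> starts
  the induction.\<close>

lemma sum_disjoint_supersets:
  fixes f :: "'a set \<Rightarrow> rat"
  assumes fin: "finite \<Omega>"
    and rel: "\<And>J. J \<subseteq> \<Omega> \<Longrightarrow> Suc (card J) = j \<Longrightarrow> (\<Sum>i\<in>\<Omega> - J. f (insert i J)) = 0"
    and "finite B" "A \<inter> B = {}" "A \<union> B \<subseteq> \<Omega>" "card A + card B \<le> j"
  shows "(\<Sum>I | I \<subseteq> \<Omega> \<and> card I = j \<and> A \<subseteq> I \<and> I \<inter> B = {}. f I) =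
    (if card A + card B < j then 0 else (-1) ^ card B * f (A \<union> B))"
  using assms(3-)
proof (induction B arbitrary: A)
  case empty
  show ?case
  proof (cases "card A < j")
    case True
    then show ?thesis using sum_supersets_eq_0[OF fin rel, of j A] empty by simp
  next
    case False
    then have c: "card A = j" using empty by simp
    have "A = I" if "I \<subseteq> \<Omega>" "card I = j" "A \<subseteq> I" for I
      using that c finite_subset[of I, OF _ fin] by (intro card_subset_eq) auto
    then have "{I. I \<subseteq> \<Omega> \<and> card I = j \<and> A \<subseteq> I} = {A}" using empty c by blast
    then show ?thesis using c by simp
  qed
next
  case (insert v B)
  let ?U = "\<lambda>A B. {I. I \<subseteq> \<Omega> \<and> card I = j \<and> A \<subseteq> I \<and> I \<inter> B = {}}"
  have finU: "finite (?U A B)" for A B by (rule finite_subset[of _ "Pow \<Omega>"]) (use fin in auto)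
  have finA: "finite A" using insert.prems(2) fin by (meson Un_subset_iff finite_subset)
  have "?U A B = ?U A (insert v B) \<union> ?U (insert v A) B" by blast
  then have "sum f (?U A B) = sum f (?U A (insert v B) \<union> ?U (insert v A) B)" by (rule arg_cong)
  also have "\<dots> = sum f (?U A (insert v B)) + sum f (?U (insert v A) B)"
    by (rule sum.union_disjoint[OF finU finU]) blast
  finally have "sum f (?U A B) = sum f (?U A (insert v B)) + sum f (?U (insert v A) B)" .
  moreover have "A \<inter> B = {}" "A \<union> B \<subseteq> \<Omega>" "card A + card B < j" "v \<notin> A"
    "card (insert v B) = Suc (card B)"
    using insert.prems insert.hyps by auto
  moreover from this have "sum f (?U A B) = 0" by (simp add: insert.IH)
  moreover have "sum f (?U (insert v A) B) =
      (if card (insert v A) + card B < j then 0 else (-1) ^ card B * f (insert v A \<union> B))"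
    using insert.prems insert.hyps finA by (intro insert.IH) auto
  moreover have "insert v A \<union> B = A \<union> insert v B" by blast
  ultimately show ?case using finA by (simp split: if_splits)
qed

section \<open>Consequences of the sum relation, and descent on the degree in one variable\<close>

context singular_family
begin

lemma sum_eval_insert_eq_0:
  "J \<subseteq> \<Omega> \<Longrightarrow> Suc (card J) = j \<Longrightarrow> (\<Sum>i\<in>\<Omega> - J. poly_eval (F (insert i J)) x) = 0"
  using sum_insert_eq_0[of J] by (simp flip: poly_eval_sum)

text \<open>The complement of I has fewer than j elements, so the inclusion-exclusion sum over the
  index sets avoiding it is zero, and I is the only such set.\<close>

lemma eq_0_if_card_less:
  assumes "card \<Omega> < 2 * j" "I \<subseteq> \<Omega>" "card I = j"
  shows "F I = 0"
proof (rule poly_eval_faithful)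
  fix x
  have fI: "finite I" "finite (\<Omega> - I)" using assms finite_vars_set finite_subset by auto
  have c: "card (\<Omega> - I) < j" using assms fI by (simp add: card_Diff_subset)
  have "I' = I" if "I' \<subseteq> \<Omega>" "card I' = j" "I' \<inter> (\<Omega> - I) = {}" for I'
    using that assms fI by (intro card_subset_eq) auto
  then have "{I'. I' \<subseteq> \<Omega> \<and> card I' = j \<and> {} \<subseteq> I' \<and> I' \<inter> (\<Omega> - I) = {}} = {I}" using assms by auto
  then show "poly_eval (F I) x = 0"
    using sum_disjoint_supersets[where f = "\<lambda>I. poly_eval (F I) x" and j = j and A = "{}",
        OF finite_vars_set sum_eval_insert_eq_0 fI(2)] c by simp
qed

lemma sum_disjoint_eval:
  assumes "I \<subseteq> \<Omega>" "card I = j"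
  shows "(\<Sum>I' | I' \<subseteq> \<Omega> \<and> card I' = j \<and> I' \<inter> I = {}. poly_eval (F I') x) = (-1) ^ j * poly_eval (F I) x"
proof -
  have fI: "finite I" using assms finite_vars_set finite_subset by auto
  show ?thesis
    using sum_disjoint_supersets[where f = "\<lambda>I. poly_eval (F I) x" and j = j and A = "{}",
        OF finite_vars_set sum_eval_insert_eq_0 fI] assms by simp
qed

lemma degree_le_exists: "\<exists>D. degree_le v D"
proof -
  let ?U = "{I. I \<subseteq> \<Omega> \<and> card I = j}"
  have fin: "finite ?U" using finite_vars_set by simp
  have "\<exists>D. \<forall>I. \<forall>L>D I. coeff_in v L (F I) = 0"
    using coeff_in_eventually_0 by (intro choice allI)
  then obtain D where D: "\<And>I L. L > D I \<Longrightarrow> coeff_in v L (F I) = 0" by blast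
  have "D I \<le> Max (D ` ?U)" if "I \<in> ?U" for I using fin that by simp
  then have "degree_le v (Max (D ` ?U))"
    unfolding degree_le_def by (auto intro!: D elim: le_less_trans[rotated])
  then show ?thesis ..
qed

lemma degree_le_pred:
  assumes "degree_le v (Suc L)" "\<And>I. I \<subseteq> \<Omega> \<Longrightarrow> card I = j \<Longrightarrow> coeff_in v (Suc L) (F I) = 0"
  shows "degree_le v L"
  using assms unfolding degree_le_def by (metis Suc_lessI)

text \<open>The leading-exponent equations concern only the coefficient at the current bound, so the
  bound is lowered in single steps from an arbitrary start.\<close>

lemma degree_le_descend:
  assumes "\<And>L I. L > K \<Longrightarrow> degree_le v L \<Longrightarrow> I \<subseteq> \<Omega> \<Longrightarrow> card I = j \<Longrightarrow> coeff_in v L (F I) = 0"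
  shows "degree_le v K"
proof -
  obtain D where "degree_le v D" using degree_le_exists by blast
  then have "degree_le v (K + D)" by (auto simp: degree_le_def)
  then show ?thesis
  proof (induction D)
    case (Suc D)
    then show ?case using assms[of "Suc (K + D)"] degree_le_pred[of v "K + D"] by simp
  qed simp
qed

lemma eq_0_descend:
  assumes "\<And>L I. degree_le v L \<Longrightarrow> I \<subseteq> \<Omega> \<Longrightarrow> card I = j \<Longrightarrow> coeff_in v L (F I) = 0"
    and "I \<subseteq> \<Omega>" "card I = j"
  shows "F I = 0"
proof -
  have "degree_le v 0" using assms(1) by (intro degree_le_descend)
  then have "coeff_in v L (F I) = 0" for L
    using assms by (cases "L = 0") (auto simp: degree_le_def)
  then show ?thesis by (rule eq_0_if_coeff_in_eq_0)
qed

lemma degree_le_swap: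
  assumes "degree_le v L" "v \<in> \<Omega>" "u \<in> \<Omega>"
  shows "degree_le u L"
  unfolding degree_le_def
proof (intro allI impI)
  fix I L' assume I: "I \<subseteq> \<Omega>" "card I = j" and L': "L' > L"
  let ?I = "transpose u v ` I"
  have I': "?I \<subseteq> \<Omega>" "card ?I = j" using swap_index I assms by auto
  have inv: "transpose u v ` ?I = I" by (simp add: image_image)
  have sw: "poly_eval (F I) y = poly_eval (F ?I) (y \<circ> transpose u v)" for y
    using swap_eq[OF I' assms(3,2), of y] by (simp only: inv)
  have "poly_in u (F I) x - poly_in v (F ?I) (x \<circ> transpose u v) = 0" for x
  proof (rule poly_eq_0_iff_infinite[of "{}"])
    fix t
    have "x(u := t) \<circ> transpose u v = (x \<circ> transpose u v)(v := t)"
      by (auto simp: transpose_def)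
    then show "poly (poly_in u (F I) x - poly_in v (F ?I) (x \<circ> transpose u v)) t = 0"
      using sw[of "x(u := t)"] by (simp add: poly_poly_in)
  qed simp
  then have "poly_eval (coeff_in u L' (F I)) x = poly_eval (coeff_in v L' (F ?I)) (x \<circ> transpose u v)" for x
    by (simp flip: coeff_poly_in)
  then show "coeff_in u L' (F I) = 0"
    using assms(1) I' L' by (intro poly_eval_faithful) (simp add: degree_le_def)
qed

lemma leading_insert_eq_0:
  assumes "degree_le v L" "v \<in> \<Omega>" "of_nat L \<noteq> \<sigma> * of_nat (card \<Omega> + 1 - j)"
    and J: "J \<subseteq> \<Omega> - {v}" "Suc (card J) = j"
  shows "coeff_in v L (F (insert v J)) = 0"
proof (rule poly_eval_faithful)
  fix x
  have "card \<Omega> - card J = card \<Omega> + 1 - j" using J by simp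
  then show "poly_eval (coeff_in v L (F (insert v J))) x = 0"
    using leading_eq_insert[OF assms(1,2) J, of x] assms(3) by simp
qed

lemma leading_no_insert_eq_0:
  assumes "degree_le v L" "v \<in> \<Omega>" "of_nat L \<noteq> \<sigma> * of_nat j"
    and "\<And>J. J \<subseteq> \<Omega> - {v} \<Longrightarrow> Suc (card J) = j \<Longrightarrow> coeff_in v L (F (insert v J)) = 0"
    and I: "I \<subseteq> \<Omega>" "card I = j"
  shows "coeff_in v L (F I) = 0"
proof (cases "v \<in> I")
  case True
  then have "insert v (I - {v}) = I" by auto
  moreover have "Suc (card (I - {v})) = j"
    using True I finite_vars_set by (metis card_Suc_Diff1 finite_subset)
  ultimately show ?thesis using assms(4)[of "I - {v}"] I by (auto simp: subset_iff)
next
  case False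
  show ?thesis
  proof (rule poly_eval_faithful)
    fix x
    have "I \<subseteq> \<Omega> - {v}" using False I by auto
    from leading_eq_no_insert[OF assms(1,2) this I(2) assms(4), of x]
    show "poly_eval (coeff_in v L (F I)) x = 0" using assms(3) by simp
  qed
qed

end

section \<open>The leading exponent\<close>

locale two_row =
  fixes m n d :: nat and \<sigma> :: rat
  assumes m_pos: "m > 0" and n_ge_2: "n \<ge> 2" and d_ge_2: "d \<ge> 2"
    and coprime: "coprime m n" and \<sigma>_def: "\<sigma> = of_nat m / of_nat n"
begin

lemma \<sigma>_n: "\<sigma> * of_nat n = of_nat m"
  using n_ge_2 by (simp add: \<sigma>_def)

lemma \<sigma>_pos: "\<sigma> > 0"
  using m_pos n_ge_2 by (simp add: \<sigma>_def)

lemma \<sigma>_dn: "\<sigma> * of_nat (d * n) = of_nat (m * d)"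
  using \<sigma>_n by (simp add: mult.commute mult.left_commute)

lemma \<sigma>_eq_of_nat_iff: "\<sigma> * of_nat k = of_nat L \<longleftrightarrow> m * k = n * L"
proof -
  have "\<sigma> * of_nat k = of_nat L \<longleftrightarrow> of_nat (m * k) = (of_nat (n * L) :: rat)"
    using n_ge_2 by (simp add: \<sigma>_def field_simps)
  then show ?thesis by (simp only: of_nat_eq_iff)
qed

lemma \<sigma>_not_int:
  assumes "0 < k" "k < n"
  shows "\<sigma> * of_nat k \<noteq> of_nat L"
proof
  assume "\<sigma> * of_nat k = of_nat L"
  then have "n dvd m * k" by (simp add: \<sigma>_eq_of_nat_iff)
  then have "n dvd k" using coprime by (simp add: coprime_commute coprime_dvd_mult_right_iff)
  then show False using assms by (auto dest: dvd_imp_le)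
qed

text \<open>Besides \<open>m d\<close>, the Dunkl equations leave \<open>m\<close> as a possible leading exponent for \<open>j = n\<close>;
  this rules it out.\<close>

lemma eq_0_if_degree_le_m:
  assumes "singular_family \<sigma> \<Omega> n F" "\<And>v. v \<in> \<Omega> \<Longrightarrow> singular_family.degree_le \<Omega> n F v m"
    and "I \<subseteq> \<Omega>" "card I = n"
  shows "F I = 0"
  using assms
proof (induction "card \<Omega>" arbitrary: \<Omega> F I rule: less_induct)
  case less
  interpret singular_family \<sigma> \<Omega> n F by fact
  show ?case
  proof (cases "card \<Omega> < 2 * n")
    case True
    then show ?thesis using less by (intro eq_0_if_card_less)
  next
    case False
    then have "\<Omega> \<noteq> {}" using n_ge_2 by auto
    then obtain v where v: "v \<in> \<Omega>" by auto
    have "coeff_in v L (F I) = 0" if L: "degree_le v L" and I: "I \<subseteq> \<Omega>" "card I = n" for L I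
    proof (cases "L \<le> m")
      case False
      then show ?thesis using less(3)[OF v] I by (auto simp: degree_le_def)
    next
      case True
      \<comment> \<open>At least 2 n variables are left, so the exponent attached to sets through v
        exceeds m and cannot occur.\<close>
      have "\<sigma> * of_nat n < \<sigma> * of_nat (card \<Omega> + 1 - n)"
        using \<sigma>_pos False n_ge_2 by (intro mult_strict_left_mono) auto
      then have "of_nat m < \<sigma> * of_nat (card \<Omega> + 1 - n)" by (simp only: \<sigma>_n)
      moreover have "of_nat L \<le> (of_nat m :: rat)" using True by simp
      ultimately have "of_nat L < \<sigma> * of_nat (card \<Omega> + 1 - n)" by (rule order_le_less_trans[rotated])
      then have ne: "of_nat L \<noteq> \<sigma> * of_nat (card \<Omega> + 1 - n)" by (rule less_imp_neq)
      have ins: "coeff_in v L (F (insert v J)) = 0" if "J \<subseteq> \<Omega> - {v}" "Suc (card J) = n" for J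
        by (rule leading_insert_eq_0[OF L v ne that])
      show ?thesis
      proof (cases "L = m")
        case False
        then have "of_nat L \<noteq> \<sigma> * of_nat n" by (simp add: \<sigma>_n)
        then show ?thesis by (rule leading_no_insert_eq_0[OF L v]) (use ins I in blast)+
      next
        case True
        show ?thesis
        proof (cases "v \<in> I")
          case True
          then have "insert v (I - {v}) = I" by auto
          moreover have "Suc (card (I - {v})) = n"
            using True I finite_vars_set by (metis card_Suc_Diff1 finite_subset)
          ultimately show ?thesis using ins[of "I - {v}"] I by (auto simp: subset_iff)
        next
          case v': False
          \<comment> \<open>With v outside I, the leading coefficients keep j = n and the degree
            bound m, so the induction hypothesis applies to them.\<close>
          have fam: "singular_family \<sigma> (\<Omega> - {v}) n (\<lambda>I. coeff_in v L (F I))"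
            by (rule leading_family_no_insert[OF L v ins])
          show ?thesis
          proof (rule less.hyps[OF _ fam])
            show "card (\<Omega> - {v}) < card \<Omega>" using v finite_vars_set by (intro card_Diff1_less)
            fix u assume u: "u \<in> \<Omega> - {v}"
            have "degree_le u m" using u less(3) by auto
            then show "singular_family.degree_le (\<Omega> - {v}) n (\<lambda>I. coeff_in v L (F I)) u m"
              using u unfolding singular_family.degree_le_def[OF fam] degree_le_def
              by (auto simp: coeff_in_commute[of u v])
          qed (use I v' in auto)
        qed
      qed
    qed
    then show ?thesis using less by (intro eq_0_descend[of v])
  qed
qed

text \<open>The condition \<open>|\<Omega>| - j + 1 = d n\<close> is preserved when leading coefficients are taken.\<close>

definition family :: "nat \<Rightarrow> nat set \<Rightarrow> (nat set \<Rightarrow> poly_q) \<Rightarrow> bool" where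
  "family j \<Omega> F \<longleftrightarrow> singular_family \<sigma> \<Omega> j F \<and> card \<Omega> = d * n - 1 + j \<and> j \<le> n \<and>
     (\<exists>I. I \<subseteq> \<Omega> \<and> card I = j \<and> F I \<noteq> 0)"

definition lead :: "nat \<Rightarrow> (nat set \<Rightarrow> poly_q) \<Rightarrow> nat set \<Rightarrow> poly_q" where
  "lead v F = (\<lambda>J. coeff_in v (m * d) (F (insert v J)))"

lemma card_family:
  assumes "family j \<Omega> F"
  shows "card \<Omega> + 1 - j = d * n" "finite \<Omega>"
proof -
  have "d * n > 0" using d_ge_2 n_ge_2 by simp
  then show "card \<Omega> + 1 - j = d * n" using assms by (simp add: family_def)
  show "finite \<Omega>" using assms by (simp add: family_def singular_family_def)
qed

text \<open>A leading exponent can only be \<sigma> d n = m d or \<sigma> j. The latter is m for j =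
  n, which does not exceed m d, and it is no integer for 0 < j < n.\<close>

lemma family_degree_le:
  assumes F: "family j \<Omega> F" and j: "j > 0" and v: "v \<in> \<Omega>"
  shows "singular_family.degree_le \<Omega> j F v (m * d)"
proof -
  interpret singular_family \<sigma> \<Omega> j F using F by (simp add: family_def)
  show ?thesis
  proof (rule degree_le_descend)
    fix L I assume L: "L > m * d" "degree_le v L" and I: "I \<subseteq> \<Omega>" "card I = j"
    have "of_nat L \<noteq> \<sigma> * of_nat (card \<Omega> + 1 - j)"
      using L unfolding card_family[OF F] \<sigma>_dn by (simp flip: of_nat_mult)
    then have ins: "coeff_in v L (F (insert v J)) = 0" if "J \<subseteq> \<Omega> - {v}" "Suc (card J) = j" for J
      using that L v by (intro leading_insert_eq_0) auto
    have "of_nat L \<noteq> \<sigma> * of_nat j"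
    proof (cases "j = n")
      case True
      have "m \<le> m * d" using d_ge_2 by simp
      then have "L \<noteq> m" using L(1) by linarith
      then show ?thesis using True by (simp add: \<sigma>_n)
    next
      case False
      then show ?thesis using \<sigma>_not_int[of j L] j F by (auto simp: family_def)
    qed
    then show "coeff_in v L (F I) = 0"
      by (rule leading_no_insert_eq_0[OF L(2) v]) (use ins I in blast)+
  qed
qed

text \<open>Otherwise the exponent m d is lost. For j < n no integer exponent remains, so F is zero
  on all index sets; for j = n only m remains, which \<open>eq_0_if_degree_le_m\<close> excludes.
  Both contradict the nonvanishing built into \<open>family\<close>.\<close>

lemma lead_nonzero:
  assumes F: "family j \<Omega> F" and j: "j > 0" and v: "v \<in> \<Omega>"
  shows "\<exists>J. J \<subseteq> \<Omega> - {v} \<and> Suc (card J) = j \<and> lead v F J \<noteq> 0"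
proof (rule ccontr)
  assume "\<not> ?thesis"
  then have zero: "\<And>J. J \<subseteq> \<Omega> - {v} \<Longrightarrow> Suc (card J) = j \<Longrightarrow> coeff_in v (m * d) (F (insert v J)) = 0"
    by (auto simp: lead_def)
  interpret singular_family \<sigma> \<Omega> j F using F by (simp add: family_def)
  have ins: "coeff_in v L (F (insert v J)) = 0" if "degree_le v L" "J \<subseteq> \<Omega> - {v}" "Suc (card J) = j" for L J
  proof (cases "L = m * d")
    case True
    then show ?thesis using zero that by simp
  next
    case False
    then have "of_nat L \<noteq> \<sigma> * of_nat (card \<Omega> + 1 - j)"
      unfolding card_family[OF F] \<sigma>_dn of_nat_eq_iff .
    then show ?thesis using that v by (intro leading_insert_eq_0) auto
  qed
  have "F I = 0" if I: "I \<subseteq> \<Omega>" "card I = j" for I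
  proof (cases "j = n")
    case True
    have "degree_le v m"
    proof (rule degree_le_descend)
      fix L I assume L: "L > m" "degree_le v L" and I: "I \<subseteq> \<Omega>" "card I = j"
      have "of_nat L \<noteq> \<sigma> * of_nat j" using L True by (simp add: \<sigma>_n)
      then show "coeff_in v L (F I) = 0"
        by (rule leading_no_insert_eq_0[OF L(2) v]) (use ins L I in blast)+
    qed
    then have "degree_le u m" if "u \<in> \<Omega>" for u using degree_le_swap v that by blast
    then show ?thesis
      using eq_0_if_degree_le_m[of \<Omega> F I] singular_family_axioms I True by blast
  next
    case False
    show ?thesis
    proof (rule eq_0_descend[of v])
      fix L I assume L: "degree_le v L" and I: "I \<subseteq> \<Omega>" "card I = j"
      have "of_nat L \<noteq> \<sigma> * of_nat j" using \<sigma>_not_int[of j L] False j F by (auto simp: family_def)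
      then show "coeff_in v L (F I) = 0"
        by (rule leading_no_insert_eq_0[OF L v]) (use ins L I in blast)+
    qed (use I in auto)
  qed
  then show False using F by (auto simp: family_def)
qed

lemma family_lead:
  assumes F: "family (Suc j) \<Omega> F" and v: "v \<in> \<Omega>"
  shows "family j (\<Omega> - {v}) (lead v F)"
proof -
  interpret singular_family \<sigma> \<Omega> "Suc j" F using F by (simp add: family_def)
  have "singular_family \<sigma> (\<Omega> - {v}) j (lead v F)"
    unfolding lead_def using family_degree_le[OF F _ v] v by (intro leading_family_insert) auto
  then show ?thesis
    using F v lead_nonzero[OF F _ v] finite_vars_set by (auto simp: family_def)
qed

end

section \<open>Values at indicator vectors\<close>

lemma coeff_linear_mult_pderiv:
  "coeff ([:- c, 1:] * pderiv P) k = of_nat k * coeff P k - c * of_nat (Suc k) * coeff P (Suc k)"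
  for P :: "rat poly"
  by (cases k) (simp_all add: coeff_pCons coeff_pderiv algebra_simps)

text \<open>Subtracting the multiple of the power with the same top coefficient leaves a solution
  \<open>R\<close> of the same equation, and the coefficient form of the equation carries the zero
  at index M down to index 0.\<close>

lemma poly_eq_power_if_ode:
  fixes P :: "rat poly"
  assumes ode: "[:- c, 1:] * pderiv P = smult (of_nat M) P" and deg: "degree P \<le> M"
  shows "poly P z = coeff P M * (z - c) ^ M"
proof -
  define R where "R = P - smult (coeff P M) ([:- c, 1:] ^ M)"
  have "[:- c, 1:] * pderiv ([:- c, 1:] ^ M) = smult (of_nat M) ([:- c, 1:] ^ M)"
    by (cases M) (simp_all only: pderiv_power_Suc, simp_all add: pderiv_pCons algebra_simps)
  then have odeR: "[:- c, 1:] * pderiv R = smult (of_nat M) R"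
    using ode by (simp add: R_def pderiv_diff pderiv_smult right_diff_distrib smult_diff_right
        del: mult_pCons_left) (simp add: mult.commute)
  have rec: "(of_nat M - of_nat k) * coeff R k = - c * of_nat (Suc k) * coeff R (Suc k)" for k
    using arg_cong[OF odeR, of "\<lambda>p. coeff p k"] unfolding coeff_linear_mult_pderiv
    by (simp add: algebra_simps)
  have "coeff R (M - i) = 0" for i
  proof (induction i)
    case 0
    show ?case by (simp add: R_def coeff_linear_power)
  next
    case (Suc i)
    show ?case
    proof (cases "i < M")
      case True
      then have "Suc (M - Suc i) = M - i" by simp
      then have "(of_nat M - of_nat (M - Suc i)) * coeff R (M - Suc i) = 0"
        using rec[of "M - Suc i"] Suc by simp
      then show ?thesis using True by (simp add: of_nat_diff)
    qed (use Suc in simp)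
  qed
  moreover have "coeff R k = 0" if "k > M" for k
    using deg that by (simp add: R_def coeff_eq_0 degree_linear_power)
  ultimately have "R = 0" by (intro poly_eqI) (metis coeff_0 diff_diff_cancel le_less_linear)
  then have "poly P z = poly (smult (coeff P M) ([:- c, 1:] ^ M)) z" by (simp add: R_def)
  then show ?thesis by (simp add: poly_power)
qed

text \<open>By the recurrence, p is a multiple of the terms of 2F1(-M, B; C; 1), which
  Chu-Vandermonde sums. The last term is recorded too, so that the sum can be expressed through
  either end of the series.\<close>

lemma sum_hypergeometric:
  fixes p :: "nat \<Rightarrow> rat"
  assumes rec: "\<And>k. k < M \<Longrightarrow> of_nat (Suc k) * (C + of_nat k) * p (Suc k) = (of_nat k - of_nat M) * (B + of_nat k) * p k"
    and C: "\<And>i. i < M \<Longrightarrow> C + of_nat i \<noteq> 0"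
  shows "(\<Sum>k\<le>M. p k) = p 0 * pochhammer (C - B) M / pochhammer C M"
    and "p M = p 0 * pochhammer B M * (-1) ^ M / pochhammer C M"
proof -
  have p: "p k = p 0 * ((pochhammer B k * pochhammer (- of_nat M) k) / (of_nat (fact k) * pochhammer C k))" if "k \<le> M" for k
    using that
  proof (induction k)
    case (Suc k)
    then have ne: "C + of_nat k \<noteq> 0" "pochhammer C k \<noteq> 0"
      using C by (auto simp: pochhammer_eq_0_iff eq_neg_iff_add_eq_0)
    have den: "of_nat (Suc k) * (C + of_nat k) \<noteq> 0" using ne by (simp del: of_nat_Suc)
    have "p (Suc k) = (of_nat k - of_nat M) * (B + of_nat k) * p k / (of_nat (Suc k) * (C + of_nat k))"
      unfolding nonzero_eq_divide_eq[OF den] using rec[of k] Suc.prems by (simp only: mult.commute Suc_le_eq)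
    also have "p k = p 0 * ((pochhammer B k * pochhammer (- of_nat M) k) / (of_nat (fact k) * pochhammer C k))"
      using Suc by simp
    also have "(of_nat k - of_nat M) * (B + of_nat k) * \<dots> / (of_nat (Suc k) * (C + of_nat k))
      = p 0 * ((pochhammer B (Suc k) * pochhammer (- of_nat M) (Suc k)) / (of_nat (fact (Suc k)) * pochhammer C (Suc k)))"
    proof -
      have "of_nat k - of_nat M = - of_nat M + (of_nat k :: rat)" by simp
      then show ?thesis
        by (simp only: pochhammer_Suc fact_Suc of_nat_mult times_divide_eq_left times_divide_eq_right
            divide_divide_eq_left mult_ac of_nat_id)
    qed
    finally show ?case .
  qed simp
  have "\<forall>i\<in>{0..<M}. C \<noteq> - of_nat i" using C by (auto simp: eq_neg_iff_add_eq_0)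
  from Vandermonde_pochhammer[OF this, of B]
  have V: "(\<Sum>k\<le>M. (pochhammer B k * pochhammer (- of_nat M) k) / (of_nat (fact k) * pochhammer C k)) =
      pochhammer (C - B) M / pochhammer C M"
    by (simp add: atMost_atLeast0)
  have "(\<Sum>k\<le>M. p k) =
      (\<Sum>k\<le>M. p 0 * ((pochhammer B k * pochhammer (- of_nat M) k) / (of_nat (fact k) * pochhammer C k)))"
    by (intro sum.cong refl p) simp
  then show "(\<Sum>k\<le>M. p k) = p 0 * pochhammer (C - B) M / pochhammer C M"
    unfolding sum_distrib_left[symmetric] V by simp
  have "pochhammer (- of_nat M) M = (-1) ^ M * (fact M :: rat)"
    using pochhammer_same[of M, where ?'a = rat] by simp
  then show "p M = p 0 * pochhammer B M * (-1) ^ M / pochhammer C M"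
    using p[of M] by simp
qed

definition ind :: "nat set \<Rightarrow> nat \<Rightarrow> rat" where
  "ind S = (\<lambda>i. of_bool (i \<in> S))"

lemma ind_insert: "(ind S)(v := 1) = ind (insert v S)"
  by (auto simp: ind_def)

lemma ind_remove: "v \<notin> S \<Longrightarrow> (ind S)(v := 0) = ind S"
  by (auto simp: ind_def)

context two_row
begin

lemma family_sum_insert:
  assumes "family j \<Omega> F" "J \<subseteq> \<Omega>" "Suc (card J) = j"
  shows "(\<Sum>k\<in>\<Omega> - J. poly_eval (F (insert k J)) x) = 0"
  using assms singular_family.sum_eval_insert_eq_0 by (auto simp: family_def)

text \<open>Swaps of v within I contribute nothing, and all other denominators are z - c. The sum
  relation turns the numerators into card (\<Omega> - I) + 1 = d n copies of F I, so the restriction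
  P satisfies (z - c) P' = m d P.\<close>

lemma eval_constant_outside:
  assumes F: "family (Suc j) \<Omega> F" and I: "I \<subseteq> \<Omega>" "card I = Suc j" "v \<in> I"
    and x: "\<And>k. k \<in> \<Omega> - I \<Longrightarrow> x k = c"
  shows "poly_eval (F I) (x(v := t)) = (t - c) ^ (m * d) * poly_eval (lead v F (I - {v})) x"
proof -
  interpret singular_family \<sigma> \<Omega> "Suc j" F using F by (simp add: family_def)
  let ?P = "poly_in v (F I) x"
  let ?J = "I - {v}"
  have fI: "finite I" using I finite_vars_set finite_subset by blast
  have v: "v \<in> \<Omega>" using I by auto
  have J: "?J \<subseteq> \<Omega>" "Suc (card ?J) = Suc j" "insert v ?J = I" using I fI by auto
  have card: "card (\<Omega> - I) + 1 = d * n"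
    using card_family[OF F] I fI card_mono[OF finite_vars_set I(1)] by (simp add: card_Diff_subset)
  have "[:- c, 1:] * pderiv ?P - smult (of_nat (m * d)) ?P = 0"
  proof (rule poly_eq_0_iff_infinite[of "insert c (x ` (\<Omega> - {v}))"])
    fix z assume z: "z \<notin> insert c (x ` (\<Omega> - {v}))"
    let ?e = "\<lambda>I. poly_eval (F I) (x(v := z))"
    have "poly (pderiv ?P) z = \<sigma> * (\<Sum>k\<in>\<Omega> - {v}. (?e I - ?e (transpose v k ` I)) / (z - x k))"
      using dunkl_eq_line[OF I(1,2) v, of z x] z by (simp add: poly_poly_in)
    also have "(\<Sum>k\<in>\<Omega> - {v}. (?e I - ?e (transpose v k ` I)) / (z - x k)) =
        (\<Sum>k\<in>\<Omega> - I. (?e I - ?e (insert k ?J)) / (z - c))"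
    proof (rule sum.mono_neutral_cong_right)
      have "transpose v k ` I = I" if "k \<in> I" for k
        using that I by (intro transpose_image_both)
      then show "\<forall>k\<in>\<Omega> - {v} - (\<Omega> - I). (?e I - ?e (transpose v k ` I)) / (z - x k) = 0" by auto
      fix k assume k: "k \<in> \<Omega> - I"
      then have "transpose v k ` I = insert k ?J"
        using transpose_image_insert[of k I v] I by (simp add: transpose_commute)
      then show "(?e I - ?e (transpose v k ` I)) / (z - x k) = (?e I - ?e (insert k ?J)) / (z - c)"
        using x[OF k] by simp
    qed (use finite_vars_set I in auto)
    also have "\<dots> = (of_nat (card (\<Omega> - I)) * ?e I - (\<Sum>k\<in>\<Omega> - I. ?e (insert k ?J))) / (z - c)"
      by (simp add: sum_subtractf flip: sum_divide_distrib)
    also have "(\<Sum>k\<in>\<Omega> - I. ?e (insert k ?J)) = - ?e I"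
    proof -
      have "\<Omega> - ?J = insert v (\<Omega> - I)" using v I by auto
      then show ?thesis using family_sum_insert[OF F J(1,2), of "x(v := z)"] J(3) I finite_vars_set
        by (simp add: eq_neg_iff_add_eq_0 add.commute)
    qed
    also have "of_nat (card (\<Omega> - I)) * ?e I - - ?e I = of_nat (card (\<Omega> - I) + 1) * ?e I"
      by (simp add: algebra_simps)
    also have "\<sigma> * (of_nat (card (\<Omega> - I) + 1) * ?e I / (z - c)) = of_nat (m * d) * ?e I / (z - c)"
      unfolding card by (simp only: mult.assoc[symmetric] times_divide_eq_right \<sigma>_dn)
    finally have "(z - c) * poly (pderiv ?P) z = of_nat (m * d) * ?e I" using z by simp
    then show "poly ([:- c, 1:] * pderiv ?P - smult (of_nat (m * d)) ?P) z = 0"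
      by (simp add: poly_poly_in algebra_simps)
  qed (use finite_vars_set in simp)
  moreover have "degree ?P \<le> m * d"
    using degree_poly_in_le[OF family_degree_le[OF F _ v] I(1,2)] by simp
  ultimately have "poly ?P t = coeff ?P (m * d) * (t - c) ^ (m * d)"
    by (intro poly_eq_power_if_ode) auto
  moreover have "lead v F ?J = coeff_in v (m * d) (F I)" by (simp only: lead_def J(3))
  ultimately show ?thesis by (simp add: poly_poly_in coeff_poly_in mult.commute)
qed

lemma eval_ind_lead:
  assumes "family (Suc j) \<Omega> F" "I \<subseteq> \<Omega>" "card I = Suc j" "v \<in> I"
  shows "poly_eval (F I) (ind I) = poly_eval (lead v F (I - {v})) (ind (I - {v}))"
proof -
  have "(ind (I - {v}))(v := 1) = ind I" using assms(4) by (simp add: ind_insert insert_absorb)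
  then show ?thesis
    using eval_constant_outside[OF assms, of "ind (I - {v})" 0 1] by (simp add: ind_def)
qed

lemma eval_ind_compl_lead:
  assumes "family (Suc j) \<Omega> F" "I \<subseteq> \<Omega>" "card I = Suc j" "v \<in> I"
  shows "poly_eval (F I) (ind (\<Omega> - I)) = (-1) ^ (m * d) * poly_eval (lead v F (I - {v})) (ind (\<Omega> - I))"
  using eval_constant_outside[OF assms, of "ind (\<Omega> - I)" 1 0] ind_remove[of v "\<Omega> - I"] assms(4)
  by (simp add: ind_def)

text \<open>For j = 0 the empty set is the only index, and \<sigma> j = 0 is the only possible
  leading exponent in every variable.\<close>

lemma eval_family_0:
  assumes F: "family 0 \<Omega> F"
  shows "\<exists>c. c \<noteq> 0 \<and> (\<forall>x. poly_eval (F {}) x = c)"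
proof -
  interpret singular_family \<sigma> \<Omega> 0 F using F by (simp add: family_def)
  have empty: "I = {}" if "I \<subseteq> \<Omega>" "card I = 0" for I
    using that finite_vars_set finite_subset by fastforce
  have deg: "degree_le v 0" if v: "v \<in> \<Omega>" for v
  proof (rule degree_le_descend)
    fix L I assume L: "L > 0" "degree_le v L" and I: "I \<subseteq> \<Omega>" "card I = 0"
    have "of_nat L \<noteq> \<sigma> * of_nat 0" using L(1) by simp
    then show "coeff_in v L (F I) = 0"
      by (rule leading_no_insert_eq_0[OF L(2) v]) (use I in auto)
  qed
  have "a = 0" if a: "a \<in> Poly_Mapping.keys (F {})" for a
  proof (rule ccontr)
    assume "a \<noteq> 0"
    then obtain v where v: "Poly_Mapping.lookup a v \<noteq> 0" by (metis poly_mapping_eqI lookup_zero)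
    then have "v \<in> vars (F {})" using a by (auto simp: vars_def in_keys_iff)
    then have "v \<in> \<Omega>" using vars_subset[of "{}"] by auto
    then have "coeff_in v (Poly_Mapping.lookup a v) (F {}) = 0"
      using deg v by (auto simp: degree_le_def)
    then show False using a lookup_coeff_in[of a v _ "F {}"] by (simp add: in_keys_iff)
  qed
  then have p: "F {} = Poly_Mapping.single 0 (Poly_Mapping.lookup (F {}) 0)"
    by (intro poly_mapping_eqI) (auto simp: lookup_single when_def in_keys_iff)
  have "F {} \<noteq> 0" using F empty by (auto simp: family_def)
  then have "Poly_Mapping.lookup (F {}) 0 \<noteq> 0" using p by (metis single_zero)
  moreover have "poly_eval (F {}) x = Poly_Mapping.lookup (F {}) 0" for x
    by (subst p) (simp add: poly_eval_single)
  ultimately show ?thesis by blast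
qed

text \<open>Passing to \<open>lead\<close> keeps this value and again gives a nonzero family; after
  j steps a nonzero constant is reached.\<close>

lemma eval_ind_nonzero:
  assumes "family j \<Omega> F" "I \<subseteq> \<Omega>" "card I = j"
  shows "poly_eval (F I) (ind I) \<noteq> 0"
  using assms
proof (induction j arbitrary: \<Omega> F I)
  case 0
  then have "I = {}" using card_family(2)[OF 0(1)] finite_subset by fastforce
  then show ?case using eval_family_0[OF 0(1)] by auto
next
  case (Suc j)
  then obtain v where v: "v \<in> I" by fastforce
  then have "family j (\<Omega> - {v}) (lead v F)" using Suc.prems by (intro family_lead) auto
  moreover have "I - {v} \<subseteq> \<Omega> - {v}" using Suc.prems by auto
  moreover have "card (I - {v}) = j" using Suc.prems v by simp
  ultimately show ?case using Suc.IH eval_ind_lead[OF Suc.prems v] by simp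
qed

text \<open>Each passage to \<open>lead\<close> costs (-1)^(m d), while the point stays the same:
  removing v from both \<open>\<Omega>\<close> and I does not change the complement.\<close>

lemma eval_ind_compl:
  assumes "family j \<Omega> F" "I \<subseteq> \<Omega>" "card I = j"
  shows "poly_eval (F I) (ind (\<Omega> - I)) = (-1) ^ (m * d * j) * poly_eval (F I) (ind I)"
  using assms
proof (induction j arbitrary: \<Omega> F I)
  case 0
  then have "I = {}" using card_family(2)[OF 0(1)] finite_subset by fastforce
  then show ?case using eval_family_0[OF 0(1)] by auto
next
  case (Suc j)
  then obtain v where v: "v \<in> I" by fastforce
  then have "family j (\<Omega> - {v}) (lead v F)" using Suc.prems by (intro family_lead) auto
  moreover have "I - {v} \<subseteq> \<Omega> - {v}" using Suc.prems by auto
  moreover have "card (I - {v}) = j" using Suc.prems v by simp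
  moreover have "\<Omega> - {v} - (I - {v}) = \<Omega> - I" using v by auto
  ultimately have "poly_eval (lead v F (I - {v})) (ind (\<Omega> - I)) =
      (-1) ^ (m * d * j) * poly_eval (lead v F (I - {v})) (ind (I - {v}))"
    using Suc.IH[of "\<Omega> - {v}" "lead v F" "I - {v}"] by simp
  then show ?case
    unfolding eval_ind_lead[OF Suc.prems v] eval_ind_compl_lead[OF Suc.prems v]
    by (simp add: power_add)
qed


subsection \<open>The hypergeometric recurrence on a line\<close>

text \<open>Only swaps of v with k in I matter, and there the point has coordinate 1. As the point
  is constant on T, the swapped set may be taken to be \<open>insert v (I - {i0})\<close> for every
  k.\<close>

lemma line_first_eq:
  assumes F: "family j \<Omega> F" and v: "v \<in> \<Omega>" and T: "T \<subseteq> \<Omega> - {v}"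
    and I: "I \<subseteq> T" "card I = j" "i0 \<in> I"
  shows "[:-1, 1:] * pderiv (poly_in v (F I) (ind T)) =
    smult (\<sigma> * of_nat j) (poly_in v (F I) (ind T) - poly_in v (F (insert v (I - {i0}))) (ind T))"
proof -
  interpret singular_family \<sigma> \<Omega> j F using F by (simp add: family_def)
  let ?A = "poly_in v (F I) (ind T)" and ?B = "poly_in v (F (insert v (I - {i0}))) (ind T)"
  have fI: "finite I" using I T finite_vars_set by (meson Diff_subset finite_subset)
  have I': "I \<subseteq> \<Omega>" "v \<notin> I" using I T by auto
  have B: "poly_eval (F (insert v (I - {k}))) ((ind T)(v := z)) = poly ?B z" if k: "k \<in> I" for k z
  proof (cases "k = i0")
    case False
    have "transpose k i0 ` insert v (I - {k}) = insert k (insert v (I - {k}) - {i0})"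
      using k I False I' by (intro transpose_image_insert) auto
    also have "\<dots> = insert v (I - {i0})" using k I False I' by auto
    finally have tr: "transpose k i0 ` insert v (I - {k}) = insert v (I - {i0})" .
    have "poly_eval (F (transpose k i0 ` insert v (I - {k}))) ((ind T)(v := z)) =
        poly_eval (F (insert v (I - {k}))) ((ind T)(v := z))"
    proof (rule swap_equal_coords)
      show "insert v (I - {k}) \<subseteq> \<Omega>" using v I' by auto
      show "card (insert v (I - {k})) = j" using card_Suc_Diff1[OF fI k] I I' fI by simp
      show "k \<in> \<Omega>" "i0 \<in> \<Omega>" using k I I' by auto
      have "k \<noteq> v" "i0 \<noteq> v" "k \<in> T" "i0 \<in> T" using k I I' by auto
      then show "((ind T)(v := z)) k = ((ind T)(v := z)) i0" by (simp add: ind_def)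
    qed
    then show ?thesis by (simp only: tr poly_poly_in)
  qed (simp add: poly_poly_in)
  have "[:-1, 1:] * pderiv ?A - smult (\<sigma> * of_nat j) (?A - ?B) = 0"
  proof (rule poly_eq_0_iff_infinite[of "insert 1 (ind T ` (\<Omega> - {v}))"])
    fix z assume z: "z \<notin> insert 1 (ind T ` (\<Omega> - {v}))"
    have "poly (pderiv ?A) z = \<sigma> * (\<Sum>k\<in>\<Omega> - {v}.
        (poly ?A z - poly (poly_in v (F (transpose v k ` I)) (ind T)) z) / (z - ind T k))"
      using dunkl_eq_line[OF I'(1) I(2) v, of z "ind T"] z by simp
    also have "(\<Sum>k\<in>\<Omega> - {v}. (poly ?A z - poly (poly_in v (F (transpose v k ` I)) (ind T)) z) / (z - ind T k))
       = (\<Sum>k\<in>I. (poly ?A z - poly ?B z) / (z - 1))"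
    proof (rule sum.mono_neutral_cong_right)
      have "transpose v k ` I = I" if "k \<notin> I" for k
        using that I' by (intro transpose_image_neither)
      then show "\<forall>k\<in>\<Omega> - {v} - I. (poly ?A z - poly (poly_in v (F (transpose v k ` I)) (ind T)) z) / (z - ind T k) = 0"
        by simp
      fix k assume k: "k \<in> I"
      have "transpose v k ` I = insert v (I - {k})" using k I' by (intro transpose_image_insert)
      moreover have "ind T k = 1" using k I by (auto simp: ind_def)
      ultimately show "(poly ?A z - poly (poly_in v (F (transpose v k ` I)) (ind T)) z) / (z - ind T k) =
          (poly ?A z - poly ?B z) / (z - 1)"
        using B[OF k, of z] by (simp only: poly_poly_in)
    qed (use finite_vars_set I' in auto)
    finally have "(z - 1) * poly (pderiv ?A) z = \<sigma> * of_nat j * (poly ?A z - poly ?B z)"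
      using z I by simp
    then show "poly ([:-1, 1:] * pderiv ?A - smult (\<sigma> * of_nat j) (?A - ?B)) z = 0"
      by (simp add: algebra_simps)
  qed (use finite_vars_set in simp)
  then show ?thesis by simp
qed

text \<open>The Dunkl equation for the index set through v has poles at 0 and 1. The sum relation
  eliminates the values at index sets that reach into the zeros \<open>Z\<close> of the point, and
  \<open>line_first_eq\<close> trades the pole at 1 for a derivative. The factor d n - \<beta> is
  card Z + 1.\<close>

lemma line_second_eq:
  assumes F: "family j \<Omega> F" and v: "v \<in> \<Omega>" and T: "T \<subseteq> \<Omega> - {v}"
    and I: "I \<subseteq> T" "card I = j" "i0 \<in> I"
    and \<beta>_def: "\<beta> = card T + 1 - j"
  shows "[:0, 1:] * pderiv (poly_in v (F (insert v (I - {i0}))) (ind T)) =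
    smult (\<sigma> * (of_nat (d * n) - of_nat \<beta>)) (poly_in v (F (insert v (I - {i0}))) (ind T)) +
    smult (\<sigma> * of_nat \<beta>) (poly_in v (F I) (ind T)) -
    smult (of_nat \<beta> / of_nat j) ([:0, 1:] * pderiv (poly_in v (F I) (ind T)))"
proof -
  interpret singular_family \<sigma> \<Omega> j F using F by (simp add: family_def)
  let ?A = "poly_in v (F I) (ind T)" and ?B = "poly_in v (F (insert v (I - {i0}))) (ind T)"
  define J where "J = I - {i0}"
  have fin: "finite T" "finite I" "finite J" using I T finite_vars_set unfolding J_def
    by (meson Diff_subset finite_subset finite_Diff)+
  have I': "I \<subseteq> \<Omega>" "v \<notin> I" using I T by auto
  have J: "J \<subseteq> \<Omega>" "v \<notin> J" "Suc (card J) = j" "J \<subseteq> T" "insert i0 J = I"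
    using card_Suc_Diff1[OF fin(2) I(3)] I I' by (auto simp: J_def)
  have vJ: "insert v J \<subseteq> \<Omega>" "card (insert v J) = j" using J v fin by auto
  have j: "j > 0" using J by simp
  have cT: "card (T - J) = \<beta>" using J fin card_mono[of T J] by (simp add: card_Diff_subset \<beta>_def)
  define Z where "Z = \<Omega> - {v} - T"
  have cZ: "card Z + 1 + \<beta> = d * n"
  proof -
    have "card (\<Omega> - {v}) = card \<Omega> - 1" using v by (simp add: finite_vars_set)
    moreover have "card Z = card (\<Omega> - {v}) - card T" using T fin by (simp add: Z_def card_Diff_subset)
    moreover have "card T \<le> card (\<Omega> - {v})" using T finite_vars_set by (simp add: card_mono)
    moreover have "j \<le> card T" using I fin card_mono by blast
    moreover have "card \<Omega> > 0" using v finite_vars_set card_gt_0_iff by blast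
    ultimately show ?thesis using card_family(1)[OF F] by (simp add: \<beta>_def)
  qed
  have A: "poly_eval (F (insert k J)) ((ind T)(v := z)) = poly ?A z" if k: "k \<in> T - J" for k z
  proof (cases "k = i0")
    case False
    have "transpose k i0 ` I = insert k (I - {i0})"
      using k I False J by (intro transpose_image_insert) (auto simp: J_def)
    then have tr: "transpose k i0 ` I = insert k J" by (simp add: J_def)
    have "poly_eval (F (transpose k i0 ` I)) ((ind T)(v := z)) = poly_eval (F I) ((ind T)(v := z))"
    proof (rule swap_equal_coords[OF I'(1) I(2)])
      show "k \<in> \<Omega>" "i0 \<in> \<Omega>" using k T I I' by auto
      have "k \<noteq> v" "i0 \<noteq> v" "k \<in> T" "i0 \<in> T" using k I I' T by auto
      then show "((ind T)(v := z)) k = ((ind T)(v := z)) i0" by (simp add: ind_def)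
    qed
    then show ?thesis by (simp only: tr poly_poly_in)
  qed (use J in \<open>simp add: poly_poly_in\<close>)
  have "[:0, 1:] * pderiv ?B - (smult (\<sigma> * (of_nat (d * n) - of_nat \<beta>)) ?B +
    smult (\<sigma> * of_nat \<beta>) ?A - smult (of_nat \<beta> / of_nat j) ([:0, 1:] * pderiv ?A)) = 0"
  proof (rule poly_eq_0_iff_infinite[of "{0, 1}"])
    fix z :: rat assume z: "z \<notin> {0, 1}"
    let ?e = "\<lambda>I. poly_eval (F I) ((ind T)(v := z))"
    have e: "?e I = poly ?A z" "?e (insert v J) = poly ?B z" by (simp_all add: poly_poly_in J_def)
    have ind_Z: "ind T k = 0" if "k \<in> Z" for k using that by (simp add: Z_def ind_def)
    have ind_T: "ind T k = 1" if "k \<in> T - J" for k using that by (simp add: ind_def)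
    have "z \<notin> ind T ` (\<Omega> - {v})" using z by (auto simp: ind_def)
    then have "poly (pderiv ?B) z = \<sigma> * (\<Sum>k\<in>\<Omega> - {v}. (?e (insert v J) - ?e (transpose v k ` insert v J)) / (z - ind T k))"
      using dunkl_eq_line[OF vJ v, of z "ind T"] by (simp only: poly_poly_in J_def not_False_eq_True)
    also have "(\<Sum>k\<in>\<Omega> - {v}. (?e (insert v J) - ?e (transpose v k ` insert v J)) / (z - ind T k)) =
       (\<Sum>k\<in>Z \<union> (T - J). (?e (insert v J) - ?e (insert k J)) / (z - ind T k))"
    proof (rule sum.mono_neutral_cong_right)
      have "transpose v k ` insert v J = insert v J" if "k \<in> J" for k
        using that by (intro transpose_image_both) auto
      then show "\<forall>k\<in>\<Omega> - {v} - (Z \<union> (T - J)). (?e (insert v J) - ?e (transpose v k ` insert v J)) / (z - ind T k) = 0"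
        by (auto simp: Z_def simp del: image_insert)
      fix k assume k: "k \<in> Z \<union> (T - J)"
      have "transpose k v ` insert v J = insert k (insert v J - {v})"
        using k J T by (intro transpose_image_insert) (auto simp: Z_def)
      also have "\<dots> = insert k J" using J by auto
      finally have "transpose v k ` insert v J = insert k J" by (simp only: transpose_commute)
      then show "(?e (insert v J) - ?e (transpose v k ` insert v J)) / (z - ind T k) =
          (?e (insert v J) - ?e (insert k J)) / (z - ind T k)" by (simp only:)
    qed (use finite_vars_set T in \<open>auto simp: Z_def\<close>)
    also have "\<dots> = (\<Sum>k\<in>Z. (?e (insert v J) - ?e (insert k J)) / (z - ind T k)) +
       (\<Sum>k\<in>T - J. (?e (insert v J) - ?e (insert k J)) / (z - ind T k))"
      using fin finite_vars_set by (intro sum.union_disjoint) (auto simp: Z_def)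
    also have "(\<Sum>k\<in>Z. (?e (insert v J) - ?e (insert k J)) / (z - ind T k)) =
       (\<Sum>k\<in>Z. (poly ?B z - ?e (insert k J)) / z)"
      by (intro sum.cong refl) (simp add: e ind_Z)
    also have "\<dots> = (of_nat (card Z) * poly ?B z - (\<Sum>k\<in>Z. ?e (insert k J))) / z"
      by (simp add: sum_subtractf flip: sum_divide_distrib)
    also have "(\<Sum>k\<in>T - J. (?e (insert v J) - ?e (insert k J)) / (z - ind T k)) =
       (\<Sum>k\<in>T - J. (poly ?B z - poly ?A z) / (z - 1))"
      by (intro sum.cong refl) (simp add: e A ind_T)
    also have "\<dots> = of_nat \<beta> * (poly ?B z - poly ?A z) / (z - 1)" by (simp add: cT)
    also have "(\<Sum>k\<in>Z. ?e (insert k J)) = - poly ?B z - of_nat \<beta> * poly ?A z"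
    proof -
      have "\<Omega> - J = insert v (Z \<union> (T - J))" using v J T by (auto simp: Z_def)
      moreover have "v \<notin> Z \<union> (T - J)" "finite Z" "Z \<inter> (T - J) = {}"
        using T finite_vars_set by (auto simp: Z_def)
      ultimately have "?e (insert v J) + ((\<Sum>k\<in>Z. ?e (insert k J)) + (\<Sum>k\<in>T - J. ?e (insert k J))) = 0"
        using family_sum_insert[OF F J(1,3), of "(ind T)(v := z)"] fin
        by (simp add: sum.union_disjoint)
      moreover have "(\<Sum>k\<in>T - J. ?e (insert k J)) = of_nat \<beta> * poly ?A z"
        by (simp add: A cT)
      ultimately show ?thesis by (simp add: e algebra_simps)
    qed
    finally have B': "poly (pderiv ?B) z = \<sigma> * ((of_nat (card Z) * poly ?B z - (- poly ?B z - of_nat \<beta> * poly ?A z)) / z +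
        of_nat \<beta> * (poly ?B z - poly ?A z) / (z - 1))" .
    have "(z - 1) * poly (pderiv ?A) z = \<sigma> * of_nat j * (poly ?A z - poly ?B z)"
      using arg_cong[OF line_first_eq[OF F v T I], of "\<lambda>p. poly p z"] by (simp add: algebra_simps)
    then have A': "\<sigma> * ((poly ?B z - poly ?A z) / (z - 1)) = - poly (pderiv ?A) z / of_nat j"
      using z j by (simp add: field_simps)
    have cZ': "of_nat (card Z) + 1 = of_nat (d * n) - (of_nat \<beta> :: rat)"
      unfolding cZ[symmetric] by simp
    have "z * poly (pderiv ?B) z = \<sigma> * ((of_nat (card Z) + 1) * poly ?B z + of_nat \<beta> * poly ?A z)
       + z * of_nat \<beta> * (\<sigma> * ((poly ?B z - poly ?A z) / (z - 1)))"
      unfolding B' using z by (simp add: distrib_left) (simp add: algebra_simps)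
    also have "\<dots> = \<sigma> * (of_nat (d * n) - of_nat \<beta>) * poly ?B z + \<sigma> * of_nat \<beta> * poly ?A z
       - of_nat \<beta> / of_nat j * (z * poly (pderiv ?A) z)"
      unfolding A' cZ' by (simp add: algebra_simps)
    finally show "poly ([:0, 1:] * pderiv ?B - (smult (\<sigma> * (of_nat (d * n) - of_nat \<beta>)) ?B +
      smult (\<sigma> * of_nat \<beta>) ?A - smult (of_nat \<beta> / of_nat j) ([:0, 1:] * pderiv ?A))) z = 0"
      by simp
  qed simp
  then show ?thesis by simp
qed

text \<open>Comparing coefficients in the two line equations and eliminating those of
  \<open>?B\<close> gives the recurrence. \<open>?top\<close> is the first equation at k = m d,
  where the next coefficient vanishes and the coefficient of \<open>?B\<close> is a value of
  \<open>lead\<close>.\<close>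

lemma line_recurrence:
  assumes F: "family j \<Omega> F" and v: "v \<in> \<Omega>" and T: "T \<subseteq> \<Omega> - {v}"
    and I: "I \<subseteq> T" "card I = j" "i0 \<in> I"
    and \<beta>_def: "\<beta> = card T + 1 - j"
  shows "of_nat (Suc k) * (of_nat k - \<sigma> * (of_nat (d * n) - of_nat \<beta>)) * coeff (poly_in v (F I) (ind T)) (Suc k) =
      (\<sigma> * of_nat j - of_nat k) * (of_nat (m * d) - of_nat k) * coeff (poly_in v (F I) (ind T)) k" (is ?rec)
    and "(of_nat (m * d) - \<sigma> * of_nat j) * coeff (poly_in v (F I) (ind T)) (m * d) =
      - \<sigma> * of_nat j * poly_eval (lead v F (I - {i0})) (ind T)" (is ?top)
    and "degree (poly_in v (F I) (ind T)) \<le> m * d"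
proof -
  interpret singular_family \<sigma> \<Omega> j F using F by (simp add: family_def)
  let ?A = "poly_in v (F I) (ind T)" and ?B = "poly_in v (F (insert v (I - {i0}))) (ind T)"
  define c where "c = \<sigma> * (of_nat (d * n) - of_nat \<beta>)"
  have fI: "finite I" using I T finite_vars_set by (meson Diff_subset finite_subset)
  have j: "j > 0" using I fI by (auto simp: card_gt_0_iff)
  have deg: "degree_le v (m * d)" by (rule family_degree_le[OF F j v])
  show degA: "degree ?A \<le> m * d" using degree_poly_in_le[OF deg] I T by auto
  have first: "of_nat k * coeff ?A k - of_nat (Suc k) * coeff ?A (Suc k) = \<sigma> * of_nat j * (coeff ?A k - coeff ?B k)" for k
    using arg_cong[OF line_first_eq[OF F v T I], of "\<lambda>p. coeff p k"]
    unfolding coeff_linear_mult_pderiv[of 1] by simp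
  have "of_nat k * coeff ?B k = c * coeff ?B k +
      \<sigma> * of_nat \<beta> * coeff ?A k - of_nat \<beta> / of_nat j * (of_nat k * coeff ?A k)" for k
    using arg_cong[OF line_second_eq[OF F v T I \<beta>_def], of "\<lambda>p. coeff p k"]
    using coeff_linear_mult_pderiv[of 0 ?A k] coeff_linear_mult_pderiv[of 0 ?B k]
    by (simp add: c_def del: mult_pCons_left)
  then have B: "(of_nat k - c) * coeff ?B k =
      \<sigma> * of_nat \<beta> * coeff ?A k - of_nat \<beta> / of_nat j * (of_nat k * coeff ?A k)" for k
    by (simp add: left_diff_distrib)
  have second: "(of_nat k - c) * (\<sigma> * of_nat j * coeff ?B k) =
     \<sigma> * of_nat \<beta> * (\<sigma> * of_nat j - of_nat k) * coeff ?A k" for k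
  proof -
    have "(of_nat k - c) * (\<sigma> * of_nat j * coeff ?B k) = \<sigma> * of_nat j * ((of_nat k - c) * coeff ?B k)"
      by (simp only: mult_ac)
    also have "\<dots> = \<sigma> * of_nat \<beta> * (\<sigma> * of_nat j - of_nat k) * coeff ?A k"
      unfolding B using j by (simp add: field_simps)
    finally show ?thesis .
  qed
  have "\<sigma> * of_nat j * coeff ?B k = (\<sigma> * of_nat j - of_nat k) * coeff ?A k + of_nat (Suc k) * coeff ?A (Suc k)" for k
    using first[of k] by (simp add: algebra_simps)
  from second[unfolded this]
  have "(of_nat k - c) * ((\<sigma> * of_nat j - of_nat k) * coeff ?A k + of_nat (Suc k) * coeff ?A (Suc k)) =
     \<sigma> * of_nat \<beta> * (\<sigma> * of_nat j - of_nat k) * coeff ?A k" .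
  moreover have "\<sigma> * of_nat \<beta> + c = of_nat (m * d)"
    unfolding c_def using \<sigma>_dn by (simp add: algebra_simps)
  moreover have "S * (K - c) * b = R * (D - K) * a"
    if "(K - c) * (R * a + S * b) = X * R * a" "X + c = D" for K R a S b X D :: rat
    using that(1) unfolding that(2)[symmetric] by (simp add: algebra_simps)
  ultimately show ?rec unfolding c_def[symmetric] by blast
  have "coeff ?A (Suc (m * d)) = 0" using degA by (simp add: coeff_eq_0)
  then show ?top using first[of "m * d"] by (simp add: coeff_poly_in lead_def algebra_simps)
qed

end

section \<open>Signs\<close>

lemma pochhammer_neg:
  fixes x :: rat
  assumes "\<And>i. i < K \<Longrightarrow> x + of_nat i < 0"
  shows "(-1) ^ K * pochhammer x K > 0"
  using assms
proof (induction K)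
  case (Suc K)
  have "x + of_nat K < 0" using Suc.prems[of K] by simp
  then have "0 < - (x + of_nat K)" by simp
  moreover have "0 < (-1) ^ K * pochhammer x K" using Suc by simp
  ultimately have "0 < ((-1) ^ K * pochhammer x K) * (- (x + of_nat K))" by (intro mult_pos_pos[of "(-1) ^ K * pochhammer x K"])
  also have "((-1) ^ K * pochhammer x K) * (- (x + of_nat K)) = (-1) ^ Suc K * pochhammer x (Suc K)"
    by (simp add: pochhammer_Suc algebra_simps)
  finally show ?case .
qed simp

lemma pochhammer_sign:
  fixes x :: rat
  assumes "K \<le> M" "\<And>i. i < K \<Longrightarrow> x + of_nat i < 0" "x + of_nat K > 0"
  shows "(-1) ^ K * pochhammer x M > 0"
proof -
  have "0 < ((-1) ^ K * pochhammer x K) * pochhammer (x + of_nat K) (M - K)"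
    using assms by (intro mult_pos_pos pochhammer_neg pochhammer_pos) auto
  then show ?thesis using pochhammer_product[OF assms(1), of x] by (simp add: mult_ac)
qed

lemma poly_1_eq_sum_coeff:
  fixes p :: "rat poly"
  assumes "degree p \<le> M"
  shows "poly p 1 = (\<Sum>k\<le>M. coeff p k)"
proof -
  have "poly p 1 = (\<Sum>k\<le>degree p. coeff p k)" by (simp add: poly_altdef)
  also have "\<dots> = (\<Sum>k\<le>M. coeff p k)"
    using assms by (intro sum.mono_neutral_left) (auto simp: coeff_eq_0)
  finally show ?thesis .
qed

section \<open>Product formula for index sets with fewer than n elements\<close>

context two_row
begin

text \<open>The product of the m d numbers \<sigma> y - m d, ..., \<sigma> y - 1. It is the
  numerator \<open>pochhammer (C - B)\<close> that Chu-Vandermonde produces in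
  \<open>eval_insert_lead\<close>, with y the number of ones in the point.\<close>

definition weight :: "nat \<Rightarrow> rat" where
  "weight y = pochhammer (\<sigma> * of_nat y - of_nat (m * d)) (m * d)"

text \<open>As \<sigma> n = m, the factors of \<open>weight (t * n + l)\<close> start at m t +
  \<sigma> l - m d. Since \<sigma> l lies strictly between the integers q and q + 1, exactly m d - m
  t - q of them are negative and none is zero; comparison with t = 0 leaves (-1)^(m t).\<close>

lemma weight_sign:
  assumes l: "0 < l" "l < n" and t: "t < d"
  shows "0 < (-1) ^ (m * t) * (weight (t * n + l) / weight l)"
proof -
  define q where "q = nat \<lfloor>\<sigma> * of_nat l\<rfloor>"
  have pos: "0 < \<sigma> * of_nat l" using \<sigma>_pos l by simp
  then have q: "of_nat q \<le> \<sigma> * of_nat l" "\<sigma> * of_nat l < of_nat q + 1"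
    unfolding q_def by linarith+
  have q1: "of_nat q < \<sigma> * of_nat l" using q \<sigma>_not_int[OF l, of q] by simp
  have "\<sigma> * of_nat l < \<sigma> * of_nat n" using \<sigma>_pos l by simp
  then have "of_nat q < (of_nat m :: rat)" using q \<sigma>_n by linarith
  then have qm: "q < m" by simp
  have sgn: "(-1) ^ (m * d - m * t - q) * weight (t * n + l) > 0" if t: "t < d" for t
  proof -
    have "m * (t + 1) \<le> m * d" using t by (intro mult_le_mono2) simp
    then have K: "m * t + q < m * d" using qm by (simp add: distrib_left)
    then have K': "of_nat (m * d - m * t - q) = (of_nat (m * d) - of_nat (m * t) - of_nat q :: rat)"
      by (simp add: of_nat_diff)
    have s: "\<sigma> * of_nat (t * n + l) = of_nat (m * t) + \<sigma> * of_nat l"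
      using \<sigma>_n by (simp add: distrib_left mult.left_commute[of \<sigma>] mult.commute)
    show ?thesis unfolding weight_def
    proof (rule pochhammer_sign)
      fix i assume "i < m * d - m * t - q"
      then have "of_nat (Suc i) \<le> (of_nat (m * d - m * t - q) :: rat)" by (simp only: of_nat_le_iff Suc_le_eq)
      then show "\<sigma> * of_nat (t * n + l) - of_nat (m * d) + of_nat i < 0"
        unfolding s K' using q by (simp only: of_nat_Suc)
    next
      show "0 < \<sigma> * of_nat (t * n + l) - of_nat (m * d) + of_nat (m * d - m * t - q)"
        unfolding s K' using q1 by linarith
    qed simp
  qed
  have s0: "(-1) ^ (m * d - q) * weight l > 0" using sgn[of 0] t by simp
  then have "0 < ((-1) ^ (m * d - m * t - q) * weight (t * n + l)) / ((-1) ^ (m * d - q) * weight l)"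
    using sgn[OF t] by simp
  also have "\<dots> = ((-1) ^ (m * d - m * t - q) * (-1) ^ (m * d - q)) * (weight (t * n + l) / weight l)"
    by (cases "even (m * d - q)") auto
  also have "(-1) ^ (m * d - m * t - q) * (-1) ^ (m * d - q) = (-1 :: rat) ^ (m * t)"
  proof -
    have "m * (t + 1) \<le> m * d" using t by (intro mult_le_mono2) simp
    then have "m * t + q \<le> m * d" using qm by (simp add: distrib_left)
    then have "m * d - m * t - q + (m * d - q) = m * t + 2 * (m * d - m * t - q)" by simp
    then show ?thesis by (metis (no_types) power_add power_mult power2_minus power_one mult_1_right)
  qed
  finally show ?thesis .
qed

lemma weight_nonzero: "0 < l \<Longrightarrow> l < n \<Longrightarrow> weight l \<noteq> 0"
  using weight_sign[of l 0] d_ge_2 by auto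

lemma eval_line:
  assumes F: "family j \<Omega> F" and v: "v \<in> \<Omega>" and T: "T \<subseteq> \<Omega> - {v}"
    and I: "I \<subseteq> T" "card I = j" "i0 \<in> I"
  shows "poly_eval (F I) (ind T) = coeff (poly_in v (F I) (ind T)) 0"
    and "poly_eval (F I) (ind (insert v T)) = (\<Sum>k\<le>m * d. coeff (poly_in v (F I) (ind T)) k)"
proof -
  have "(ind T)(v := 0) = ind T" using T by (intro ind_remove) auto
  then show "poly_eval (F I) (ind T) = coeff (poly_in v (F I) (ind T)) 0"
    by (metis poly_poly_in poly_0_coeff_0)
  have "degree (poly_in v (F I) (ind T)) \<le> m * d"
    using line_recurrence(3)[OF F v T I refl] .
  then show "poly_eval (F I) (ind (insert v T)) = (\<Sum>k\<le>m * d. coeff (poly_in v (F I) (ind T)) k)"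
    by (simp add: poly_1_eq_sum_coeff[symmetric] poly_poly_in ind_insert)
qed

text \<open>The series is read backwards from k = m d, because the last coefficient is known from
  \<open>lead\<close>. The backward recurrence divides by \<sigma> j - k, which is nonzero as
  \<sigma> j is no integer for 0 < j < n.\<close>

lemma eval_insert_lead:
  assumes F: "family j \<Omega> F" and j: "0 < j" "j < n" and v: "v \<in> \<Omega>" and T: "T \<subseteq> \<Omega> - {v}"
    and I: "I \<subseteq> T" "card I = j" "i0 \<in> I"
  shows "poly_eval (F I) (ind (insert v T)) * weight j =
    poly_eval (lead v F (I - {i0})) (ind T) * weight (card T + 1)"
proof -
  define a where "a = coeff (poly_in v (F I) (ind T))"
  define \<beta> where "\<beta> = card T + 1 - j"
  define \<rho> where "\<rho> = \<sigma> * of_nat j"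
  define C where "C = \<rho> - of_nat (m * d) + 1"
  define B where "B = 1 - of_nat (m * d) + \<sigma> * (of_nat (d * n) - of_nat \<beta>)"
  have fT: "finite T" using T card_family(2)[OF F] by (meson Diff_subset finite_subset)
  have "j \<le> card T" using I fT card_mono by blast
  then have \<beta>: "of_nat \<beta> = (of_nat (card T + 1) - of_nat j :: rat)"
    unfolding \<beta>_def by (intro of_nat_diff) simp
  note rec = line_recurrence(1)[OF F v T I \<beta>_def, folded a_def \<rho>_def]
  have C: "C + of_nat i \<noteq> 0" if i: "i < m * d" for i
  proof
    assume "C + of_nat i = 0"
    then have "\<rho> = of_nat (m * d) - of_nat (Suc i)" by (simp add: C_def)
    also have "\<dots> = of_nat (m * d - Suc i)" using i by (subst of_nat_diff) auto
    finally show False using \<sigma>_not_int[OF j] by (simp add: \<rho>_def)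
  qed
  have "(\<Sum>k\<le>m * d. a (m * d - k)) = a (m * d - 0) * pochhammer (C - B) (m * d) / pochhammer C (m * d)"
  proof (rule sum_hypergeometric(1)[OF _ C])
    fix i assume i: "i < m * d"
    define k where "k = m * d - Suc i"
    have k: "Suc k = m * d - i" "of_nat k = (of_nat (m * d) - of_nat i - 1 :: rat)"
      using i by (auto simp: k_def of_nat_diff)
    have "of_nat (Suc k) = (of_nat (m * d) - of_nat i :: rat)" using k(2) by simp
    then have "(of_nat (m * d) - of_nat i) * (of_nat (m * d) - of_nat i - 1 - \<sigma> * (of_nat (d * n) - of_nat \<beta>)) * a (m * d - i) =
        (\<rho> - (of_nat (m * d) - of_nat i - 1)) * (of_nat (m * d) - (of_nat (m * d) - of_nat i - 1)) * a k"
      using rec[of k] unfolding k by simp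
    moreover have "(i' + 1) * (\<rho> - M + 1 + i') * y = (i' - M) * (1 - M + c + i') * x"
      if "(M - i') * (M - i' - 1 - c) * x = (\<rho> - (M - i' - 1)) * (M - (M - i' - 1)) * y" for i' M c x y :: rat
      using that by (simp add: algebra_simps)
    ultimately show "of_nat (Suc i) * (C + of_nat i) * a (m * d - Suc i) =
        (of_nat i - of_nat (m * d)) * (B + of_nat i) * a (m * d - i)"
      unfolding C_def B_def k_def[symmetric] by (simp only: of_nat_Suc add.commute[of 1 "of_nat i"])
  qed
  moreover have "(\<Sum>k\<le>m * d. a (m * d - k)) = (\<Sum>k\<le>m * d. a k)"
    by (rule sum.reindex_bij_witness[of _ "\<lambda>k. m * d - k" "\<lambda>k. m * d - k"]) auto
  moreover have "C - B = \<sigma> * of_nat (card T + 1) - of_nat (m * d)"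
    unfolding C_def B_def \<rho>_def \<beta> \<sigma>_dn[symmetric] by (simp add: algebra_simps)
  moreover have pC: "pochhammer C (m * d) \<noteq> 0"
    using C by (auto simp: pochhammer_eq_0_iff eq_neg_iff_add_eq_0)
  ultimately have S: "poly_eval (F I) (ind (insert v T)) * pochhammer C (m * d) = a (m * d) * weight (card T + 1)"
    using pC eval_line(2)[OF F v T I] by (auto simp: a_def weight_def field_simps)
  have top: "(\<rho> - of_nat (m * d)) * a (m * d) = \<rho> * poly_eval (lead v F (I - {i0})) (ind T)"
    using line_recurrence(2)[OF F v T I \<beta>_def] unfolding a_def[symmetric] \<rho>_def by (simp add: algebra_simps)
  \<comment> \<open>Both sides are the product of \<rho> - m d, ..., \<rho>. The factors \<rho> and
    \<rho> - m d are those of \<open>top\<close>, so they cancel.\<close>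
  have w: "weight j * \<rho> = (\<rho> - of_nat (m * d)) * pochhammer C (m * d)"
    using pochhammer_rec[of "\<rho> - of_nat (m * d)" "m * d"] pochhammer_Suc[of "\<rho> - of_nat (m * d)" "m * d"]
    by (simp add: weight_def \<rho>_def C_def)
  have "\<rho> * (poly_eval (F I) (ind (insert v T)) * weight j) = (weight j * \<rho>) * poly_eval (F I) (ind (insert v T))"
    by (simp only: mult_ac)
  also have "\<dots> = (\<rho> - of_nat (m * d)) * (poly_eval (F I) (ind (insert v T)) * pochhammer C (m * d))"
    unfolding w by (simp only: mult_ac)
  also have "\<dots> = \<rho> * (poly_eval (lead v F (I - {i0})) (ind T) * weight (card T + 1))"
    unfolding S using top by (simp only: mult.assoc[symmetric])
  finally show ?thesis using \<sigma>_pos j by (simp add: \<rho>_def)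
qed

text \<open>Induction on j. Some v in I is traded for an i0 in S - I, which keeps the value because
  both coordinates are 1. Now v lies outside the index set, so \<open>eval_insert_lead\<close>
  removes it from S and splits off the last factor of the product.\<close>

lemma eval_ind_product:
  assumes "family j \<Omega> F" "j < n" "S \<subseteq> \<Omega>" "I \<subseteq> S" "card I = j"
  shows "poly_eval (F I) (ind S) = poly_eval (F I) (ind I) * (\<Prod>l=1..j. weight (card S - j + l) / weight l)"
  using assms
proof (induction j arbitrary: \<Omega> F S I)
  case 0
  then have "I = {}" using card_family(2)[OF 0(1)] finite_subset by (metis card_0_eq)
  then show ?case using eval_family_0[OF 0(1)] by auto
next
  case (Suc j)
  interpret singular_family \<sigma> \<Omega> "Suc j" F using Suc.prems by (simp add: family_def)
  have fin: "finite S" "finite I"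
    using finite_subset[OF Suc.prems(3) finite_vars_set] finite_subset[OF Suc.prems(4)] by auto
  have I: "I \<subseteq> \<Omega>" using Suc.prems by auto
  obtain v where v: "v \<in> I" using Suc.prems by fastforce
  show ?case
  proof (cases "S = I")
    \<comment> \<open>No i0 is available for the trade, but every factor of the product is
      1.\<close>
    case True
    then have "(\<Prod>l=1..Suc j. weight (card S - Suc j + l) / weight l) = 1"
      using weight_nonzero Suc.prems by (intro prod.neutral) auto
    then show ?thesis using True by (simp only: mult_1_right)
  next
    case False
    then obtain i0 where i0: "i0 \<in> S" "i0 \<notin> I" using Suc.prems(4) by blast
    let ?T = "S - {v}" and ?J = "I - {v}" and ?I = "insert i0 (I - {v})"
    have cS: "card S = card ?T + 1" using v Suc.prems fin card_Suc_Diff1[of S v] by auto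
    have TS: "insert v ?T = S" using v Suc.prems(4) by auto
    have I': "?I \<subseteq> ?T" "card ?I = Suc j" "i0 \<in> ?I" "?I - {i0} = ?J"
      using i0 v Suc.prems fin card_Suc_Diff1[of I v] by auto
    have tr: "transpose i0 v ` I = ?I" using i0 v by (intro transpose_image_insert)
    have "i0 \<in> \<Omega>" "v \<in> \<Omega>" "ind S i0 = ind S v" using i0 v Suc.prems by (auto simp: ind_def)
    then have "poly_eval (F I) (ind S) = poly_eval (F ?I) (ind S)"
      using swap_equal_coords[OF I Suc.prems(5), of i0 v "ind S"] by (simp only: tr)
    also have "poly_eval (F ?I) (ind S) = poly_eval (lead v F ?J) (ind ?T) * weight (card S) / weight (Suc j)"
      using eval_insert_lead[OF Suc.prems(1) _ Suc.prems(2) \<open>v \<in> \<Omega>\<close> _ I'(1-3)] Suc.prems weight_nonzero[of "Suc j"]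
      unfolding I'(4) TS cS[symmetric] by (auto simp: field_simps)
    also have "poly_eval (lead v F ?J) (ind ?T) =
        poly_eval (lead v F ?J) (ind ?J) * (\<Prod>l=1..j. weight (card ?T - j + l) / weight l)"
    proof (rule Suc.IH)
      show "family j (\<Omega> - {v}) (lead v F)" using Suc.prems \<open>v \<in> \<Omega>\<close> by (intro family_lead)
    qed (use Suc.prems v fin in auto)
    also have "poly_eval (lead v F ?J) (ind ?J) = poly_eval (F I) (ind I)"
      using eval_ind_lead[OF Suc.prems(1) I Suc.prems(5) v] by simp
    also have "card ?T - j = card S - Suc j" using cS by simp
    finally have "poly_eval (F I) (ind S) = poly_eval (F I) (ind I) *
        (\<Prod>l=1..j. weight (card S - Suc j + l) / weight l) * weight (card S) / weight (Suc j)" .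
    moreover have "card S - Suc j + Suc j = card S"
      using card_mono[OF fin(1) Suc.prems(4)] Suc.prems(5) by simp
    ultimately show ?thesis by simp
  qed
qed

lemma eval_ind_swap:
  assumes F: "family j \<Omega> F" and I: "I \<subseteq> \<Omega>" "card I = j" "i \<in> I" and v: "v \<in> \<Omega>" "v \<notin> I"
  shows "poly_eval (F (insert v (I - {i}))) (ind (insert v (I - {i}))) = poly_eval (F I) (ind I)"
proof -
  interpret singular_family \<sigma> \<Omega> j F using F by (simp add: family_def)
  have tr: "transpose v i ` I = insert v (I - {i})" using I v by (intro transpose_image_insert)
  have "ind (insert v (I - {i})) \<circ> transpose v i = ind I"
    using I v by (auto simp: ind_def transpose_def)
  then show ?thesis
    using swap_eq[OF I(1,2) v(1), of i "ind (insert v (I - {i}))"] I by (auto simp: tr)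
qed

text \<open>Any two index sets of the same size are linked by exchanges of single elements. The
  common value is the reference for the signs of different index sets in
  \<open>no_family\<close>.\<close>

lemma eval_ind_independent:
  assumes F: "family j \<Omega> F" and "I \<subseteq> \<Omega>" "card I = j" "I' \<subseteq> \<Omega>" "card I' = j"
  shows "poly_eval (F I) (ind I) = poly_eval (F I') (ind I')"
  using assms(2,3)
proof (induction "card (I - I')" arbitrary: I rule: less_induct)
  case less
  have fin: "finite I" "finite I'" using less(2) assms(4) card_family(2)[OF F] finite_subset by blast+
  show ?case
  proof (cases "I = I'")
    case False
    have "\<not> I \<subseteq> I'" using card_subset_eq[of I' I] fin False less assms(5) by auto
    then obtain i where i: "i \<in> I" "i \<notin> I'" by auto
    have "\<not> I' \<subseteq> I" using card_subset_eq[of I I'] fin False less assms(5) by auto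
    then obtain v where v: "v \<in> I'" "v \<notin> I" by auto
    let ?K = "insert v (I - {i})"
    have "poly_eval (F ?K) (ind ?K) = poly_eval (F I') (ind I')"
    proof (rule less.hyps)
      have "?K - I' \<subset> I - I'" using i v by auto
      then show "card (?K - I') < card (I - I')" using fin by (intro psubset_card_mono) auto
      show "?K \<subseteq> \<Omega>" using v less(2) assms(4) by auto
      show "card ?K = j" using i v fin less(3) card_Suc_Diff1[of I i] by auto
    qed
    then show ?thesis using eval_ind_swap[OF F less(2,3) i(1), of v] v assms(4) by auto
  qed simp
qed


section \<open>Signs of the values for index sets with n elements\<close>

lemma sign_product_pos:
  fixes a b c :: rat
  assumes "0 < s * a * c" "0 < u * b" "x = a * b"
  shows "0 < (s * u) * x * c"
  using mult_pos_pos[OF assms(1,2)] assms(3) by (simp add: mult_ac)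

text \<open>Adding v to T must multiply the sign by (-1)^m. The old value is \<open>a 0\<close>, the
  new one the sum of all \<open>a k\<close>; this sum consists of a piece starting at k = 0 and
  possibly a second one, and each is shown to have the required sign.\<close>

lemma eval_insert_sign:
  assumes F: "family n \<Omega> F" and v: "v \<in> \<Omega>" and T: "T \<subseteq> \<Omega> - {v}"
    and I: "I \<subseteq> T" "card I = n" and cT: "card T + 1 < d * n"
    and IH: "0 < (-1) ^ (m * (card T - n)) * poly_eval (F I) (ind T) * poly_eval (F I) (ind I)"
  shows "0 < (-1) ^ (m * (card T + 1 - n)) * poly_eval (F I) (ind (insert v T)) * poly_eval (F I) (ind I)"
proof -
  interpret singular_family \<sigma> \<Omega> n F using F by (simp add: family_def)
  have fin: "finite T" "finite I" using I T finite_vars_set by (meson Diff_subset finite_subset)+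
  obtain i0 where i0: "i0 \<in> I" using I n_ge_2 by fastforce
  have nT: "n \<le> card T" using I fin card_mono by blast
  define \<beta> where "\<beta> = card T + 1 - n"
  define \<kappa> where "\<kappa> = \<sigma> * (of_nat (d * n) - of_nat \<beta>)"
  define a where "a = coeff (poly_in v (F I) (ind T))"
  define G where "G = poly_eval (F I) (ind I)"
  have \<beta>: "0 < \<beta>" "\<beta> + n < d * n" using nT cT by (auto simp: \<beta>_def)
  have \<kappa>: "\<kappa> = of_nat (m * d) - \<sigma> * of_nat \<beta>"
    unfolding \<kappa>_def \<sigma>_dn[symmetric] by (simp add: algebra_simps)
  have \<kappa>_less: "\<kappa> < of_nat (m * d)" using \<kappa> \<sigma>_pos \<beta> by simp
  \<comment> \<open>\<open>cT\<close> says \<beta> + n < d n. This keeps \<kappa> above m, so no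
    denominator vanishes before the recurrence stops at k = m.\<close>
  have \<kappa>_greater: "of_nat m < \<kappa>"
  proof -
    have "\<sigma> * of_nat (\<beta> + n) < \<sigma> * of_nat (d * n)" using \<sigma>_pos \<beta> by (simp only: mult_less_cancel_left_pos of_nat_less_iff)
    moreover have "\<sigma> * of_nat (\<beta> + n) = \<sigma> * of_nat \<beta> + of_nat m" by (simp add: distrib_left \<sigma>_n)
    ultimately show ?thesis unfolding \<kappa> \<sigma>_dn[symmetric] by linarith
  qed
  have rec: "of_nat (Suc k) * (of_nat k - \<kappa>) * a (Suc k) = (of_nat m - of_nat k) * (of_nat (m * d) - of_nat k) * a k" for k
    using line_recurrence(1)[OF F v T I(1,2) i0 \<beta>_def, folded a_def \<kappa>_def] unfolding \<sigma>_n .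
  have total: "poly_eval (F I) (ind (insert v T)) = (\<Sum>k\<le>m * d. a k)"
    using eval_line(2)[OF F v T I i0] by (simp add: a_def)
  have md: "m < m * d" using m_pos d_ge_2 by simp
  have negC: "- \<kappa> + of_nat i < 0" if "i < m" for i
  proof -
    have "of_nat i < (of_nat m :: rat)" using that by simp
    then show ?thesis using \<kappa>_greater by linarith
  qed
  \<comment> \<open>The factor m - k, which is \<sigma> n - k, plays the part of the terminating
    parameter, and m d that of \<open>B\<close>.\<close>
  have "(\<Sum>k\<le>m. a k) = a 0 * pochhammer (- \<kappa> - - of_nat (m * d)) m / pochhammer (- \<kappa>) m"
  proof (rule sum_hypergeometric(1))
    show "of_nat (Suc k) * (- \<kappa> + of_nat k) * a (Suc k) = (of_nat k - of_nat m) * (- of_nat (m * d) + of_nat k) * a k" for k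
      using rec[of k] by (simp add: algebra_simps)
    show "- \<kappa> + of_nat i \<noteq> 0" if "i < m" for i using negC[OF that] by simp
  qed
  moreover have "a 0 = poly_eval (F I) (ind T)" using eval_line(1)[OF F v T I i0] by (simp add: a_def)
  ultimately have S1: "(\<Sum>k\<le>m. a k) = poly_eval (F I) (ind T) * (pochhammer (\<sigma> * of_nat \<beta>) m / pochhammer (- \<kappa>) m)"
    by (simp add: \<kappa>)
  have "0 < (-1) ^ m * (pochhammer (\<sigma> * of_nat \<beta>) m / pochhammer (- \<kappa>) m)"
  proof -
    have "0 < pochhammer (\<sigma> * of_nat \<beta>) m" using \<sigma>_pos \<beta> by (intro pochhammer_pos) simp
    moreover have "0 < (-1) ^ m * pochhammer (- \<kappa>) m" using negC by (rule pochhammer_neg)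
    ultimately have "0 < pochhammer (\<sigma> * of_nat \<beta>) m / ((-1) ^ m * pochhammer (- \<kappa>) m)" by simp
    also have "\<dots> = (-1) ^ m * (pochhammer (\<sigma> * of_nat \<beta>) m / pochhammer (- \<kappa>) m)"
      by (cases "even m") auto
    finally show ?thesis .
  qed
  from sign_product_pos[OF IH this S1]
  have "0 < ((-1) ^ (m * (card T - n)) * (-1) ^ m) * (\<Sum>k\<le>m. a k) * G" by (simp only: G_def)
  moreover have "m * \<beta> = m * (card T - n) + m" using nT by (simp add: \<beta>_def Suc_diff_le)
  then have "(-1) ^ (m * (card T - n)) * (-1) ^ m = (-1 :: rat) ^ (m * \<beta>)" by (simp add: power_add)
  ultimately have pos1: "0 < (-1) ^ (m * \<beta>) * (\<Sum>k\<le>m. a k) * G" by (simp only:)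
  have a_m: "a (Suc m) = 0" using rec[of m] \<kappa>_greater by simp
  have a_zero: "a k = 0" if "m < k" "\<And>i. i < k \<Longrightarrow> of_nat i \<noteq> \<kappa>" for k
    using that
  proof (induction k)
    case (Suc k)
    show ?case
    proof (cases "k = m")
      case False
      then have "a k = 0" using Suc by auto
      moreover have "of_nat k - \<kappa> \<noteq> 0" using Suc.prems(2)[of k] by simp
      ultimately show ?thesis using rec[of k] by (simp del: of_nat_Suc)
    qed (simp add: a_m)
  qed simp
  show ?thesis
  proof (cases "\<exists>k. of_nat k = \<kappa>")
    case False
    have "(\<Sum>k\<le>m * d. a k) = (\<Sum>k\<le>m. a k)"
    proof (rule sum.mono_neutral_right)
      show "\<forall>k\<in>{..m * d} - {..m}. a k = 0" using a_zero False by auto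
    qed (use md in auto)
    then show ?thesis using pos1 by (simp add: total G_def \<beta>_def)
  next
    case True
    \<comment> \<open>The recurrence breaks off after \<open>k = m\<close> but restarts freely at \<open>k = q + 1\<close>; the size of this
      second hypergeometric piece is read off the leading coefficient.\<close>
    then obtain q where q: "of_nat q = \<kappa>" by auto
    have q_bounds: "m < q" "q < m * d"
      using \<kappa>_greater \<kappa>_less unfolding q[symmetric] by (simp_all only: of_nat_less_iff)
    \<comment> \<open>Integrality of \<kappa> forces n to divide \<beta>, by coprimality. Then
      \<beta> = t n and q = m d - m t with 0 < t < d, the range needed for
      \<open>weight_sign\<close>.\<close>
    have "\<sigma> * of_nat \<beta> = of_nat (m * d - q)"
      using q \<kappa> q_bounds by (simp add: of_nat_diff)
    then have m\<beta>: "m * \<beta> = n * (m * d - q)" by (simp add: \<sigma>_eq_of_nat_iff)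
    then have "n dvd m * \<beta>" by simp
    then have "n dvd \<beta>" using coprime by (simp add: coprime_commute coprime_dvd_mult_right_iff)
    then obtain t where t: "\<beta> = t * n" by (metis dvdE mult.commute)
    have "m * t = m * d - q" using m\<beta> n_ge_2 unfolding t by simp
    then have qt: "q + m * t = m * d" using q_bounds by simp
    have t_pos: "t > 0" using \<beta> t by (cases t) auto
    have td: "t < d" using \<beta>(2) unfolding t by (metis add_lessD1 mult_less_cancel2)
    \<comment> \<open>The second piece runs from k = q + 1 to k = m d, so it has m t terms.\<close>
    define M where "M = m * t - 1"
    have M: "Suc M = m * t" "q + 1 + M = m * d"
    proof -
      have "m * t > 0" using t_pos m_pos by simp
      then show "Suc M = m * t" "q + 1 + M = m * d" unfolding M_def using qt by linarith+
    qed
    define p where "p = (\<lambda>i. a (q + 1 + i))"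
    \<comment> \<open>At k = q + 1 + i the factor k - \<kappa> becomes i + 1, the factor that builds
      the factorial. So the shifted sequence is again hypergeometric, with C = q + 2 and B = q + 1 -
      m.\<close>
    have prec: "of_nat (Suc i) * (of_nat (q + 2) + of_nat i) * p (Suc i) =
        (of_nat i - of_nat M) * (of_nat (q + 1 - m) + of_nat i) * p i" for i
    proof -
      have 1: "of_nat (q + 1 - m) = (of_nat q + 1 - of_nat m :: rat)" using q_bounds by (subst of_nat_diff) auto
      have 2: "of_nat (m * d) = (of_nat q + 1 + of_nat M :: rat)" unfolding M(2)[symmetric] by simp
      have 3: "of_nat (Suc (q + 1 + i)) = (of_nat q + 2 + of_nat i :: rat)"
        "of_nat (q + 1 + i) = (of_nat q + 1 + of_nat i :: rat)" "of_nat (q + 2) = (of_nat q + 2 :: rat)"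
        "of_nat (Suc i) = (of_nat i + 1 :: rat)" by simp_all
      have "(i' + 1) * (Q + 2 + i') * y = (i' - M') * (Q + 1 - m' + i') * x"
        if "(Q + 2 + i') * (Q + 1 + i' - Q) * y = (m' - (Q + 1 + i')) * (Q + 1 + M' - (Q + 1 + i')) * x"
        for i' Q y x M' m' :: rat
        using that by (simp add: algebra_simps)
      from this[OF rec[of "q + 1 + i", unfolded 2 3 q[symmetric]]]
      show ?thesis unfolding 1 3 p_def add_Suc_right .
    qed
    have C: "of_nat (q + 2) + of_nat i \<noteq> (0 :: rat)" for i
      by (metis add_2_eq_Suc' of_nat_add of_nat_neq_0 add_Suc)
    define G' where "G' = poly_eval (lead v F (I - {i0})) (ind T)"
    have S2: "(\<Sum>i\<le>M. p i) = p 0 * pochhammer (of_nat (q + 2) - of_nat (q + 1 - m)) M / pochhammer (of_nat (q + 2)) M"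
      by (rule sum_hypergeometric(1)[OF prec C])
    have pM: "p M = p 0 * pochhammer (of_nat (q + 1 - m)) M * (-1) ^ M / pochhammer (of_nat (q + 2)) M"
      by (rule sum_hypergeometric(2)[OF prec C])
    have p1: "0 < pochhammer (of_nat (q + 2) - of_nat (q + 1 - m) :: rat) M"
      using q_bounds by (intro pochhammer_pos) (simp flip: of_nat_diff)
    have p2: "0 < pochhammer (of_nat (q + 2) :: rat) M" by (intro pochhammer_pos) (simp only: of_nat_0_less_iff)
    have p3: "0 < pochhammer (of_nat (q + 1 - m) :: rat) M"
      using q_bounds by (intro pochhammer_pos) (simp only: of_nat_0_less_iff)
    have top: "(of_nat (m * d) - of_nat m) * p M = - of_nat m * G'"
      using line_recurrence(2)[OF F v T I i0 \<beta>_def] unfolding a_def[symmetric] p_def M(2) G'_def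
      by (simp add: \<sigma>_n)
    \<comment> \<open>\<open>G'\<close> is a value of a family with j = n - 1, so the product
      formula applies. As card T - (n - 1) = t n, each of its n - 1 factors has sign (-1)^(m
      t).\<close>
    have G'_sign: "0 < (-1) ^ (m * t * (n - 1)) * G' * G"
    proof -
      let ?J = "I - {i0}" and ?I = "insert v (I - {i0})"
      have vI: "v \<notin> I" "I \<subseteq> \<Omega>" using T I by auto
      have F': "family (n - 1) (\<Omega> - {v}) (lead v F)"
        using F v n_ge_2 by (intro family_lead) auto
      have cJ: "card ?J = n - 1" using I i0 by simp
      have "G' = poly_eval (lead v F ?J) (ind ?J) * (\<Prod>l=1..n - 1. weight (card T - (n - 1) + l) / weight l)"
        unfolding G'_def using n_ge_2 T I cJ by (intro eval_ind_product[OF F']) auto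
      also have "card T - (n - 1) = t * n" using nT n_ge_2 t by (simp add: \<beta>_def)
      also have "poly_eval (lead v F ?J) (ind ?J) = G"
      proof -
        have "card ?I = Suc (n - 1)" using cJ vI fin by simp
        then have "poly_eval (F ?I) (ind ?I) = poly_eval (lead v F (?I - {v})) (ind (?I - {v}))"
          using v vI F n_ge_2 by (intro eval_ind_lead[of "n - 1"]) auto
        moreover have "?I - {v} = ?J" using vI by auto
        moreover have "poly_eval (F ?I) (ind ?I) = G"
          unfolding G_def using vI by (intro eval_ind_swap[OF F _ I(2) i0 v]) auto
        ultimately show ?thesis by simp
      qed
      finally have "(-1) ^ (m * t * (n - 1)) * G' * G =
          ((-1) ^ (m * t * (n - 1)) * (\<Prod>l=1..n - 1. weight (t * n + l) / weight l)) * (G * G)"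
        by (simp add: mult_ac)
      also have "(-1) ^ (m * t * (n - 1)) * (\<Prod>l=1..n - 1. weight (t * n + l) / weight l) =
          (\<Prod>l=1..n - 1. (-1) ^ (m * t) * (weight (t * n + l) / weight l))"
        unfolding prod.distrib by (simp add: power_mult)
      also have "\<dots> * (G * G) > 0"
      proof (rule mult_pos_pos)
        show "0 < (\<Prod>l=1..n - 1. (-1) ^ (m * t) * (weight (t * n + l) / weight l))"
          using weight_sign td n_ge_2 by (intro prod_pos) auto
        have "G \<noteq> 0" unfolding G_def using vI I by (intro eval_ind_nonzero[OF F]) auto
        then show "0 < G * G" by (metis zero_less_mult_iff linorder_neq_iff)
      qed
      finally show ?thesis .
    qed
    have tail: "(\<Sum>k\<le>m * d. a k) = (\<Sum>k\<le>m. a k) + (\<Sum>i\<le>M. p i)"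
    proof -
      have "(\<Sum>k\<le>m * d. a k) = (\<Sum>k\<in>{..m} \<union> {q + 1..m * d}. a k)"
      proof (rule sum.mono_neutral_right)
        have "a k = 0" if "m < k" "k \<le> q" for k
        proof (rule a_zero[OF that(1)])
          fix i assume "i < k"
          then show "of_nat i \<noteq> \<kappa>" using that(2) unfolding q[symmetric] by simp
        qed
        note zero = this
        show "\<forall>k\<in>{..m * d} - ({..m} \<union> {q + 1..m * d}). a k = 0"
        proof
          fix k assume "k \<in> {..m * d} - ({..m} \<union> {q + 1..m * d})"
          then have "m < k" "k \<le> q" by auto
          then show "a k = 0" by (rule zero)
        qed
      qed (use md in auto)
      also have "\<dots> = (\<Sum>k\<le>m. a k) + (\<Sum>k\<in>{q + 1..m * d}. a k)"
        using q_bounds by (intro sum.union_disjoint) auto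
      also have "(\<Sum>k\<in>{q + 1..m * d}. a k) = (\<Sum>i\<le>M. p i)"
        unfolding p_def
        by (rule sum.reindex_bij_witness[of _ "\<lambda>i. q + 1 + i" "\<lambda>k. k - (q + 1)"]) (use M in auto)
      finally show ?thesis .
    qed
    \<comment> \<open>The free start \<open>p 0\<close> is eliminated between \<open>S2\<close> and
      \<open>pM\<close> in favour of \<open>p M\<close>, which \<open>top\<close> expresses through
      \<open>G'\<close>. This gives the sign (-1)^(M + 1) = (-1)^(m t) times (-1)^(m t (n - 1)),
      that is (-1)^(m \<beta>), the same as for the first piece.\<close>
    have "0 < (-1) ^ (m * \<beta>) * (\<Sum>i\<le>M. p i) * G"
    proof -
      define r where "r = pochhammer (of_nat (q + 2) - of_nat (q + 1 - m) :: rat) M / pochhammer (of_nat (q + 1 - m)) M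
        * (of_nat m / (of_nat (m * d) - of_nat m))"
      have den: "0 < of_nat (m * d) - (of_nat m :: rat)" using md by (simp only: diff_gt_0_iff_gt of_nat_less_iff)
      have r: "r > 0" unfolding r_def using p1 p3 den m_pos by simp
      have "(\<Sum>i\<le>M. p i) = (-1) ^ M * p M * (pochhammer (of_nat (q + 2) - of_nat (q + 1 - m)) M / pochhammer (of_nat (q + 1 - m)) M)"
        unfolding S2 pM using p2 p3 by (cases "even M") auto
      also have "p M = - G' * (of_nat m / (of_nat (m * d) - of_nat m))"
      proof -
        have "y = - g * (u / w)" if "w * y = - u * g" "0 < w" for y g u w :: rat
          using that by (simp add: field_simps)
        from this[OF top den] show ?thesis .
      qed
      finally have "(\<Sum>i\<le>M. p i) = (-1) ^ Suc M * G' * r" by (simp add: r_def mult_ac)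
      then have "(-1) ^ (m * \<beta>) * (\<Sum>i\<le>M. p i) * G = ((-1) ^ (m * \<beta>) * (-1) ^ (m * t)) * G' * G * r"
        unfolding M(1) by (simp only: mult_ac)
      also have "(-1) ^ (m * \<beta>) * (-1) ^ (m * t) = (-1 :: rat) ^ (m * t * (n - 1))"
      proof -
        have "m * \<beta> = m * t * (n - 1) + m * t" using n_ge_2 unfolding t by (cases n) (auto simp: algebra_simps)
        then show ?thesis by (cases "even (m * t)") (auto simp: power_add)
      qed
      finally show ?thesis using mult_pos_pos[OF G'_sign r] by (simp only:)
    qed
    from add_pos_pos[OF pos1 this] have "0 < (-1) ^ (m * \<beta>) * (\<Sum>k\<le>m * d. a k) * G"
      unfolding tail by (simp only: distrib_left distrib_right)
    then show ?thesis by (simp add: total G_def \<beta>_def)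
  qed
qed

text \<open>At T = I the product is a nonzero square; the elements of T - I are then added one by
  one with \<open>eval_insert_sign\<close>.\<close>

lemma eval_ind_sign:
  assumes F: "family n \<Omega> F" and I: "I \<subseteq> \<Omega>" "card I = n"
    and T: "I \<subseteq> T" "T \<subseteq> \<Omega>" "card T < d * n"
  shows "0 < (-1) ^ (m * (card T - n)) * poly_eval (F I) (ind T) * poly_eval (F I) (ind I)"
proof -
  have fin: "finite \<Omega>" using card_family(2)[OF F] .
  then have "finite (T - I)" using T finite_subset by blast
  then have "\<And>T. finite D \<Longrightarrow> D = T - I \<Longrightarrow> I \<subseteq> T \<Longrightarrow> T \<subseteq> \<Omega> \<Longrightarrow> card T < d * n \<Longrightarrow>
      0 < (-1) ^ (m * (card T - n)) * poly_eval (F I) (ind T) * poly_eval (F I) (ind I)" for D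
  proof -
    fix T assume "finite D" "D = T - I" "I \<subseteq> T" "T \<subseteq> \<Omega>" "card T < d * n"
    then show "0 < (-1) ^ (m * (card T - n)) * poly_eval (F I) (ind T) * poly_eval (F I) (ind I)"
    proof (induction D arbitrary: T)
      case empty
      then have "T = I" by auto
      have "0 < poly_eval (F I) (ind I) * poly_eval (F I) (ind I)"
        using eval_ind_nonzero[OF F I] by (metis zero_less_mult_iff linorder_neq_iff)
      then show ?case using I \<open>T = I\<close> by simp
    next
      case (insert v D)
      let ?T = "T - {v}"
      have v: "v \<in> T" "v \<notin> I" using insert.prems by auto
      have fT: "finite T" using insert.prems fin finite_subset by blast
      have cT: "card T = card ?T + 1" using v fT card_Suc_Diff1[of T v] by simp
      have ins: "insert v ?T = T" using v by auto
      have D: "D = ?T - I" using insert.prems(1) insert.hyps(2) by auto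
      have sub: "I \<subseteq> ?T" "?T \<subseteq> \<Omega>" "?T \<subseteq> \<Omega> - {v}" "v \<in> \<Omega>" using insert.prems v by auto
      have less: "card ?T < d * n" "card ?T + 1 < d * n" using insert.prems(4) cT by linarith+
      have "0 < (-1) ^ (m * (card ?T - n)) * poly_eval (F I) (ind ?T) * poly_eval (F I) (ind I)"
        by (rule insert.IH[OF D sub(1,2) less(1)])
      then have "0 < (-1) ^ (m * (card ?T + 1 - n)) * poly_eval (F I) (ind (insert v ?T)) * poly_eval (F I) (ind I)"
        by (rule eval_insert_sign[OF F sub(4,3,1) I(2) less(2)])
      then show ?case unfolding ins cT .
    qed
  qed
  then show ?thesis using T \<open>finite (T - I)\<close> by blast
qed

section \<open>The parity contradiction\<close>

lemma no_family: "\<not> family n \<Omega> F"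
proof
  assume F: "family n \<Omega> F"
  interpret singular_family \<sigma> \<Omega> n F using F by (simp add: family_def)
  have card: "card \<Omega> = d * n - 1 + n" using F by (simp add: family_def)
  then obtain I where I: "I \<subseteq> \<Omega>" "card I = n"
    using obtain_subset_with_card_n[of n \<Omega>] by auto
  let ?T = "\<Omega> - I"
  define G where "G = poly_eval (F I) (ind I)"
  define s :: rat where "s = (-1) ^ (m * (d * n - 1 - n))"
  have fI: "finite I" using I finite_vars_set finite_subset by blast
  have dn: "2 * n \<le> d * n" using d_ge_2 by simp
  \<comment> \<open>The complement of I lies just below the bound d n in
    \<open>eval_ind_sign\<close>. It has at least n elements since d and n are at least 2, so some
    index set is disjoint from I and the sum below is not empty.\<close>
  have cT: "card ?T = d * n - 1" "n \<le> d * n - 1" "card ?T < d * n"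
  proof -
    show "card ?T = d * n - 1" using I fI card by (simp add: card_Diff_subset)
    with dn n_ge_2 show "n \<le> d * n - 1" "card ?T < d * n" by linarith+
  qed
  let ?U = "{I'. I' \<subseteq> \<Omega> \<and> card I' = n \<and> I' \<inter> I = {}}"
  have pos: "0 < s * poly_eval (F I') (ind ?T) * G" if "I' \<in> ?U" for I'
  proof -
    have I': "I' \<subseteq> \<Omega>" "card I' = n" "I' \<subseteq> ?T" using that by auto
    have "poly_eval (F I') (ind I') = G" unfolding G_def by (rule eval_ind_independent[OF F I'(1,2) I])
    then show ?thesis using eval_ind_sign[OF F I'(1,2,3) Diff_subset cT(3)] by (simp add: s_def cT(1))
  qed
  obtain I' where "I' \<subseteq> ?T" "card I' = n"
    using obtain_subset_with_card_n[of n ?T] cT by auto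
  then have "?U \<noteq> {}" by blast
  moreover have "finite ?U" using finite_vars_set by simp
  ultimately have "0 < (\<Sum>I'\<in>?U. s * poly_eval (F I') (ind ?T) * G)" using pos by (intro sum_pos) auto
  also have "\<dots> = s * (\<Sum>I'\<in>?U. poly_eval (F I') (ind ?T)) * G"
    by (simp add: sum_distrib_left sum_distrib_right)
  also have "(\<Sum>I'\<in>?U. poly_eval (F I') (ind ?T)) = (-1) ^ n * ((-1) ^ (m * d * n) * G)"
    unfolding G_def using sum_disjoint_eval[OF I, of "ind ?T"] eval_ind_compl[OF F I] by simp
  also have "s * ((-1) ^ n * ((-1) ^ (m * d * n) * G)) * G = (s * (-1) ^ n * (-1) ^ (m * d * n)) * (G * G)"
    by (simp only: mult_ac)
  also have "s * (-1) ^ n * (-1) ^ (m * d * n) = -1"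
  proof -
    \<comment> \<open>Modulo 2 this is m (n + 1) + n = m n + m + n, which is even only if m and n
      both are.\<close>
    have "odd (m * (d * n - 1 - n) + n + m * d * n)"
    proof -
      have "m * (d * n - 1 - n) + m * (n + 1) = m * d * n"
      proof -
        have "d * n - 1 - n + (n + 1) = d * n" using cT(2) n_ge_2 by simp
        then have "m * (d * n - 1 - n + (n + 1)) = m * (d * n)" by (rule arg_cong)
        then show ?thesis by (simp only: distrib_left mult.assoc)
      qed
      then have "even (m * (d * n - 1 - n) + m * d * n) \<longleftrightarrow> even (m * (n + 1))"
        by (metis even_add)
      moreover have "odd m \<or> odd n" using coprime by (meson coprime_common_divisor_nat odd_one even_numeral coprime_def)
      ultimately show ?thesis by auto
    qed
    then show ?thesis by (simp add: s_def flip: power_add)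
  qed
  finally have "G * G < 0" by simp
  then show False using mult_less_0_iff by auto
qed

end

section \<open>Singular modules\<close>

lemma module_qscale: "module (qscale :: rat \<Rightarrow> ('a \<Rightarrow>\<^sub>0 rat) \<Rightarrow> _)"
  using qscale_vector_space by (simp add: module_iff_vector_space)

lemma subspace_qscale_iff:
  "module.subspace qscale (S :: ('a \<Rightarrow>\<^sub>0 rat) set) \<longleftrightarrow>
    0 \<in> S \<and> (\<forall>x\<in>S. \<forall>y\<in>S. x + y \<in> S) \<and> (\<forall>c. \<forall>x\<in>S. qscale c x \<in> S)"
  by (rule module.subspace_def[OF module_qscale])

lemma perm_act_0 [simp]: "perm_act w 0 = 0"
  by (simp add: perm_act_def lin_ext_def)

lemma perm_act_sum: "perm_act w (\<Sum>i\<in>S. f i) = (\<Sum>i\<in>S. perm_act w (f i))"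
  by (induction S rule: infinite_finite_induct) (simp_all add: perm_act_add)

lemma perm_act_diff:
  assumes "bij w"
  shows "perm_act w (p - q) = perm_act w p - perm_act w q"
  using assms by (intro poly_eval_eqI) (simp add: poly_eval_perm_act poly_eval_diff)

lemma perm_act_qscale:
  assumes "bij w"
  shows "perm_act w (qscale c p) = qscale c (perm_act w p)"
  using assms by (intro poly_eval_eqI) (simp add: poly_eval_perm_act poly_eval_qscale)

lemma partial_deriv_qscale: "partial_deriv i (qscale c p) = qscale c (partial_deriv i p)"
  by (auto intro!: poly_mapping_eqI simp: partial_deriv_lookup algebra_simps)

lemma partial_deriv_perm_act:
  assumes "bij w"
  shows "partial_deriv (w i) (perm_act w p) = perm_act w (partial_deriv i p)"
proof (induction p rule: poly_mapping_single_induct)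
  case zero
  then show ?case by simp
next
  case (add a c p)
  have "Poly_Mapping.map_key (inv w) a - Poly_Mapping.single (w i) 1 =
      Poly_Mapping.map_key (inv w) (a - Poly_Mapping.single i 1)"
    using assms by (auto intro!: poly_mapping_eqI
        simp: lookup_map_key_inv lookup_minus lookup_single when_def bij_inv_eq_iff inv_f_f bij_is_inj)
  then have "partial_deriv (w i) (perm_act w (Poly_Mapping.single a c)) =
      perm_act w (partial_deriv i (Poly_Mapping.single a c))"
    using assms by (simp add: perm_act_def partial_deriv_single lookup_map_key_inv inv_f_f bij_is_inj)
  then show ?case using add by (simp add: perm_act_add partial_deriv_add)
qed

lemma div_diff_mult:
  assumes "i \<noteq> j"
  shows "div_diff i j f * (X i - X j) = f - perm_act (transpose i j) f"
  using div_diff_iff[OF assms] by blast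

lemma div_diff_add: "i \<noteq> j \<Longrightarrow> div_diff i j (f + g) = div_diff i j f + div_diff i j g"
  by (simp add: div_diff_iff distrib_right div_diff_mult perm_act_add)

lemma div_diff_qscale:
  assumes "i \<noteq> j"
  shows "div_diff i j (qscale c f) = qscale c (div_diff i j f)"
proof -
  have "qscale c (div_diff i j f) * (X i - X j) = qscale c (div_diff i j f * (X i - X j))"
    by (rule poly_eval_eqI) (simp add: poly_eval_qscale poly_eval_mult)
  also have "\<dots> = qscale c f - perm_act (transpose i j) (qscale c f)"
    unfolding div_diff_mult[OF assms]
    by (rule poly_eval_eqI) (simp add: poly_eval_qscale poly_eval_diff perm_act_qscale algebra_simps)
  finally show ?thesis using assms by (simp add: div_diff_iff)
qed

text \<open>By uniqueness of the quotient it suffices to multiply by the difference of variables; w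
  conjugates the transposition of i and j to that of w i and w j.\<close>

lemma div_diff_perm_act:
  assumes "bij w" "i \<noteq> j"
  shows "div_diff (w i) (w j) (perm_act w f) = perm_act w (div_diff i j f)"
proof -
  have ne: "w i \<noteq> w j" using assms by (simp add: bij_is_inj inj_eq)
  have "perm_act w (div_diff i j f) * (X (w i) - X (w j)) = perm_act w (div_diff i j f * (X i - X j))"
    using assms(1) by (simp add: perm_act_mult perm_act_diff perm_act_X)
  also have "\<dots> = perm_act w f - perm_act w (perm_act (transpose i j) f)"
    using assms by (simp add: div_diff_mult perm_act_diff)
  also have "perm_act w (perm_act (transpose i j) f) = perm_act (transpose (w i) (w j)) (perm_act w f)"
  proof (rule poly_eval_eqI)
    fix x :: "nat \<Rightarrow> rat"
    have "transpose (w i) (w j) (w k) = w (transpose i j k)" for k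
      using assms(1) by (auto simp: transpose_def bij_is_inj inj_eq)
    then show "poly_eval (perm_act w (perm_act (transpose i j) f)) x =
        poly_eval (perm_act (transpose (w i) (w j)) (perm_act w f)) x"
      using assms(1) by (simp add: poly_eval_perm_act)
  qed
  finally show ?thesis using ne by (simp add: div_diff_iff)
qed

lemma dunkl_add: "dunkl N \<kappa> i (f + g) = dunkl N \<kappa> i f + dunkl N \<kappa> i g"
  by (rule poly_eval_eqI)
    (simp add: dunkl_def partial_deriv_add div_diff_add poly_eval_add poly_eval_qscale poly_eval_sum
      sum.distrib algebra_simps)

lemma dunkl_qscale: "dunkl N \<kappa> i (qscale c f) = qscale c (dunkl N \<kappa> i f)"
  by (rule poly_eval_eqI)
    (simp add: dunkl_def partial_deriv_qscale div_diff_qscale poly_eval_add poly_eval_qscale poly_eval_sum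
      algebra_simps flip: sum_distrib_left)

lemma dunkl_perm_act:
  assumes w: "w permutes {1..N}" and i: "i \<in> {1..N}"
  shows "dunkl N \<kappa> (w i) (perm_act w f) = perm_act w (dunkl N \<kappa> i f)"
proof -
  have bij: "bij w" using w by (rule permutes_bij)
  have "(\<Sum>j\<in>{1..N} - {w i}. div_diff (w i) j (perm_act w f)) =
      (\<Sum>j\<in>{1..N} - {i}. div_diff (w i) (w j) (perm_act w f))"
    using w bij
    by (intro sum.reindex_bij_witness[of _ w "inv w"])
      (auto simp: permutes_inverses permutes_in_image permutes_inv bij_is_inj inj_eq bij_inv_eq_iff
        simp del: atLeastAtMost_iff intro: permutes_in_image[THEN iffD2])
  also have "\<dots> = (\<Sum>j\<in>{1..N} - {i}. perm_act w (div_diff i j f))"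
    using bij by (intro sum.cong) (auto simp: div_diff_perm_act)
  finally show ?thesis
    using bij by (simp add: dunkl_def partial_deriv_perm_act perm_act_add perm_act_qscale perm_act_sum)
qed

text \<open>The elements of V killed by all Dunkl operators form a submodule, by
  \<open>dunkl_perm_act\<close>. It contains p, so irreducibility makes it all of V.\<close>

lemma irreducible_singular:
  assumes irr: "sym_irreducible N perm_act V" and p: "p \<in> V" "singular_poly N \<kappa> p"
    and v: "v \<in> V" and i: "i \<in> {1..N}"
  shows "dunkl N \<kappa> i v = 0"
proof -
  define W where "W = {v \<in> V. \<forall>i\<in>{1..N}. dunkl N \<kappa> i v = 0}"
  have V: "module.subspace qscale V" "\<And>w v. w permutes {1..N} \<Longrightarrow> v \<in> V \<Longrightarrow> perm_act w v \<in> V"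
    using irr by (auto simp: sym_irreducible_def sym_submodule_def)
  have z: "dunkl N \<kappa> i 0 = 0" for i using dunkl_add[of N \<kappa> i 0 0] by simp
  have q0: "qscale c (0 :: poly_q) = 0" for c by (auto intro!: poly_mapping_eqI)
  have "sym_submodule N perm_act W"
    unfolding sym_submodule_def
  proof (intro conjI allI impI)
    show "module.subspace qscale W"
      using V(1) unfolding subspace_qscale_iff
      by (auto simp: W_def z dunkl_add dunkl_qscale q0)
  next
    fix w v assume w: "w permutes {1..N}" and v: "v \<in> W"
    have "dunkl N \<kappa> i (perm_act w v) = 0" if i: "i \<in> {1..N}" for i
    proof -
      have "inv w i \<in> {1..N}" using permutes_in_image[OF permutes_inv[OF w]] i by blast
      moreover have "w (inv w i) = i" using permutes_inverses(1)[OF w] .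
      ultimately have "dunkl N \<kappa> i (perm_act w v) = perm_act w (dunkl N \<kappa> (inv w i) v)"
        using dunkl_perm_act[OF w, of "inv w i" \<kappa> v] by simp
      then show ?thesis using v \<open>inv w i \<in> {1..N}\<close> by (simp add: W_def)
    qed
    then show "perm_act w v \<in> W" using V(2)[OF w] v by (simp add: W_def)
  qed
  moreover have "W \<subseteq> V" by (auto simp: W_def)
  moreover have "p \<in> W" "p \<noteq> 0" using p by (auto simp: W_def singular_poly_def)
  ultimately have "W = V" using irr unfolding sym_irreducible_def by blast
  then have "\<forall>i\<in>{1..N}. dunkl N \<kappa> i v = 0" using v unfolding W_def by blast
  then show ?thesis using i by (rule bspec)
qed

section \<open>The generating family of a two-row Specht module\<close>

lemma qscale_single: "qscale c (Poly_Mapping.single a b) = Poly_Mapping.single a (c * b)"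
  by (auto intro!: poly_mapping_eqI simp: lookup_single when_def)

lemma polytabloid_eq:
  "polytabloid N \<mu> t = (\<Sum>\<sigma>\<in>column_stabilizer N \<mu> t.
     Poly_Mapping.single (\<lambda>r. \<sigma> ` tabloid_of \<mu> t r) (of_int (sign \<sigma>)))"
  by (simp add: polytabloid_def tabloid_act_def qscale_single)

lemma finite_column_stabilizer [simp]: "finite (column_stabilizer N \<mu> t)"
  by (rule finite_subset[of _ "{\<sigma>. \<sigma> permutes {1..N}}"])
    (auto simp: column_stabilizer_def intro: finite_permutations)

lemma tabloid_act_sum: "tabloid_act w (\<Sum>i\<in>S. f i) = (\<Sum>i\<in>S. tabloid_act w (f i))"
  by (induction S rule: infinite_finite_induct)
    (simp_all add: tabloid_act_def lin_ext_add, simp_all add: lin_ext_def)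

lemma tabloid_of_comp: "tabloid_of \<mu> (w \<circ> t) r = w ` tabloid_of \<mu> t r"
  by (auto simp: tabloid_of_def)

definition column :: "nat list \<Rightarrow> (nat \<times> nat \<Rightarrow> nat) \<Rightarrow> nat \<Rightarrow> nat set" where
  "column \<mu> t c = {t (r, c) | r. (r, c) \<in> diagram \<mu>}"

lemma column_comp: "column \<mu> (w \<circ> t) c = w ` column \<mu> t c"
  by (auto simp: column_def)

lemma column_stabilizer_iff:
  "\<sigma> \<in> column_stabilizer N \<mu> t \<longleftrightarrow> \<sigma> permutes {1..N} \<and> (\<forall>c. \<sigma> ` column \<mu> t c = column \<mu> t c)"
  by (simp add: column_stabilizer_def column_def)

lemma column_stabilizer_comp:
  assumes w: "w permutes {1..N}" and \<sigma>: "\<sigma> \<in> column_stabilizer N \<mu> t"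
  shows "w \<circ> \<sigma> \<circ> inv w \<in> column_stabilizer N \<mu> (w \<circ> t)"
proof -
  have \<sigma>': "\<sigma> permutes {1..N}" "\<sigma> ` column \<mu> t c = column \<mu> t c" for c
    using \<sigma> by (simp_all add: column_stabilizer_iff)
  have "(w \<circ> \<sigma> \<circ> inv w) ` w ` A = w ` \<sigma> ` A" for A
    using w by (simp add: image_image permutes_inverses)
  moreover have "w \<circ> \<sigma> \<circ> inv w permutes {1..N}"
    using w \<sigma>'(1) by (intro permutes_compose permutes_inv)
  ultimately show ?thesis by (simp add: column_stabilizer_iff column_comp \<sigma>'(2) del: o_apply)
qed

lemma sign_conj:
  assumes "w permutes S" "\<sigma> permutes S" "finite S"
  shows "sign (w \<circ> \<sigma> \<circ> inv w) = sign \<sigma>"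
proof -
  have "permutation w" "permutation \<sigma>" using assms permutation_permutes by blast+
  then have "sign (w \<circ> \<sigma> \<circ> inv w) = sign w * sign \<sigma> * sign w"
    by (simp add: sign_compose permutation_compose permutation_inverse sign_inverse)
  then show ?thesis by (simp add: sign_def)
qed

text \<open>Conjugation by w carries the column stabilizer of t to that of
  \<open>w \<circ> t\<close> and preserves signs.\<close>

lemma tabloid_act_polytabloid:
  assumes w: "w permutes {1..N}"
  shows "tabloid_act w (polytabloid N \<mu> t) = polytabloid N \<mu> (w \<circ> t)"
proof -
  have inv: "inv w \<circ> w = id" "w \<circ> inv w = id" using w by (auto simp: permutes_inv_o)
  have "tabloid_act w (polytabloid N \<mu> t) = (\<Sum>\<sigma>\<in>column_stabilizer N \<mu> t.
     Poly_Mapping.single (\<lambda>r. w ` \<sigma> ` tabloid_of \<mu> t r) (of_int (sign \<sigma>)))"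
    unfolding polytabloid_eq tabloid_act_sum by (simp add: tabloid_act_def)
  also have "\<dots> = (\<Sum>\<sigma>\<in>column_stabilizer N \<mu> (w \<circ> t).
     Poly_Mapping.single (\<lambda>r. \<sigma> ` tabloid_of \<mu> (w \<circ> t) r) (of_int (sign \<sigma>)))"
  proof (rule sum.reindex_bij_witness[of _ "\<lambda>\<sigma>. inv w \<circ> \<sigma> \<circ> w" "\<lambda>\<sigma>. w \<circ> \<sigma> \<circ> inv w"])
    fix \<sigma> assume \<sigma>: "\<sigma> \<in> column_stabilizer N \<mu> t"
    show "inv w \<circ> (w \<circ> \<sigma> \<circ> inv w) \<circ> w = \<sigma>"
      by (metis (no_types) comp_assoc id_comp comp_id inv(1))
    show "w \<circ> \<sigma> \<circ> inv w \<in> column_stabilizer N \<mu> (w \<circ> t)" by (rule column_stabilizer_comp[OF w \<sigma>])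
    have "sign (w \<circ> \<sigma> \<circ> inv w) = sign \<sigma>"
      using \<sigma> w by (intro sign_conj[of _ "{1..N}"]) (auto simp: column_stabilizer_def)
    moreover have "(w \<circ> \<sigma> \<circ> inv w) ` w ` A = w ` \<sigma> ` A" for A
      using w by (simp add: image_image permutes_inverses)
    ultimately show "Poly_Mapping.single (\<lambda>r. (w \<circ> \<sigma> \<circ> inv w) ` tabloid_of \<mu> (w \<circ> t) r) (of_int (sign (w \<circ> \<sigma> \<circ> inv w))) =
        Poly_Mapping.single (\<lambda>r. w ` \<sigma> ` tabloid_of \<mu> t r) (of_int (sign \<sigma>) :: rat)"
      by (simp add: tabloid_of_comp)
  next
    fix \<sigma> assume \<sigma>: "\<sigma> \<in> column_stabilizer N \<mu> (w \<circ> t)"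
    show "w \<circ> (inv w \<circ> \<sigma> \<circ> w) \<circ> inv w = \<sigma>"
      by (metis (no_types) comp_assoc id_comp comp_id inv(2))
    have "inv w \<circ> \<sigma> \<circ> inv (inv w) \<in> column_stabilizer N \<mu> (inv w \<circ> (w \<circ> t))"
      by (rule column_stabilizer_comp[OF permutes_inv[OF w] \<sigma>])
    then show "inv w \<circ> \<sigma> \<circ> w \<in> column_stabilizer N \<mu> t"
      using w by (simp add: permutes_inv_inv inv comp_assoc[symmetric])
  qed
  finally show ?thesis by (simp add: polytabloid_eq)
qed

text \<open>Composition with the transposition on the right permutes the column stabilizer and
  reverses every sign.\<close>

lemma polytabloid_column_transpose:
  assumes \<tau>: "transpose a b \<in> column_stabilizer N \<mu> t" and "a \<noteq> b"
  shows "polytabloid N \<mu> (transpose a b \<circ> t) = - polytabloid N \<mu> t"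
proof -
  let ?\<tau> = "transpose a b"
  have \<tau>\<tau>: "?\<tau> \<circ> ?\<tau> = id" by auto
  have stab: "column_stabilizer N \<mu> (?\<tau> \<circ> t) = column_stabilizer N \<mu> t"
    using \<tau> by (intro set_eqI) (simp only: column_stabilizer_iff column_comp)
  have closed: "\<sigma> \<circ> ?\<tau> \<in> column_stabilizer N \<mu> t" if "\<sigma> \<in> column_stabilizer N \<mu> t" for \<sigma>
    using that \<tau> unfolding column_stabilizer_iff image_comp[symmetric] by (simp add: permutes_compose)
  have "polytabloid N \<mu> (?\<tau> \<circ> t) = (\<Sum>\<sigma>\<in>column_stabilizer N \<mu> t.
     Poly_Mapping.single (\<lambda>r. (\<sigma> \<circ> ?\<tau>) ` tabloid_of \<mu> t r) (of_int (sign \<sigma>)))"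
    unfolding polytabloid_eq stab tabloid_of_comp by (simp add: image_comp)
  also have "\<dots> = (\<Sum>\<sigma>\<in>column_stabilizer N \<mu> t.
     - Poly_Mapping.single (\<lambda>r. \<sigma> ` tabloid_of \<mu> t r) (of_int (sign \<sigma>)))"
  proof (rule sum.reindex_bij_witness[of _ "\<lambda>\<sigma>. \<sigma> \<circ> ?\<tau>" "\<lambda>\<sigma>. \<sigma> \<circ> ?\<tau>"])
    fix \<sigma> assume \<sigma>: "\<sigma> \<in> column_stabilizer N \<mu> t"
    show "\<sigma> \<circ> ?\<tau> \<circ> ?\<tau> = \<sigma>" by (simp add: comp_assoc \<tau>\<tau>)
    show "\<sigma> \<circ> ?\<tau> \<in> column_stabilizer N \<mu> t" by (rule closed[OF \<sigma>])
    have "permutation \<sigma>" using \<sigma> by (auto simp: column_stabilizer_def permutation_permutes)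
    then have "sign (\<sigma> \<circ> ?\<tau>) = - sign \<sigma>"
      using assms(2) by (simp add: sign_compose permutation_swap_id sign_swap_id)
    then show "- Poly_Mapping.single (\<lambda>r. (\<sigma> \<circ> ?\<tau>) ` tabloid_of \<mu> t r) (of_int (sign (\<sigma> \<circ> ?\<tau>))) =
        Poly_Mapping.single (\<lambda>r. (\<sigma> \<circ> ?\<tau>) ` tabloid_of \<mu> t r) (of_int (sign \<sigma>) :: rat)"
      by (simp add: single_uminus)
  qed (use closed in \<open>auto simp: comp_assoc \<tau>\<tau>\<close>)
  finally show ?thesis by (simp add: polytabloid_eq sum_negf)
qed

text \<open>A column permutation that also preserves each row fixes every entry, because an entry is
  determined by its row and column. So only the identity contributes.\<close>

lemma lookup_polytabloid:
  assumes t: "t \<in> tableaux N \<mu>"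
  shows "Poly_Mapping.lookup (polytabloid N \<mu> t) (tabloid_of \<mu> t) = 1"
proof -
  have t': "bij_betw t (diagram \<mu>) {1..N}" using t by (simp add: tableaux_def)
  have "\<sigma> = id" if \<sigma>: "\<sigma> \<in> column_stabilizer N \<mu> t" and eq: "(\<lambda>r. \<sigma> ` tabloid_of \<mu> t r) = tabloid_of \<mu> t" for \<sigma>
  proof
    fix k
    show "\<sigma> k = id k"
    proof (cases "k \<in> {1..N}")
      case True
      then have "k \<in> t ` diagram \<mu>" using t' by (simp add: bij_betw_def)
      then obtain r c where rc: "(r, c) \<in> diagram \<mu>" "k = t (r, c)" by auto
      have "\<sigma> k \<in> \<sigma> ` tabloid_of \<mu> t r" using rc by (auto simp: tabloid_of_def)
      then have "\<sigma> k \<in> tabloid_of \<mu> t r" using fun_cong[OF eq, of r] by simp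
      then obtain c' where c': "(r, c') \<in> diagram \<mu>" "\<sigma> k = t (r, c')" by (auto simp: tabloid_of_def)
      have "\<sigma> k \<in> \<sigma> ` column \<mu> t c" using rc by (auto simp: column_def)
      moreover have "\<sigma> ` column \<mu> t c = column \<mu> t c" using \<sigma> by (simp only: column_stabilizer_iff)
      ultimately have "\<sigma> k \<in> column \<mu> t c" by simp
      then obtain r' where r': "(r', c) \<in> diagram \<mu>" "\<sigma> k = t (r', c)" by (auto simp: column_def)
      have "(r, c') = (r', c)" using c' r' t' by (metis bij_betw_def inj_onD)
      then show ?thesis using c' rc by simp
    next
      case False
      then show ?thesis using \<sigma> by (auto simp: column_stabilizer_def permutes_def)
    qed
  qed
  moreover have "id \<in> column_stabilizer N \<mu> t" by (simp add: column_stabilizer_def permutes_id)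
  ultimately have "Poly_Mapping.lookup (polytabloid N \<mu> t) (tabloid_of \<mu> t) =
      (\<Sum>\<sigma>\<in>column_stabilizer N \<mu> t. if \<sigma> = id then 1 else 0)"
    unfolding polytabloid_eq lookup_sum by (intro sum.cong) (auto simp: lookup_single when_def)
  then show ?thesis using \<open>id \<in> _\<close> by simp
qed

text \<open>Fixed points of h need no separate treatment: the whole sum equals its own negative,
  which over the rationals forces it to be zero.\<close>

lemma sum_antisymmetric_involution:
  fixes f :: "'b \<Rightarrow> ('a \<Rightarrow>\<^sub>0 rat)"
  assumes "\<And>t. t \<in> A \<Longrightarrow> h t \<in> A" "\<And>t. t \<in> A \<Longrightarrow> h (h t) = t" "\<And>t. t \<in> A \<Longrightarrow> f (h t) = - f t"
  shows "sum f A = 0"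
proof -
  have "sum f A = (\<Sum>t\<in>A. f (h t))"
    by (rule sum.reindex_bij_witness[of _ h h]) (use assms in auto)
  also have "\<dots> = - sum f A" using assms(3) by (simp add: sum_negf)
  finally have "Poly_Mapping.lookup (sum f A) k = - Poly_Mapping.lookup (sum f A) k" for k
    by (metis lookup_uminus uminus_apply)
  then show ?thesis by (intro poly_mapping_eqI) (simp add: equal_neg_zero)
qed

section \<open>Row sums of polytabloids for a two-row shape\<close>

locale two_row_shape =
  fixes N a n :: nat and \<mu> :: "nat list"
  assumes n_le_a: "n \<le> a" and N_def: "N = a + n" and \<mu>_def: "\<mu> = [a, n]"
begin

lemma diagram_iff: "(r, c) \<in> diagram \<mu> \<longleftrightarrow> (r = 0 \<and> c < a) \<or> (r = 1 \<and> c < n)"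
  by (auto simp: diagram_def \<mu>_def nth_Cons' less_Suc_eq)

text \<open>Tableaux are only determined on the diagram; requiring the value \<open>0\<close> elsewhere makes
  their set finite.\<close>

definition normal_tableaux :: "(nat \<times> nat \<Rightarrow> nat) set" where
  "normal_tableaux = {t \<in> tableaux N \<mu>. \<forall>p. p \<notin> diagram \<mu> \<longrightarrow> t p = 0}"

lemma finite_diagram: "finite (diagram \<mu>)"
  by (rule finite_subset[of _ "{0, 1} \<times> {..<a + n}"]) (auto simp: diagram_iff)

lemma finite_normal_tableaux: "finite normal_tableaux"
proof (rule finite_subset)
  show "normal_tableaux \<subseteq> {t. \<forall>p. (p \<in> diagram \<mu> \<longrightarrow> t p \<in> {1..N}) \<and> (p \<notin> diagram \<mu> \<longrightarrow> t p = 0)}"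
    by (force simp: normal_tableaux_def tableaux_def bij_betw_def)
  show "finite {t. \<forall>p. (p \<in> diagram \<mu> \<longrightarrow> t p \<in> {1..N}) \<and> (p \<notin> diagram \<mu> \<longrightarrow> t p = (0::nat))}"
    using finite_diagram by (intro finite_set_of_finite_funs) auto
qed

lemma normal_tableaux_comp:
  assumes w: "w permutes {1..N}" and t: "t \<in> normal_tableaux"
  shows "w \<circ> t \<in> normal_tableaux"
proof -
  have "bij_betw (w \<circ> t) (diagram \<mu>) {1..N}"
    using t permutes_imp_bij[OF w] by (auto simp: normal_tableaux_def tableaux_def intro: bij_betw_trans)
  moreover have "w 0 = 0" using w by (auto simp: permutes_def)
  ultimately show ?thesis using t by (auto simp: normal_tableaux_def tableaux_def)
qed

definition second_row :: "(nat \<times> nat \<Rightarrow> nat) \<Rightarrow> nat set" where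
  "second_row t = tabloid_of \<mu> t 1"

lemma second_row_eq: "second_row t = {t (1, c) | c. c < n}"
  by (auto simp: second_row_def tabloid_of_def diagram_iff)

lemma second_row_comp: "second_row (w \<circ> t) = w ` second_row t"
  by (simp add: second_row_def tabloid_of_comp)

lemma second_row_card:
  assumes "t \<in> normal_tableaux"
  shows "second_row t \<subseteq> {1..N}" "card (second_row t) = n"
proof -
  have t: "bij_betw t (diagram \<mu>) {1..N}" using assms by (simp add: normal_tableaux_def tableaux_def)
  have eq: "second_row t = t ` ({1} \<times> {..<n})" by (auto simp: second_row_eq)
  have sub: "{1} \<times> {..<n} \<subseteq> diagram \<mu>" by (auto simp: diagram_iff)
  show "second_row t \<subseteq> {1..N}" using t sub unfolding eq by (auto simp: bij_betw_def)
  have "inj_on t ({1} \<times> {..<n})" using t sub by (auto simp: bij_betw_def intro: inj_on_subset)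
  then show "card (second_row t) = n" unfolding eq by (simp add: card_image)
qed

lemma first_row_eq:
  assumes "t \<in> normal_tableaux"
  shows "tabloid_of \<mu> t 0 = {1..N} - second_row t"
proof -
  have t: "inj_on t (diagram \<mu>)" "t ` diagram \<mu> = {1..N}"
    using assms by (simp_all add: normal_tableaux_def tableaux_def bij_betw_def)
  have "{1..N} = tabloid_of \<mu> t 0 \<union> second_row t"
    unfolding t(2)[symmetric] by (force simp: second_row_eq tabloid_of_def diagram_iff)
  moreover have "tabloid_of \<mu> t 0 \<inter> second_row t = {}"
    using t(1) by (fastforce simp: second_row_eq tabloid_of_def diagram_iff dest: inj_onD)
  ultimately show ?thesis by blast
qed

lemma tabloid_eq_if_second_row_eq:
  assumes "t \<in> normal_tableaux" "t' \<in> normal_tableaux" "second_row t = second_row t'"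
  shows "tabloid_of \<mu> t = tabloid_of \<mu> t'"
proof
  fix r :: nat
  consider "r = 0" | "r = 1" | "r \<ge> 2" by linarith
  then show "tabloid_of \<mu> t r = tabloid_of \<mu> t' r"
  proof cases
    case 1
    then show ?thesis using assms first_row_eq by simp
  next
    case 2
    then show ?thesis using assms(3) by (simp only: second_row_def)
  next
    case 3
    then show ?thesis by (auto simp: tabloid_of_def diagram_iff)
  qed
qed

text \<open>A vector of the Specht module that depends on I alone and is fixed by every permutation
  preserving I. For I of size n it is, up to a nonzero factor, the projection to the Specht module
  of the tabloid with second row I.\<close>

definition row_sum :: "nat set \<Rightarrow> (tabloid \<Rightarrow>\<^sub>0 rat)" where
  "row_sum I = (\<Sum>t\<in>{t \<in> normal_tableaux. second_row t = I}. polytabloid N \<mu> t)"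

lemma row_sum_in_specht: "row_sum I \<in> specht N \<mu>"
  unfolding row_sum_def specht_def
  by (intro module.span_sum[OF module_qscale] module.span_base[OF module_qscale])
    (auto simp: normal_tableaux_def)

lemma tabloid_act_row_sum:
  assumes w: "w permutes {1..N}"
  shows "tabloid_act w (row_sum I) = row_sum (w ` I)"
proof -
  have inv: "inv w \<circ> w = id" "w \<circ> inv w = id" using w by (auto simp: permutes_inv_o)
  have "tabloid_act w (row_sum I) = (\<Sum>t\<in>{t \<in> normal_tableaux. second_row t = I}. polytabloid N \<mu> (w \<circ> t))"
    unfolding row_sum_def tabloid_act_sum by (simp add: tabloid_act_polytabloid[OF w])
  also have "\<dots> = row_sum (w ` I)"
    unfolding row_sum_def
  proof (rule sum.reindex_bij_witness[of _ "\<lambda>t. inv w \<circ> t" "\<lambda>t. w \<circ> t"])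
    fix t assume t: "t \<in> {t \<in> normal_tableaux. second_row t = I}"
    show "inv w \<circ> (w \<circ> t) = t" by (simp add: comp_assoc[symmetric] inv)
    show "w \<circ> t \<in> {t \<in> normal_tableaux. second_row t = w ` I}"
      using t normal_tableaux_comp[OF w] by (simp add: second_row_comp)
  next
    fix t assume t: "t \<in> {t \<in> normal_tableaux. second_row t = w ` I}"
    show "w \<circ> (inv w \<circ> t) = t" by (simp add: comp_assoc[symmetric] inv)
    have "inv w ` w ` I = I" using w by (simp add: image_image permutes_inverses)
    then show "inv w \<circ> t \<in> {t \<in> normal_tableaux. second_row t = I}"
      using t normal_tableaux_comp[OF permutes_inv[OF w]] by (simp add: second_row_comp)
  qed simp
  finally show ?thesis .
qed

text \<open>Garnir-type cancellation: exactly one box of the second row holds an element outside \<open>J\<close>,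
  and exchanging it with the box above it changes the sign of the polytabloid.\<close>

lemma sum_row_sum_insert:
  assumes J: "J \<subseteq> {1..N}" "Suc (card J) = n"
  shows "(\<Sum>i\<in>{1..N} - J. row_sum (insert i J)) = 0"
proof -
  define B where "B c i = {t \<in> normal_tableaux. second_row t = insert i J \<and> t (1, c) = i}" for c i
  define C where "C c = {t \<in> normal_tableaux. second_row t = insert (t (1, c)) J \<and> t (1, c) \<notin> J}" for c
  have inj: "inj_on t (diagram \<mu>)" if "t \<in> normal_tableaux" for t
    using that by (simp add: normal_tableaux_def tableaux_def bij_betw_def)
  have fB: "finite (B c i)" for c i unfolding B_def using finite_normal_tableaux by simp
  have fC: "finite (C c)" for c unfolding C_def using finite_normal_tableaux by simp
  have row: "row_sum (insert i J) = (\<Sum>c<n. sum (polytabloid N \<mu>) (B c i))" for i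
  proof -
    have "\<exists>c<n. t (1, c) = i" if "second_row t = insert i J" for t
    proof -
      have "i \<in> second_row t" using that by simp
      then show ?thesis unfolding second_row_eq by auto
    qed
    then have "{t \<in> normal_tableaux. second_row t = insert i J} = (\<Union>c\<in>{..<n}. B c i)"
      unfolding B_def by blast
    moreover have "B c i \<inter> B c' i = {}" if "c \<in> {..<n}" "c' \<in> {..<n}" "c \<noteq> c'" for c c'
    proof -
      have "(1, c) \<in> diagram \<mu>" "(1, c') \<in> diagram \<mu>" using that by (auto simp: diagram_iff)
      then have ne: "t (1, c) \<noteq> t (1, c')" if "t \<in> normal_tableaux" for t
        using inj_onD[OF inj[OF that], of "(1, c)" "(1, c')"] \<open>c \<noteq> c'\<close> by auto
      have False if "t \<in> B c i" "t \<in> B c' i" for t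
        using that ne[of t] by (simp add: B_def)
      then show ?thesis by blast
    qed
    ultimately show ?thesis
      unfolding row_sum_def using fB by (simp only:) (rule sum.UNION_disjoint, auto)
  qed
  have "(\<Sum>i\<in>{1..N} - J. row_sum (insert i J)) = (\<Sum>c<n. \<Sum>i\<in>{1..N} - J. sum (polytabloid N \<mu>) (B c i))"
    unfolding row by (rule sum.swap)
  also have "\<dots> = (\<Sum>c<n. sum (polytabloid N \<mu>) (C c))"
  proof (rule sum.cong[OF refl])
    fix c assume c: "c \<in> {..<n}"
    have "(\<Sum>i\<in>{1..N} - J. sum (polytabloid N \<mu>) {t \<in> C c. t (1, c) = i}) = sum (polytabloid N \<mu>) (C c)"
    proof (rule sum.group[OF fC])
      have "t (1, c) \<in> second_row t" for t using c by (auto simp: second_row_eq)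
      then have "t (1, c) \<in> {1..N} - J" if "t \<in> C c" for t
        using that second_row_card(1)[of t] unfolding C_def by blast
      then show "(\<lambda>t. t (1, c)) ` C c \<subseteq> {1..N} - J" by (rule image_subsetI)
    qed simp
    moreover have "{t \<in> C c. t (1, c) = i} = B c i" if "i \<in> {1..N} - J" for i
      using that unfolding B_def C_def by blast
    ultimately show "(\<Sum>i\<in>{1..N} - J. sum (polytabloid N \<mu>) (B c i)) = sum (polytabloid N \<mu>) (C c)" by simp
  qed
  also have "\<dots> = 0"
  proof (rule sum.neutral, rule ballI)
    fix c assume c: "c \<in> {..<n}"
    let ?h = "\<lambda>t. transpose (t (0, c)) (t (1, c)) \<circ> t"
    have dia: "(0, c) \<in> diagram \<mu>" "(1, c) \<in> diagram \<mu>" using c n_le_a by (auto simp: diagram_iff)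
    have facts: "t (0, c) \<noteq> t (1, c)" "t (0, c) \<notin> J" "transpose (t (0, c)) (t (1, c)) permutes {1..N}"
      "transpose (t (0, c)) (t (1, c)) \<in> column_stabilizer N \<mu> t" if t: "t \<in> C c" for t
    proof -
      have t': "t \<in> normal_tableaux" using t by (simp add: C_def)
      have im: "t p \<in> {1..N}" if "p \<in> diagram \<mu>" for p
        using t' that by (auto simp: normal_tableaux_def tableaux_def bij_betw_def)
      have "t (0, c) \<notin> second_row t"
      proof
        assume "t (0, c) \<in> second_row t"
        then obtain c' where c': "c' < n" "t (0, c) = t (1, c')" unfolding second_row_eq by auto
        then have "(1, c') \<in> diagram \<mu>" by (simp add: diagram_iff)
        then show False using inj_onD[OF inj[OF t'] c'(2) dia(1)] by simp
      qed
      moreover have "second_row t = insert (t (1, c)) J" using t by (simp add: C_def)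
      ultimately show "t (0, c) \<noteq> t (1, c)" "t (0, c) \<notin> J" by auto
      show per: "transpose (t (0, c)) (t (1, c)) permutes {1..N}"
        using im dia by (intro permutes_swap_id)
      have "transpose (t (0, c)) (t (1, c)) ` column \<mu> t c' = column \<mu> t c'" for c'
      proof (cases "c' = c")
        case True
        have "t (0, c) \<in> column \<mu> t c'" "t (1, c) \<in> column \<mu> t c'" using True dia by (auto simp: column_def)
        then show ?thesis by (rule transpose_image_both)
      next
        case False
        have "t (r, c) \<notin> column \<mu> t c'" if "(r, c) \<in> diagram \<mu>" for r
          using False inj_onD[OF inj[OF t'], of "(r, c)"] that by (auto simp: column_def)
        then show ?thesis using dia by (intro transpose_image_neither)
      qed
      then show "transpose (t (0, c)) (t (1, c)) \<in> column_stabilizer N \<mu> t"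
        using per unfolding column_stabilizer_iff by blast
    qed
    show "sum (polytabloid N \<mu>) (C c) = 0"
    proof (rule sum_antisymmetric_involution[of _ ?h])
      fix t assume t: "t \<in> C c"
      have t': "t \<in> normal_tableaux" "second_row t = insert (t (1, c)) J" "t (1, c) \<notin> J"
        using t by (auto simp: C_def)
      have "transpose (t (0, c)) (t (1, c)) ` J = J" using facts[OF t] t' by (intro transpose_image_neither)
      then have "second_row (?h t) = insert (t (0, c)) J"
        unfolding second_row_comp t'(2) by simp
      then show "?h t \<in> C c"
        using normal_tableaux_comp[OF facts(3)[OF t] t'(1)] facts[OF t] by (simp add: C_def)
      show "?h (?h t) = t" by (auto simp: transpose_commute)
      show "polytabloid N \<mu> (?h t) = - polytabloid N \<mu> t"
        using facts[OF t] by (intro polytabloid_column_transpose)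
    qed
  qed
  finally show ?thesis .
qed

text \<open>All normal tableaux with second row I share one tabloid, and each of their polytabloids
  contains it with coefficient 1. Its coefficient in the row sum is thus a number of tableaux, and
  nothing cancels.\<close>

lemma row_sum_nonzero: "\<exists>I. I \<subseteq> {1..N} \<and> card I = n \<and> row_sum I \<noteq> 0"
proof -
  have "diagram \<mu> = {0} \<times> {..<a} \<union> {1} \<times> {..<n}" by (auto simp: diagram_iff)
  then have "card (diagram \<mu>) = card {1..N}"
    by (simp add: card_Un_disjoint N_def disjoint_iff)
  then obtain t where t: "bij_betw t (diagram \<mu>) {1..N}"
    using finite_diagram finite_same_card_bij by blast
  define t0 where "t0 = (\<lambda>p. if p \<in> diagram \<mu> then t p else 0)"
  have "bij_betw t0 (diagram \<mu>) {1..N}" using t by (simp add: t0_def cong: bij_betw_cong)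
  then have t0: "t0 \<in> normal_tableaux" by (simp add: normal_tableaux_def tableaux_def t0_def)
  let ?I = "second_row t0" and ?A = "{t \<in> normal_tableaux. second_row t = second_row t0}"
  have "Poly_Mapping.lookup (row_sum ?I) (tabloid_of \<mu> t0) = (\<Sum>t\<in>?A. 1)"
    unfolding row_sum_def lookup_sum
  proof (rule sum.cong[OF refl])
    fix t assume t: "t \<in> ?A"
    then have "tabloid_of \<mu> t0 = tabloid_of \<mu> t" using t0 by (intro tabloid_eq_if_second_row_eq) auto
    moreover have "t \<in> tableaux N \<mu>" using t by (simp add: normal_tableaux_def)
    ultimately show "Poly_Mapping.lookup (polytabloid N \<mu> t) (tabloid_of \<mu> t0) = 1"
      by (simp add: lookup_polytabloid)
  qed
  also have "\<dots> \<noteq> 0" using t0 finite_normal_tableaux by (auto simp: card_gt_0_iff)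
  finally have "row_sum ?I \<noteq> 0" by auto
  then show ?thesis using second_row_card[OF t0] by blast
qed

text \<open>The family consists of the preimages of the row sums under the isomorphism, which
  transports their permutation behaviour and the sum relation. The Dunkl equations come from
  \<open>irreducible_singular\<close>, evaluated where the divided differences are honest
  quotients.\<close>

lemma singular_family_of_isotype:
  assumes p: "singular_poly N \<kappa> p" "of_isotype N \<mu> p"
  shows "\<exists>F. singular_family (- \<kappa>) {1..N} n F \<and> (\<exists>I. I \<subseteq> {1..N} \<and> card I = n \<and> F I \<noteq> 0)"
proof -
  obtain k V where V: "V \<subseteq> homogeneous_polys N k" "sym_irreducible N perm_act V"
    "sym_isomorphic N perm_act V tabloid_act (specht N \<mu>)" "p \<in> V"
    using p(2) by (auto simp: of_isotype_def)
  obtain \<phi> where \<phi>: "bij_betw \<phi> V (specht N \<mu>)" "\<And>u v. u \<in> V \<Longrightarrow> v \<in> V \<Longrightarrow> \<phi> (u + v) = \<phi> u + \<phi> v"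
    "\<And>w v. w permutes {1..N} \<Longrightarrow> v \<in> V \<Longrightarrow> \<phi> (perm_act w v) = tabloid_act w (\<phi> v)"
    using V(3) by (auto simp: sym_isomorphic_def)
  have sub: "0 \<in> V" "\<And>u v. u \<in> V \<Longrightarrow> v \<in> V \<Longrightarrow> u + v \<in> V"
    "\<And>w v. w permutes {1..N} \<Longrightarrow> v \<in> V \<Longrightarrow> perm_act w v \<in> V"
    using V(2) by (auto simp: sym_irreducible_def sym_submodule_def subspace_qscale_iff)
  have inj: "u = v" if "u \<in> V" "v \<in> V" "\<phi> u = \<phi> v" for u v
    using that \<phi>(1) by (auto simp: bij_betw_def dest: inj_onD)
  have \<phi>0: "\<phi> 0 = 0" using \<phi>(2)[of 0 0] sub(1) by simp
  have \<phi>_sum: "(\<Sum>i\<in>S. f i) \<in> V \<and> \<phi> (\<Sum>i\<in>S. f i) = (\<Sum>i\<in>S. \<phi> (f i))"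
    if "finite S" "\<And>i. i \<in> S \<Longrightarrow> f i \<in> V" for S :: "nat set" and f
    using that by (induction S) (auto simp: \<phi>0 sub \<phi>(2))
  define F where "F I = inv_into V \<phi> (row_sum I)" for I
  have F: "F I \<in> V" "\<phi> (F I) = row_sum I" for I
    using \<phi>(1) row_sum_in_specht[of I] unfolding F_def
    by (auto simp: bij_betw_def intro: inv_into_into f_inv_into_f)
  have perm: "perm_act w (F I) = F (w ` I)" if w: "w permutes {1..N}" for w I
    using \<phi>(3)[OF w F(1), of I] F by (intro inj sub(3) w) (simp_all add: tabloid_act_row_sum[OF w])
  have swap: "perm_act (transpose i j) (F I) = F (transpose i j ` I)" if "i \<in> {1..N}" "j \<in> {1..N}" for i j I
    using that by (intro perm permutes_swap_id)
  have "singular_family (- \<kappa>) {1..N} n F"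
  proof
    fix I
    show "vars (F I) \<subseteq> {1..N}"
      using F(1)[of I] V(1) by (fastforce simp: homogeneous_polys_def polys_def vars_def)
    show "poly_eval (F (transpose i j ` I)) x = poly_eval (F I) (x \<circ> transpose i j)"
      if "i \<in> {1..N}" "j \<in> {1..N}" for i j x
      by (simp add: poly_eval_perm_act comp_def flip: swap[OF that])
    show "poly_eval (partial_deriv i (F I)) x = - \<kappa> * (\<Sum>j\<in>{1..N} - {i}.
        (poly_eval (F I) x - poly_eval (F (transpose i j ` I)) x) / (x i - x j))"
      if i: "i \<in> {1..N}" and x: "\<And>j. j \<in> {1..N} - {i} \<Longrightarrow> x j \<noteq> x i" for i x
    proof -
      have "dunkl N \<kappa> i (F I) = 0" using irreducible_singular[OF V(2,4) p(1) F(1) i] .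
      then have "poly_eval (dunkl N \<kappa> i (F I)) x = 0" by simp
      then have "poly_eval (partial_deriv i (F I)) x = - \<kappa> * (\<Sum>j\<in>{1..N} - {i}. poly_eval (div_diff i j (F I)) x)"
        by (simp add: dunkl_def poly_eval_add poly_eval_qscale poly_eval_sum)
      also have "(\<Sum>j\<in>{1..N} - {i}. poly_eval (div_diff i j (F I)) x) = (\<Sum>j\<in>{1..N} - {i}.
          (poly_eval (F I) x - poly_eval (F (transpose i j ` I)) x) / (x i - x j))"
      proof (rule sum.cong[OF refl])
        fix j assume j: "j \<in> {1..N} - {i}"
        then have "i \<noteq> j" "j \<in> {1..N}" by auto
        have "poly_eval (div_diff i j (F I) * (X i - X j)) x = poly_eval (F I - F (transpose i j ` I)) x"
          unfolding div_diff_mult[OF \<open>i \<noteq> j\<close>] swap[OF i \<open>j \<in> {1..N}\<close>] ..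
        then show "poly_eval (div_diff i j (F I)) x =
            (poly_eval (F I) x - poly_eval (F (transpose i j ` I)) x) / (x i - x j)"
          using x[OF j] by (simp add: poly_eval_mult poly_eval_diff field_simps)
      qed
      finally show ?thesis .
    qed
  next
    fix J assume J: "J \<subseteq> {1..N}" "Suc (card J) = n"
    have "(\<Sum>i\<in>{1..N} - J. F (insert i J)) \<in> V \<and>
        \<phi> (\<Sum>i\<in>{1..N} - J. F (insert i J)) = (\<Sum>i\<in>{1..N} - J. \<phi> (F (insert i J)))"
      using F(1) by (intro \<phi>_sum) auto
    then show "(\<Sum>i\<in>{1..N} - J. F (insert i J)) = 0"
      using sum_row_sum_insert[OF J] by (intro inj) (simp_all add: sub(1) \<phi>0 F(2))
  qed simp
  moreover obtain I where "I \<subseteq> {1..N}" "card I = n" "row_sum I \<noteq> 0" using row_sum_nonzero by blast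
  moreover from this have "F I \<noteq> 0" using F(2)[of I] \<phi>0 by auto
  ultimately show ?thesis by blast
qed

end

theorem theorem5:
  fixes m n d N :: nat and \<kappa>\<^sub>0 :: rat and \<tau> :: "nat list"
  assumes "m > 0" and "n > 0" and "d > 0"
    and "coprime m n"
    and "d \<ge> 2" and "n \<ge> 2"
    and "\<kappa>\<^sub>0 = - (of_nat m / of_nat n)"
    and "\<tau> = [d * n - 1, n]"
    and "N = (d + 1) * n - 1"
  shows "\<not> (\<exists>p. singular_poly N \<kappa>\<^sub>0 p \<and> of_isotype N \<tau> p)"
proof
  assume "\<exists>p. singular_poly N \<kappa>\<^sub>0 p \<and> of_isotype N \<tau> p"
  then obtain p where p: "singular_poly N \<kappa>\<^sub>0 p" "of_isotype N \<tau> p" by blast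
  have dn: "2 * n \<le> d * n" using assms by simp
  have "(d + 1) * n = d * n + n" by simp
  then have N: "N = d * n - 1 + n" using assms dn by linarith
  interpret two_row m n d "- \<kappa>\<^sub>0" using assms by unfold_locales auto
  interpret two_row_shape N "d * n - 1" n \<tau> using assms dn N by unfold_locales linarith+
  obtain F where "singular_family (- \<kappa>\<^sub>0) {1..N} n F" "\<exists>I. I \<subseteq> {1..N} \<and> card I = n \<and> F I \<noteq> 0"
    using singular_family_of_isotype[OF p] by blast
  then have "family n {1..N} F" using N by (simp add: family_def)
  then show False using no_family by blast
qed

end
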